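(* Assume that $\Gamma$ satisfies the doubling property $(D)$, the condition $(\Delta(\alpha))$ for some $\alpha>0$, and the $L^1$ Poincaré inequality on balls $(P_1)$. Then for all $t\in(1,+\infty]$, $$\dot S^{1,1}(\Gamma)=\dot M^{1,1}(\Gamma)=\dot HS^1_{\max}(\Gamma)=\dot HS^1_{t,ato}(\Gamma).$$ In particular, $\dot HS^1_{t,ato}(\Gamma)$ does not depend on $t$.
   Context: Setting. $\Gamma$ is an infinite set with a symmetric weight $\mu_{xy}=\mu_{yx}\ge 0$ on $\Gamma\times\Gamma$; $x\sim y$ iff $\mu_{xy}>0$, and $E=\{(x,y)\in\Gamma\times\Gamma:\mu_{xy}>0\}$. $\Gamma$ is connected (any two points are joined by a finite path $x_0\sim x_1\sim\dots\sim x_N$); $d(x,y)$ is the shortest length of a path joining $x$ to $y$; $B(x,r)=\{y: d(x,y)\le r\}$. A ball $B$ comes with its centre and radius $r(B)$. $\Gamma$ is locally uniformly finite: there is $N$ with $\#B(x,1)\le N$ for all $x$. $m(x)=\sum_{y\sim x}\mu_{xy}$, assumed $>0$ for all $x$; $m(\Omega)=\sum_{x\in\Omega}m(x)$, $V(x,r)=m(B(x,r))$, $V(B)=m(B)$. $p(x,y)=\mu_{xy}/m(x)$. $L^p(\Gamma)$ is the space of real functions with $\|f\|_{L^p(\Gamma)}=(\sum_x|f(x)|^pm(x))^{1/p}<\infty$ (sup norm if $p=\infty$). $\nabla f(x)=\big(\frac12\sum_{y}p(x,y)|f(y)-f(x)|^2\big)^{1/2}$. $f_B=\frac1{V(B)}\sum_{x\in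 B}f(x)m(x)$. $(D)$: there is $C>0$ with $V(x,2r)\le CV(x,r)$ for all $x\in\Gamma$, $r>0$. $(\Delta(\alpha))$: for all $x,y\in\Gamma$, ($x\sim y\Leftrightarrow\mu_{xy}\ge\alpha m(x)$), and $x\sim x$. $(P_1)$: there is $C>0$ such that for all functions $f$ on $\Gamma$ and all balls $B$ of radius $r>0$, $\sum_{x\in B}|f(x)-f_B|m(x)\le Cr\sum_{x\in B}\nabla f(x)m(x)$. For $\Omega\subset\Gamma$: $\partial\Omega=\{x\in\Omega:\exists y\sim x,\ y\notin\Omega\}$, $\overset{\circ}{\Omega}=\Omega\setminus\partial\Omega$, $E_\Omega=\{(x,y)\in\Omega\times\Omega: x\sim y\}$. For antisymmetric $F$ (i.e. $F(x,y)=-F(y,x)$), $\|F\|_{L^\infty(E_\Omega)}=\frac12\sup_{E_\Omega}|F|$ and $\delta F(x)=\sum_{y\sim x}p(x,y)F(x,y)$. Maximal functions: $Nf(x)=\sup_{B\ni x}\frac1{r(B)V(B)}\sum_{y\in B}|f(y)-f_B|m(y)$, the supremum over balls $B\ni x$ with $r(B)>0$. $\mathcal M^+f(x)=\sup_F\big|\sum_{y\in\overset{\circ}{B}}f(y)\,\delta F(y)\,m(y)\big|$, the supremum over all balls $B\ni x$ and all antisymmetric $F:E\to\mathbb R$ supported in $E_B$ with $\|F\|_{L^\infty(E_B)}\le\frac1{V(B)}$ and $\|\delta F\|_{L^\infty(\overset{\circ}{B})}\le\frac1{r(B)V(B)}$. Spaces: $\dot S^{1,1}(\Gamma)$ (resp.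 $\dot HS^1_{\max}(\Gamma)$) is the space of functions $f$ on $\Gamma$ with $Nf\in L^1(\Gamma)$ (resp. $\mathcal M^+f\in L^1(\Gamma)$), with semi-norm the $L^1$ norm of that quantity. $\dot M^{1,1}(\Gamma)$ is the space of functions $f$ for which there is a nonnegative $g\in L^1(\Gamma)$ with $|f(x)-f(y)|\le d(x,y)(g(x)+g(y))$ for all $x,y\in\Gamma$, with semi-norm $\inf_g\|g\|_{L^1(\Gamma)}$. Atoms: for $1<t\le\infty$ and $\frac1t+\frac1{t'}=1$, a homogeneous Hardy-Sobolev $(1,t)$-atom is a function $a$ on $\Gamma$ supported in a ball $B$ with $\|\nabla a\|_{L^t(\Gamma)}\le V(B)^{-1/t'}$ and $\sum_xa(x)m(x)=0$. $\dot HS^1_{t,ato}(\Gamma)$ is the space of functions $f$ that can be written $f=\sum_i\lambda_ia_i$ with $(\lambda_i)\in\ell^1$ and $a_i$ homogeneous Hardy-Sobolev $(1,t)$-atoms, the convergence being in $\dot W^{1,1}(\Gamma)$, i.e. $\|\nabla(f-\sum_{i\le k}\lambda_ia_i)\|_{L^1(\Gamma)}\to0$ as $k\to\infty$; its semi-norm is $\inf\sum_i|\lambda_i|$ over all such decompositions.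
   Formalization: In the definition of M⁺ the fields F are required to be supported in the edges of the interior of B, not merely in E_B; with the printed support condition M⁺1 is bounded below by a positive constant, so constants would lie in the other spaces but not in HS¹_max. *)

theory Defs
  imports "HOL-Analysis.Analysis"
begin

section \<open>Weighted graphs\<close>

text \<open>The vertex set \<open>\<Gamma>\<close> is the whole type \<open>'v\<close>; the weight is a function \<open>\<mu>\<close> of two vertices.\<close>

definition adj :: "('v \<Rightarrow> 'v \<Rightarrow> real) \<Rightarrow> 'v \<Rightarrow> 'v \<Rightarrow> bool" where
  "adj \<mu> x y \<longleftrightarrow> \<mu> x y > 0"

text \<open>\<open>(adj \<mu> ^^ n) x y\<close> says that some path \<open>x = x\<^sub>0 \<sim> \<dots> \<sim> x\<^sub>n = y\<close> of length \<open>n\<close> exists.\<close>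

definition gdist :: "('v \<Rightarrow> 'v \<Rightarrow> real) \<Rightarrow> 'v \<Rightarrow> 'v \<Rightarrow> nat" where
  "gdist \<mu> x y = (LEAST n. (adj \<mu> ^^ n) x y)"

definition gball :: "('v \<Rightarrow> 'v \<Rightarrow> real) \<Rightarrow> 'v \<Rightarrow> real \<Rightarrow> 'v set" where
  "gball \<mu> x r = {y. real (gdist \<mu> x y) \<le> r}"

definition vmass :: "('v \<Rightarrow> 'v \<Rightarrow> real) \<Rightarrow> 'v \<Rightarrow> real" where
  "vmass \<mu> x = (\<Sum>y | adj \<mu> x y. \<mu> x y)"

text \<open>Only used for finite \<open>\<Omega>\<close> (balls are finite under local uniform finiteness).\<close>

definition vol :: "('v \<Rightarrow> 'v \<Rightarrow> real) \<Rightarrow> 'v set \<Rightarrow> real" where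
  "vol \<mu> \<Omega> = (\<Sum>x\<in>\<Omega>. vmass \<mu> x)"

definition kernel :: "('v \<Rightarrow> 'v \<Rightarrow> real) \<Rightarrow> 'v \<Rightarrow> 'v \<Rightarrow> real" where
  "kernel \<mu> x y = \<mu> x y / vmass \<mu> x"

locale weighted_graph =
  fixes \<mu> :: "'v \<Rightarrow> 'v \<Rightarrow> real"
  assumes infinite_vertices: "infinite (UNIV :: 'v set)"
    and weight_nonneg: "0 \<le> \<mu> x y"
    and weight_sym: "\<mu> x y = \<mu> y x"
    and connected_graph: "(adj \<mu>)\<^sup>*\<^sup>* x y"
    and locally_uniformly_finite: "\<exists>N. \<forall>x. finite (gball \<mu> x 1) \<and> card (gball \<mu> x 1) \<le> N"
    and vmass_pos: "0 < vmass \<mu> x"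


section \<open>Function spaces, gradient, averages\<close>

definition vmeasure :: "('v \<Rightarrow> 'v \<Rightarrow> real) \<Rightarrow> 'v measure" where
  "vmeasure \<mu> = point_measure UNIV (\<lambda>x. ennreal (vmass \<mu> x))"

definition Lp_norm :: "('v \<Rightarrow> 'v \<Rightarrow> real) \<Rightarrow> ennreal \<Rightarrow> ('v \<Rightarrow> real) \<Rightarrow> ennreal" where
  "Lp_norm \<mu> p f =
    (if p = \<infinity> then (SUP x. ennreal \<bar>f x\<bar>)
     else (let I = (\<integral>\<^sup>+x. ennreal (\<bar>f x\<bar> powr enn2real p) \<partial>vmeasure \<mu>)
           in if I = \<infinity> then \<infinity> else ennreal (enn2real I powr (1 / enn2real p))))"

text \<open>The sum runs over the neighbours of \<open>x\<close> only, since \<open>kernel \<mu> x y = 0\<close> for the other \<open>y\<close>.\<close>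

definition grad :: "('v \<Rightarrow> 'v \<Rightarrow> real) \<Rightarrow> ('v \<Rightarrow> real) \<Rightarrow> 'v \<Rightarrow> real" where
  "grad \<mu> f x = sqrt (1 / 2 * (\<Sum>y | adj \<mu> x y. kernel \<mu> x y * \<bar>f y - f x\<bar>\<^sup>2))"

definition avg :: "('v \<Rightarrow> 'v \<Rightarrow> real) \<Rightarrow> 'v set \<Rightarrow> ('v \<Rightarrow> real) \<Rightarrow> real" where
  "avg \<mu> B f = 1 / vol \<mu> B * (\<Sum>x\<in>B. f x * vmass \<mu> x)"


section \<open>Geometric hypotheses\<close>

definition doubling :: "('v \<Rightarrow> 'v \<Rightarrow> real) \<Rightarrow> bool" where
  "doubling \<mu> \<longleftrightarrow>
    (\<exists>C>0. \<forall>x. \<forall>r>0. vol \<mu> (gball \<mu> x (2 * r)) \<le> C * vol \<mu> (gball \<mu> x r))"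

definition Delta_cond :: "('v \<Rightarrow> 'v \<Rightarrow> real) \<Rightarrow> real \<Rightarrow> bool" where
  "Delta_cond \<mu> \<alpha> \<longleftrightarrow>
    (\<forall>x y. (adj \<mu> x y \<longleftrightarrow> \<mu> x y \<ge> \<alpha> * vmass \<mu> x) \<and> adj \<mu> x x)"

definition poincare1 :: "('v \<Rightarrow> 'v \<Rightarrow> real) \<Rightarrow> bool" where
  "poincare1 \<mu> \<longleftrightarrow>
    (\<exists>C>0. \<forall>(f :: 'v \<Rightarrow> real) z. \<forall>r>0.
      (\<Sum>x\<in>gball \<mu> z r. \<bar>f x - avg \<mu> (gball \<mu> z r) f\<bar> * vmass \<mu> x)
        \<le> C * r * (\<Sum>x\<in>gball \<mu> z r. grad \<mu> f x * vmass \<mu> x))"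


section \<open>Maximal functions\<close>

definition vboundary :: "('v \<Rightarrow> 'v \<Rightarrow> real) \<Rightarrow> 'v set \<Rightarrow> 'v set" where
  "vboundary \<mu> \<Omega> = {x \<in> \<Omega>. \<exists>y. adj \<mu> x y \<and> y \<notin> \<Omega>}"

definition vinterior :: "('v \<Rightarrow> 'v \<Rightarrow> real) \<Rightarrow> 'v set \<Rightarrow> 'v set" where
  "vinterior \<mu> \<Omega> = \<Omega> - vboundary \<mu> \<Omega>"

definition edges_in :: "('v \<Rightarrow> 'v \<Rightarrow> real) \<Rightarrow> 'v set \<Rightarrow> ('v \<times> 'v) set" where
  "edges_in \<mu> \<Omega> = {(x, y) \<in> \<Omega> \<times> \<Omega>. adj \<mu> x y}"

text \<open>Functions on the edge set are represented as total functions vanishing off the edges.\<close>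

definition edge_sup_norm :: "('v \<Rightarrow> 'v \<Rightarrow> real) \<Rightarrow> 'v set \<Rightarrow> ('v \<Rightarrow> 'v \<Rightarrow> real) \<Rightarrow> ennreal" where
  "edge_sup_norm \<mu> \<Omega> F = (SUP (x, y) \<in> edges_in \<mu> \<Omega>. ennreal \<bar>F x y\<bar>) / 2"

definition vdiv :: "('v \<Rightarrow> 'v \<Rightarrow> real) \<Rightarrow> ('v \<Rightarrow> 'v \<Rightarrow> real) \<Rightarrow> 'v \<Rightarrow> real" where
  "vdiv \<mu> F x = (\<Sum>y | adj \<mu> x y. kernel \<mu> x y * F x y)"

definition Nmax :: "('v \<Rightarrow> 'v \<Rightarrow> real) \<Rightarrow> ('v \<Rightarrow> real) \<Rightarrow> 'v \<Rightarrow> ennreal" where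
  "Nmax \<mu> f x =
    (SUP (z, r) \<in> {(z, r). 0 < r \<and> x \<in> gball \<mu> z r}.
      ennreal (1 / (r * vol \<mu> (gball \<mu> z r)) *
        (\<Sum>y\<in>gball \<mu> z r. \<bar>f y - avg \<mu> (gball \<mu> z r) f\<bar> * vmass \<mu> y)))"

text \<open>
  Test fields for the ball \<open>B(z, r)\<close>. ``Supported in the edges of \<open>B\<close>'' is meant as for
  compactly supported vector fields in an open ball: \<open>F\<close> vanishes on every edge having an
  endpoint on the boundary of \<open>B\<close>. Hence \<open>vdiv \<mu> F\<close> vanishes off the interior of \<open>B\<close> and has
  mean zero there. If \<open>F\<close> could be nonzero on edges meeting the boundary, its flux would make
  \<open>Mplus\<close> of the constant \<open>1\<close> bounded below by a positive constant, whereas constants have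
  seminorm zero in the other spaces below.
\<close>

definition test_field :: "('v \<Rightarrow> 'v \<Rightarrow> real) \<Rightarrow> 'v \<Rightarrow> real \<Rightarrow> ('v \<Rightarrow> 'v \<Rightarrow> real) \<Rightarrow> bool" where
  "test_field \<mu> z r F \<longleftrightarrow>
    (\<forall>x y. F x y = - F y x) \<and>
    (\<forall>x y. (x, y) \<notin> edges_in \<mu> (vinterior \<mu> (gball \<mu> z r)) \<longrightarrow> F x y = 0) \<and>
    edge_sup_norm \<mu> (gball \<mu> z r) F \<le> ennreal (1 / vol \<mu> (gball \<mu> z r)) \<and>
    (SUP x \<in> vinterior \<mu> (gball \<mu> z r). ennreal \<bar>vdiv \<mu> F x\<bar>)
      \<le> ennreal (1 / (r * vol \<mu> (gball \<mu> z r)))"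

definition Mplus :: "('v \<Rightarrow> 'v \<Rightarrow> real) \<Rightarrow> ('v \<Rightarrow> real) \<Rightarrow> 'v \<Rightarrow> ennreal" where
  "Mplus \<mu> f x =
    (SUP (z, r, F) \<in> {(z, r, F). 0 < r \<and> x \<in> gball \<mu> z r \<and> test_field \<mu> z r F}.
      ennreal \<bar>\<Sum>y\<in>vinterior \<mu> (gball \<mu> z r). f y * vdiv \<mu> F y * vmass \<mu> y\<bar>)"


section \<open>The spaces and their seminorms\<close>

text \<open>Seminorms take values in \<open>ennreal\<close>.\<close>

definition S_seminorm :: "('v \<Rightarrow> 'v \<Rightarrow> real) \<Rightarrow> ('v \<Rightarrow> real) \<Rightarrow> ennreal" where
  "S_seminorm \<mu> f = (\<integral>\<^sup>+x. Nmax \<mu> f x \<partial>vmeasure \<mu>)"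

definition S_space :: "('v \<Rightarrow> 'v \<Rightarrow> real) \<Rightarrow> ('v \<Rightarrow> real) set" where
  "S_space \<mu> = {f. S_seminorm \<mu> f < \<infinity>}"

definition HSmax_seminorm :: "('v \<Rightarrow> 'v \<Rightarrow> real) \<Rightarrow> ('v \<Rightarrow> real) \<Rightarrow> ennreal" where
  "HSmax_seminorm \<mu> f = (\<integral>\<^sup>+x. Mplus \<mu> f x \<partial>vmeasure \<mu>)"

definition HSmax_space :: "('v \<Rightarrow> 'v \<Rightarrow> real) \<Rightarrow> ('v \<Rightarrow> real) set" where
  "HSmax_space \<mu> = {f. HSmax_seminorm \<mu> f < \<infinity>}"

definition hajlasz_gradients :: "('v \<Rightarrow> 'v \<Rightarrow> real) \<Rightarrow> ('v \<Rightarrow> real) \<Rightarrow> ('v \<Rightarrow> real) set" where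
  "hajlasz_gradients \<mu> f =
    {g. (\<forall>x. 0 \<le> g x) \<and> Lp_norm \<mu> 1 g < \<infinity> \<and>
        (\<forall>x y. \<bar>f x - f y\<bar> \<le> real (gdist \<mu> x y) * (g x + g y))}"

definition M_space :: "('v \<Rightarrow> 'v \<Rightarrow> real) \<Rightarrow> ('v \<Rightarrow> real) set" where
  "M_space \<mu> = {f. hajlasz_gradients \<mu> f \<noteq> {}}"

definition M_seminorm :: "('v \<Rightarrow> 'v \<Rightarrow> real) \<Rightarrow> ('v \<Rightarrow> real) \<Rightarrow> ennreal" where
  "M_seminorm \<mu> f = (INF g \<in> hajlasz_gradients \<mu> f. Lp_norm \<mu> 1 g)"

text \<open>
  The conjugate exponent enters through \<open>1/t' = 1 - 1/t\<close>, where \<open>1/t = 0\<close> for \<open>t = \<infinity>\<close>. The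
  sum expressing the cancellation is finite, \<open>a\<close> being supported in the ball.
\<close>

definition HS_atom :: "('v \<Rightarrow> 'v \<Rightarrow> real) \<Rightarrow> ennreal \<Rightarrow> ('v \<Rightarrow> real) \<Rightarrow> bool" where
  "HS_atom \<mu> t a \<longleftrightarrow>
    (\<exists>z r. 0 < r \<and>
      (\<forall>x. x \<notin> gball \<mu> z r \<longrightarrow> a x = 0) \<and>
      Lp_norm \<mu> t (grad \<mu> a) \<le> ennreal (vol \<mu> (gball \<mu> z r) powr - (1 - enn2real (1 / t))) \<and>
      (\<Sum>x\<in>gball \<mu> z r. a x * vmass \<mu> x) = 0)"

definition atomic_decomp ::
  "('v \<Rightarrow> 'v \<Rightarrow> real) \<Rightarrow> ennreal \<Rightarrow> ('v \<Rightarrow> real) \<Rightarrow> (nat \<Rightarrow> real) \<Rightarrow> (nat \<Rightarrow> 'v \<Rightarrow> real) \<Rightarrow> bool" where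
  "atomic_decomp \<mu> t f c a \<longleftrightarrow>
    summable (\<lambda>i. \<bar>c i\<bar>) \<and> (\<forall>i. HS_atom \<mu> t (a i)) \<and>
    (\<lambda>k. Lp_norm \<mu> 1 (grad \<mu> (\<lambda>x. f x - (\<Sum>i\<le>k. c i * a i x)))) \<longlonglongrightarrow> 0"

definition HSato_space :: "('v \<Rightarrow> 'v \<Rightarrow> real) \<Rightarrow> ennreal \<Rightarrow> ('v \<Rightarrow> real) set" where
  "HSato_space \<mu> t = {f. \<exists>c a. atomic_decomp \<mu> t f c a}"

definition HSato_seminorm :: "('v \<Rightarrow> 'v \<Rightarrow> real) \<Rightarrow> ennreal \<Rightarrow> ('v \<Rightarrow> real) \<Rightarrow> ennreal" where
  "HSato_seminorm \<mu> t f =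
    (INF (c, a) \<in> {(c, a). atomic_decomp \<mu> t f c a}. ennreal (\<Sum>i. \<bar>c i\<bar>))"

text \<open>
  Equality of seminormed spaces: the same functions, with equivalent seminorms.
\<close>

definition same_space ::
  "('v \<Rightarrow> real) set \<Rightarrow> (('v \<Rightarrow> real) \<Rightarrow> ennreal) \<Rightarrow>
   ('v \<Rightarrow> real) set \<Rightarrow> (('v \<Rightarrow> real) \<Rightarrow> ennreal) \<Rightarrow> bool" where
  "same_space A nA B nB \<longleftrightarrow>
    A = B \<and> (\<exists>C>0. \<forall>f\<in>A. nA f \<le> ennreal C * nB f \<and> nB f \<le> ennreal C * nA f)"

end

theory Submission
  imports Defs
begin

text \<open>
  The embeddings are proved around the cycle
  \<open>S \<rightarrow> M \<rightarrow> HS\<^sub>t\<^sub>,\<^sub>a\<^sub>t\<^sub>o \<rightarrow> S\<close>, together with \<open>S \<leftrightarrow> HS\<^sub>m\<^sub>a\<^sub>x\<close>.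

  Chaining averages over dyadic balls shows that a multiple of \<open>Nmax \<mu> f\<close> is a Hajlasz gradient.
  Conversely, if \<open>g\<close> is a Hajlasz gradient of \<open>f\<close>, let \<open>f\<^sub>j\<close> be the McShane extension of the restriction
  of \<open>f\<close> to \<open>{g \<le> 2^j}\<close>. The difference of consecutive \<open>f\<^sub>j\<close> is Lipschitz with constant of order
  \<open>2^j\<close> and lives on \<open>{g > 2^j}\<close>; it is cut into bumps on Whitney balls, and the masses
  \<open>2^j m {g > 2^j}\<close> sum to at most \<open>2 \<parallel>g\<parallel>\<close>. A Lipschitz bump need not have mean zero, but
  moving its mass outwards along normalised tents on the balls \<open>B(z, 2^k r)\<close> writes it as a
  geometrically convergent series of atoms. For an atom \<open>a\<close>, \<open>Nmax \<mu> a\<close> is controlled near the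
  ball by the Hardy-Littlewood maximal function of the gradient, and far away by the size of \<open>a\<close>.

  Finally \<open>Mplus \<le> Nmax\<close> because test fields have divergence of mean zero, while
  \<open>Nmax \<le> C Mplus\<close> because, by duality, the Poincare inequality yields bounded solutions of the
  divergence equation on balls.
\<close>

section \<open>Balls, volumes and integrals\<close>

text \<open>All four seminorms vanish on constants, so functions are handled through their edge
  differences \<open>f y - f x\<close>. This is why atomic series are summed edge by edge, and why a
  telescoping series may end in any sequence whose edge differences tend to 0. An infinite connected
  doubling graph has infinite mass. A set of finite measure therefore never exhausts the graph,
  every set \<open>{g \<le> s}\<close> with \<open>s > 0\<close> is nonempty, and the McShane layers
  can descend all the way to level 0. Lipschitz atoms serve every \<open>t\<close> at once, so the
  passage from \<open>M\<close> to atoms has a core free of \<open>t\<close>. The exponent returns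
  when a given atom is estimated, and there it enters through some finite power \<open>s > 1\<close>
  of the gradient. Discreteness leaves two recurring traces. A ball of radius below 1 is a single
  point, so estimates on balls may concentrate on radii at least 1. The gradient of a function
  living on \<open>B z r\<close> lives on \<open>B z (r + 1)\<close>, which costs a factor
  \<open>Cd\<^sup>2\<close>.\<close>

context weighted_graph
begin

abbreviation m :: "'v \<Rightarrow> real" where "m \<equiv> vmass \<mu>"
abbreviation d :: "'v \<Rightarrow> 'v \<Rightarrow> real" where "d x y \<equiv> real (gdist \<mu> x y)"
abbreviation B :: "'v \<Rightarrow> real \<Rightarrow> 'v set" where "B \<equiv> gball \<mu>"
abbreviation V :: "'v \<Rightarrow> real \<Rightarrow> real" where "V z r \<equiv> vol \<mu> (gball \<mu> z r)"

lemma adj_sym: "adj \<mu> x y \<Longrightarrow> adj \<mu> y x"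
  using weight_sym[of x y] by (simp add: adj_def)

lemma relpowp_adj_sym: "(adj \<mu> ^^ n) x y \<Longrightarrow> (adj \<mu> ^^ n) y x"
proof (induction n arbitrary: y)
  case (Suc n)
  then obtain w where "(adj \<mu> ^^ n) x w" "adj \<mu> w y"
    by (auto elim: relpowp_Suc_E)
  with Suc.IH[of w] show ?case
    using adj_sym relpowp_Suc_I2 by metis
qed auto

lemma gdist_path: "(adj \<mu> ^^ gdist \<mu> x y) x y"
  unfolding gdist_def using rtranclp_imp_relpowp[OF connected_graph[of x y]] by (rule LeastI_ex)

lemma gdist_le: "(adj \<mu> ^^ n) x y \<Longrightarrow> gdist \<mu> x y \<le> n"
  unfolding gdist_def by (rule Least_le)

lemma gdist_sym: "gdist \<mu> x y = gdist \<mu> y x"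
  by (meson antisym gdist_le gdist_path relpowp_adj_sym)

lemma gdist_triangle: "gdist \<mu> x z \<le> gdist \<mu> x y + gdist \<mu> y z"
  using gdist_le[OF relpowp_trans[OF gdist_path gdist_path]] .

lemma d_sym: "d x y = d y x"
  by (simp add: gdist_sym)

lemma d_triangle: "d x z \<le> d x y + d y z"
  using gdist_triangle[of x z y] by linarith

lemma gdist_self [simp]: "gdist \<mu> x x = 0"
  using gdist_le[of 0 x x] by simp

lemma gdist_eq_0_iff [simp]: "gdist \<mu> x y = 0 \<longleftrightarrow> x = y"
proof
  assume "gdist \<mu> x y = 0"
  with gdist_path[of x y] show "x = y" by simp
qed simp

lemma gdist_adj: "adj \<mu> x y \<Longrightarrow> gdist \<mu> x y \<le> 1"
  using gdist_le[of 1 x y] by (metis relpowp_1)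

lemma gdist_predecessor:
  assumes "gdist \<mu> x y = Suc n"
  obtains w where "gdist \<mu> x w = n" "adj \<mu> w y"
proof -
  have "(adj \<mu> ^^ Suc n) x y" using gdist_path[of x y] assms by simp
  then obtain w where w: "(adj \<mu> ^^ n) x w" "adj \<mu> w y"
    by (auto elim: relpowp_Suc_E)
  have "Suc n \<le> gdist \<mu> x w + 1"
    using gdist_triangle[of x y w] gdist_adj[OF w(2)] assms by simp
  with gdist_le[OF w(1)] that w(2) show ?thesis by fastforce
qed

lemma mem_gball: "y \<in> B x r \<longleftrightarrow> d x y \<le> r"
  by (simp add: gball_def)

lemma center_in_gball [simp]: "0 < r \<Longrightarrow> x \<in> B x r"
  by (simp add: mem_gball)

lemma gball_mono: "r \<le> s \<Longrightarrow> B x r \<subseteq> B x s"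
  by (auto simp: mem_gball)

lemma gball_subset: "d x y + r \<le> s \<Longrightarrow> B y r \<subseteq> B x s"
  unfolding mem_gball subset_iff using d_triangle[of x _ y] by (smt (verit))

lemma gball_small: "0 < r \<Longrightarrow> r < 1 \<Longrightarrow> B x r = {x}"
proof -
  assume r: "0 < r" "r < 1"
  have "y = x" if "d x y \<le> r" for y
  proof -
    have "gdist \<mu> x y = 0" using that r by linarith
    then show ?thesis by simp
  qed
  with r show ?thesis by (auto simp: mem_gball)
qed

lemma finite_gball_nat: "finite (B x (real n))"
proof (induction n)
  case 0
  have "B x (real 0) = {x}" by (auto simp: mem_gball)
  then show ?case by simp
next
  case (Suc n)
  have "B x (real (Suc n)) \<subseteq> (\<Union>w\<in>B x (real n). B w 1) \<union> B x (real n)"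
  proof
    fix y assume y: "y \<in> B x (real (Suc n))"
    show "y \<in> (\<Union>w\<in>B x (real n). B w 1) \<union> B x (real n)"
    proof (cases "gdist \<mu> x y = Suc n")
      case True
      then obtain w where "gdist \<mu> x w = n" "adj \<mu> w y"
        by (rule gdist_predecessor)
      then have "w \<in> B x (real n)" "y \<in> B w 1"
        using gdist_adj[of w y] by (auto simp: mem_gball)
      then show ?thesis by blast
    qed (use y in \<open>auto simp: mem_gball\<close>)
  qed
  moreover have "finite (B w 1)" for w
    using locally_uniformly_finite by blast
  ultimately show ?case using Suc by (meson finite_UN_I finite_Un finite_subset)
qed

lemma finite_gball [simp]: "finite (B x r)"
  by (rule finite_subset[OF gball_mono finite_gball_nat[of x "nat \<lceil>r\<rceil>"]]) linarith

lemma nbrs_subset_gball: "{y. adj \<mu> x y} \<subseteq> B x 1"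
  using gdist_adj by (force simp: mem_gball)

lemma finite_nbrs [simp]: "finite {y. adj \<mu> x y}"
  by (rule finite_subset[OF nbrs_subset_gball]) simp

lemma m_nonneg [simp]: "0 \<le> m x"
  using vmass_pos[of x] by simp

lemma m_neq_0 [simp]: "m x \<noteq> 0"
  using vmass_pos[of x] by simp

lemma vol_nonneg [simp]: "0 \<le> vol \<mu> A"
  by (simp add: vol_def sum_nonneg)

lemma vol_mono: "finite A' \<Longrightarrow> A \<subseteq> A' \<Longrightarrow> vol \<mu> A \<le> vol \<mu> A'"
  by (simp add: vol_def sum_mono2)

lemma V_mono: "r \<le> s \<Longrightarrow> V x r \<le> V x s"
  by (simp add: vol_mono gball_mono)

lemma m_le_V: "y \<in> B x r \<Longrightarrow> m y \<le> V x r"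
  using vol_mono[of "B x r" "{y}"] by (simp add: vol_def)

lemma V_pos [simp]: "0 < r \<Longrightarrow> 0 < V x r"
  using m_le_V[of x x r] vmass_pos[of x] by fastforce

lemma UNIV_gball: "(UNIV :: 'v set) = (\<Union>n. B x (real n))"
proof -
  have "y \<in> B x (real (gdist \<mu> x y))" for y by (simp add: mem_gball)
  then show ?thesis by blast
qed

lemma countable_vertices: "countable (UNIV :: 'v set)"
proof -
  fix x :: 'v
  show ?thesis by (subst UNIV_gball[of x]) (simp add: countable_finite)
qed

lemma vertex_enumeration:
  obtains e :: "nat \<Rightarrow> 'v" where "bij e"
  using bij_betw_from_nat_into[OF countable_vertices infinite_vertices] by blast

text \<open>Finite balls cannot exhaust an infinite graph, so some vertex lies beyond distance
  \<open>n\<close>; going back along a shortest path to it takes every smaller value of the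
  distance.\<close>

lemma gdist_attained: "\<exists>y. gdist \<mu> x y = n"
proof -
  have down: "\<exists>y. gdist \<mu> x y = k" if "k \<le> gdist \<mu> x y" for k y
    using that
  proof (induction "gdist \<mu> x y" arbitrary: y)
    case (Suc n)
    then obtain w where "gdist \<mu> x w = n" by (metis gdist_predecessor)
    with Suc show ?case by (metis le_Suc_eq)
  qed auto
  have "\<exists>y. y \<notin> B x (real n)"
    using infinite_vertices finite_gball[of x "real n"] by (metis UNIV_eq_I)
  then obtain y where "n \<le> gdist \<mu> x y" unfolding mem_gball by (metis linorder_le_cases of_nat_le_iff)
  then show ?thesis by (rule down)
qed

lemma edge_lipschitz:
  assumes "\<And>x y. adj \<mu> x y \<Longrightarrow> \<bar>b y - b x\<bar> \<le> L"
  shows "\<bar>b y - b x\<bar> \<le> L * d x y"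
proof -
  have "\<bar>b y - b x\<bar> \<le> L * real n" if "(adj \<mu> ^^ n) x y" for n
    using that
  proof (induction n arbitrary: y)
    case (Suc n)
    then obtain w where w: "(adj \<mu> ^^ n) x w" "adj \<mu> w y"
      by (auto elim: relpowp_Suc_E)
    then show ?case using Suc.IH[OF w(1)] assms[OF w(2)] by (simp add: algebra_simps)
  qed auto
  then show ?thesis using gdist_path by blast
qed

lemma sum_kernel: "(\<Sum>y | adj \<mu> x y. kernel \<mu> x y) = 1"
  by (simp add: kernel_def sum_divide_distrib[symmetric] vmass_def[symmetric])

lemma kernel_nonneg [simp]: "0 \<le> kernel \<mu> x y"
  by (simp add: kernel_def weight_nonneg)

lemma grad_nonneg [simp]: "0 \<le> grad \<mu> f x"
  by (simp add: grad_def sum_nonneg)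

lemma grad_le_sup:
  assumes "\<And>y. adj \<mu> x y \<Longrightarrow> \<bar>f y - f x\<bar> \<le> L" "0 \<le> L"
  shows "grad \<mu> f x \<le> L"
proof -
  have "(\<Sum>y | adj \<mu> x y. kernel \<mu> x y * \<bar>f y - f x\<bar>\<^sup>2) \<le> (\<Sum>y | adj \<mu> x y. kernel \<mu> x y * L\<^sup>2)"
    by (intro sum_mono mult_left_mono power_mono) (auto simp: assms)
  also have "\<dots> = L\<^sup>2"
    by (simp add: sum_distrib_right[symmetric] sum_kernel)
  finally show ?thesis unfolding grad_def using assms(2)
    by (intro real_le_lsqrt) (auto intro: order_trans)
qed

lemma grad_le_sum: "grad \<mu> f x \<le> (\<Sum>y | adj \<mu> x y. \<bar>f y - f x\<bar>)"
proof (rule grad_le_sup)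
  fix y assume "adj \<mu> x y"
  then show "\<bar>f y - f x\<bar> \<le> (\<Sum>y | adj \<mu> x y. \<bar>f y - f x\<bar>)"
    by (intro member_le_sum[where f = "\<lambda>y. \<bar>f y - f x\<bar>"]) auto
qed (simp add: sum_nonneg)

lemma grad_support:
  assumes "\<And>x. x \<notin> B z r \<Longrightarrow> f x = 0" "x \<notin> B z (r + 1)"
  shows "grad \<mu> f x = 0"
proof -
  have "f y - f x = 0" if "adj \<mu> x y" for y
  proof -
    have "d z x \<le> d z y + 1"
      using d_triangle[of z x y] gdist_adj[OF adj_sym[OF that]] by linarith
    then have "y \<notin> B z r" "x \<notin> B z r" using assms(2) by (auto simp: mem_gball)
    then show ?thesis using assms(1) by simp
  qed
  then show ?thesis by (simp add: grad_def)
qed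

lemma nn_integral_vmeasure:
  "(\<integral>\<^sup>+x. h x \<partial>vmeasure \<mu>) = (\<integral>\<^sup>+x. ennreal (m x) * h x \<partial>count_space UNIV)"
  by (simp add: vmeasure_def point_measure_def nn_integral_density)

lemma space_vmeasure [simp]: "space (vmeasure \<mu>) = UNIV"
  and sets_vmeasure [simp]: "sets (vmeasure \<mu>) = UNIV"
  by (auto simp: vmeasure_def space_point_measure sets_point_measure)

lemma borel_measurable_vmeasure [measurable]: "h \<in> borel_measurable (vmeasure \<mu>)"
  by (auto simp: measurable_def)

lemma nn_integral_vmeasure_finite:
  assumes "finite A" "\<And>x. x \<in> A \<Longrightarrow> 0 \<le> h x"
  shows "(\<integral>\<^sup>+x. ennreal (h x) * indicator A x \<partial>vmeasure \<mu>) = ennreal (\<Sum>x\<in>A. h x * m x)"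
proof -
  have "(\<integral>\<^sup>+x. ennreal (h x) * indicator A x \<partial>vmeasure \<mu>)
      = (\<Sum>x\<in>A. ennreal (m x) * (ennreal (h x) * indicator A x))"
    unfolding nn_integral_vmeasure
    by (rule nn_integral_count_space'[OF assms(1)]) (auto simp: indicator_def)
  also have "\<dots> = (\<Sum>x\<in>A. ennreal (h x * m x))"
    by (intro sum.cong) (auto simp: indicator_def ennreal_mult' assms mult.commute)
  also have "\<dots> = ennreal (\<Sum>x\<in>A. h x * m x)"
    by (intro sum_ennreal) (simp add: assms)
  finally show ?thesis .
qed

lemma emeasure_vmeasure_finite: "finite A \<Longrightarrow> emeasure (vmeasure \<mu>) A = ennreal (vol \<mu> A)"
  using nn_integral_vmeasure_finite[of A "\<lambda>_. 1"] by (simp add: vol_def)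

lemma Lp_norm_1: "Lp_norm \<mu> 1 f = (\<integral>\<^sup>+x. ennreal \<bar>f x\<bar> \<partial>vmeasure \<mu>)"
  unfolding Lp_norm_def Let_def by (auto simp: top.not_eq_extremum)

lemma finite_point_if_integrable:
  assumes "(\<integral>\<^sup>+x. h x \<partial>vmeasure \<mu>) < \<infinity>"
  shows "h x < \<infinity>"
proof -
  have "ennreal (m x) * h x \<le> (\<integral>\<^sup>+x. ennreal (m x) * h x \<partial>count_space UNIV)"
    using nn_integral_ge_point[of x UNIV "\<lambda>x. ennreal (m x) * h x"] by simp
  also have "\<dots> < \<infinity>" using assms by (simp add: nn_integral_vmeasure)
  finally show ?thesis
    using vmass_pos[of x] by (auto simp: ennreal_mult_less_top top.not_eq_extremum)
qed

end

section \<open>Volume comparison and infinite mass under doubling\<close>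

locale doubling_graph = weighted_graph \<mu> for \<mu> :: "'v \<Rightarrow> 'v \<Rightarrow> real" +
  fixes Cd :: real
  assumes V_double: "0 < r \<Longrightarrow> V x (2 * r) \<le> Cd * V x r"
begin

lemma Cd_ge_1: "1 \<le> Cd"
proof -
  fix x :: 'v
  have "V x 1 \<le> V x 2" by (rule V_mono) simp
  also have "\<dots> \<le> Cd * V x 1" using V_double[of 1 x] by simp
  finally show ?thesis using V_pos[of 1 x] by simp
qed

lemma Cd_nonneg [simp]: "0 \<le> Cd"
  using Cd_ge_1 by simp

lemma V_double_power: "0 < r \<Longrightarrow> V x (2 ^ n * r) \<le> Cd ^ n * V x r"
proof (induction n)
  case (Suc n)
  have "V x (2 ^ Suc n * r) = V x (2 * (2 ^ n * r))" by (simp add: mult.assoc)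
  also have "\<dots> \<le> Cd * V x (2 ^ n * r)" using Suc.prems by (intro V_double) simp
  also have "\<dots> \<le> Cd * (Cd ^ n * V x r)" using Suc by (intro mult_left_mono) auto
  finally show ?case by (simp add: mult.assoc)
qed simp

lemma vol_le_dilate:
  assumes "0 < r" "d x y + s \<le> 2 ^ n * r"
  shows "V y s \<le> Cd ^ n * V x r"
proof -
  have "V y s \<le> V x (2 ^ n * r)"
    by (intro vol_mono gball_subset assms finite_gball)
  with V_double_power[OF assms(1), of x n] show ?thesis by linarith
qed

text \<open>This is the price of the one step by which a gradient spreads beyond the support. For
  small \<open>r\<close> that step exceeds any fixed multiple of \<open>r\<close>, but then
  \<open>B x r\<close> is a singleton and equals \<open>B x (1 / 2)\<close>, to which two doublings
  apply.\<close>

lemma V_add_1: "0 < r \<Longrightarrow> V x (r + 1) \<le> Cd\<^sup>2 * V x r"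
proof (cases "1 \<le> r")
  case True
  then show ?thesis by (intro vol_le_dilate) auto
next
  case False
  assume "0 < r"
  with False have "B x r = B x (1 / 2)" by (simp add: gball_small)
  moreover have "V x (r + 1) \<le> Cd\<^sup>2 * V x (1 / 2)"
    using False by (intro vol_le_dilate) auto
  ultimately show ?thesis by simp
qed

text \<open>If the mass were finite, one ball would hold nearly all of it; yet a disjoint ball of
  the same radius nearby would, by doubling, hold at least a fixed fraction as much.\<close>

lemma volume_unbounded: "\<exists>R>0. K < V x R"
proof (rule ccontr)
  assume "\<not> ?thesis"
  then have le: "V x R \<le> K" if "R > 0" for R using that by force
  define S where "S = (SUP R\<in>{0<..}. V x R)"
  have bdd: "bdd_above ((\<lambda>R. V x R) ` {0<..})" using le by (intro bdd_aboveI2[of _ _ K]) auto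
  have up: "V x R \<le> S" if "R > 0" for R
    unfolding S_def using that by (intro cSUP_upper bdd) auto
  have S: "S > 0" using up[of 1] V_pos[of 1 x] by linarith
  \<comment> \<open>Small enough that a part \<open>\<epsilon>\<close> of the supremum, enlarged by
    the factor \<open>Cd ^ 3\<close>, still falls short of the part
    \<open>1 - \<epsilon>\<close>.\<close>
  define \<epsilon> where "\<epsilon> = 1 / (Cd ^ 3 + 2)"
  have Cd3: "Cd ^ 3 > 0" using Cd_ge_1 by simp
  have eps: "0 < \<epsilon>" "Cd ^ 3 * \<epsilon> < 1 - \<epsilon>" 
  proof -
    have pos: "0 < Cd ^ 3 + 2" using Cd3 by linarith
    then show "0 < \<epsilon>" by (simp add: \<epsilon>_def)
    have "(Cd ^ 3 + 2) * \<epsilon> = 1" unfolding \<epsilon>_def using pos by simp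
    then show "Cd ^ 3 * \<epsilon> < 1 - \<epsilon>" using \<open>0 < \<epsilon>\<close> by (simp add: algebra_simps)
  qed
  have "S * (1 - \<epsilon>) < S" using S eps by (simp add: algebra_simps)
  then obtain R where R: "R > 0" "S * (1 - \<epsilon>) < V x R"
    unfolding S_def by (subst (asm) less_cSUP_iff) (use bdd in auto)
  \<comment> \<open>A radius of at least 1 leaves room for an integer distance \<open>n\<close>
    between \<open>2 * R'\<close> and \<open>3 * R'\<close>: far enough for disjoint balls, near
    enough for \<open>n + R' \<le> 2 ^ 3 * R'\<close>.\<close>
  define R' where "R' = max R 1"
  have R': "R' \<ge> 1" "S * (1 - \<epsilon>) < V x R'"
    using R V_mono[of R R' x] by (auto simp: R'_def)
  define n where "n = nat \<lfloor>2 * R'\<rfloor> + 1"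
  have n: "2 * R' < n" "n \<le> 3 * R'" using R' unfolding n_def by linarith+
  obtain y where y: "gdist \<mu> x y = n" using gdist_attained by blast
  have disj: "B x R' \<inter> B y R' = {}"
  proof -
    have False if "d x w \<le> R'" "d y w \<le> R'" for w
      using that d_triangle[of x y w] y n d_sym[of w y] by linarith
    then show ?thesis by (auto simp: mem_gball)
  qed
  have sub: "B y R' \<subseteq> B x (n + R')" by (rule gball_subset) (simp add: y)
  have "V x R' + V y R' = vol \<mu> (B x R' \<union> B y R')"
    unfolding vol_def using disj by (simp add: sum.union_disjoint)
  also have "\<dots> \<le> V x (n + R')"
    using sub gball_mono[of R' "n + R'" x] by (intro vol_mono) auto
  also have "\<dots> \<le> S" using R' by (intro up) simp
  finally have "V y R' \<le> S * \<epsilon>" using R' by (simp add: algebra_simps)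
  moreover have "V x R' \<le> Cd ^ 3 * V y R'"
    using R' n y d_sym[of x y] by (intro vol_le_dilate) auto
  ultimately have "V x R' \<le> S * (Cd ^ 3 * \<epsilon>)"
    using Cd3 by (smt (verit) mult.assoc mult.commute mult_left_mono)
  also have "\<dots> < S * (1 - \<epsilon>)" using eps S by simp
  finally show False using R' by simp
qed

lemma emeasure_vertices: "emeasure (vmeasure \<mu>) UNIV = \<infinity>"
proof (rule ccontr)
  assume "\<not> ?thesis"
  then obtain K where K: "0 \<le> K" "emeasure (vmeasure \<mu>) UNIV = ennreal K"
    using ennreal_cases by (metis infinity_ennreal_def)
  fix x :: 'v
  obtain R where R: "R > 0" "K < V x R" using volume_unbounded by blast
  have "ennreal (V x R) \<le> emeasure (vmeasure \<mu>) UNIV"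
    by (simp add: emeasure_vmeasure_finite[symmetric] emeasure_mono)
  with R K show False by (simp add: ennreal_le_iff)
qed

end

section \<open>Oscillation and the divergence equation\<close>

text \<open>
  If the least squares solution over the compact box of admissible fields has a nonzero residual
  \<open>\<phi>\<close>, then \<open>\<phi>\<close> violates \<open>dual\<close>.
\<close>

lemma flow_duality:
  fixes w :: "'v \<Rightarrow> 'v \<Rightarrow> real" and b :: "'v \<Rightarrow> real"
  assumes S: "finite S" and sym: "\<And>x y. w x y = w y x" and K: "0 \<le> K"
    and dual: "\<And>\<phi>. (\<Sum>x\<in>S. \<phi> x * b x) \<le> K * (\<Sum>x\<in>S. \<Sum>y\<in>S. w x y * \<bar>\<phi> x - \<phi> y\<bar>)"
  obtains F where "\<And>x y. F x y = - F y x" "\<And>x y. \<bar>F x y\<bar> \<le> 2 * K"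
    "\<And>x. x \<in> S \<Longrightarrow> (\<Sum>y\<in>S. w x y * F x y) = b x"
proof -
  \<comment> \<open>Antisymmetry is obtained by projecting an arbitrary \<open>H\<close>, so the
    admissible set \<open>X\<close> is a plain product of intervals and compact by
    Tychonoff.\<close>
  define G where "G = (\<lambda>H :: 'v \<times> 'v \<Rightarrow> real. \<lambda>x y. (H (x, y) - H (y, x)) / 2)"
  define dv where "dv = (\<lambda>H x. \<Sum>y\<in>S. w x y * G H x y)"
  define Q where "Q = (\<lambda>H. \<Sum>x\<in>S. (b x - dv H x)\<^sup>2)"
  define X where "X = (\<Pi>\<^sub>E e\<in>(UNIV :: ('v \<times> 'v) set). {-2 * K .. 2 * K})"
  have "compactin (product_topology (\<lambda>_. euclidean) UNIV) X"
    unfolding X_def by (subst compactin_PiE) auto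
  then have "compact X"
    by (simp add: euclidean_product_topology)
  moreover have "(\<lambda>_. 0) \<in> X" using K by (auto simp: X_def)
  moreover have "continuous_on X Q"
    unfolding Q_def dv_def G_def
    by (intro continuous_intros continuous_on_product_coordinates continuous_on_subset[OF _ subset_UNIV])
      (auto intro!: continuous_on_product_coordinates)
  ultimately obtain H where H: "H \<in> X" "\<And>H'. H' \<in> X \<Longrightarrow> Q H \<le> Q H'"
    using continuous_attains_inf[of X Q] by blast
  define \<phi> where "\<phi> = (\<lambda>x. b x - dv H x)"
  \<comment> \<open>Summation by parts: exchanging the two summation variables uses that
    \<open>w\<close> is symmetric and the field antisymmetric.\<close>
  have pairing: "(\<Sum>x\<in>S. \<phi> x * dv H' x) = (\<Sum>x\<in>S. \<Sum>y\<in>S. w x y * (\<phi> x - \<phi> y) * G H' x y) / 2" for H'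
  proof -
    have "(\<Sum>x\<in>S. \<phi> x * dv H' x) = (\<Sum>x\<in>S. \<Sum>y\<in>S. \<phi> x * w x y * G H' x y)"
      by (simp add: dv_def sum_distrib_left mult.assoc)
    moreover have "\<dots> = (\<Sum>x\<in>S. \<Sum>y\<in>S. \<phi> y * w y x * G H' y x)"
      by (rule sum.swap)
    moreover have "\<dots> = (\<Sum>x\<in>S. \<Sum>y\<in>S. - (\<phi> y * w x y * G H' x y))"
      by (intro sum.cong refl) (simp add: sym[of _ _] G_def field_simps)
    ultimately have "2 * (\<Sum>x\<in>S. \<phi> x * dv H' x)
       = (\<Sum>x\<in>S. \<Sum>y\<in>S. \<phi> x * w x y * G H' x y) + (\<Sum>x\<in>S. \<Sum>y\<in>S. - (\<phi> y * w x y * G H' x y))"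
      by simp
    also have "\<dots> = (\<Sum>x\<in>S. \<Sum>y\<in>S. w x y * (\<phi> x - \<phi> y) * G H' x y)"
      by (simp add: sum.distrib[symmetric] algebra_simps)
    finally show ?thesis by simp
  qed
  \<comment> \<open>Variational inequality at the minimiser of \<open>Q\<close>: a step of size
    \<open>\<epsilon>\<close> towards a better \<open>H'\<close> would change \<open>Q\<close> by
    \<open>- 2 * \<epsilon> * p + \<epsilon>\<^sup>2 * q\<close>, which is negative for small
    \<open>\<epsilon>\<close>.\<close>
  have first_order: "(\<Sum>x\<in>S. \<phi> x * dv H' x) \<le> (\<Sum>x\<in>S. \<phi> x * dv H x)" if H': "H' \<in> X" for H'
  proof (rule ccontr)
    define p where "p = (\<Sum>x\<in>S. \<phi> x * (dv H' x - dv H x))"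
    define q where "q = (\<Sum>x\<in>S. (dv H' x - dv H x)\<^sup>2)"
    assume "\<not> ?thesis"
    then have p: "p > 0" by (simp add: p_def right_diff_distrib sum_subtractf)
    have q: "q \<ge> 0" by (simp add: q_def sum_nonneg)
    define \<epsilon> where "\<epsilon> = min 1 (p / (q + 1))"
    have eps: "0 < \<epsilon>" "\<epsilon> \<le> 1" "\<epsilon> * (q + 1) \<le> p"
    proof -
      show "0 < \<epsilon>" "\<epsilon> \<le> 1" using p q by (auto simp: \<epsilon>_def)
      have "\<epsilon> * (q + 1) \<le> p / (q + 1) * (q + 1)"
        using q by (intro mult_right_mono) (auto simp: \<epsilon>_def)
      then show "\<epsilon> * (q + 1) \<le> p" using q by simp
    qed
    define H\<epsilon> where "H\<epsilon> = (\<lambda>e. H e + \<epsilon> * (H' e - H e))"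
    have mem: "H\<epsilon> \<in> X"
    proof -
      have "-2 * K \<le> H\<epsilon> e \<and> H\<epsilon> e \<le> 2 * K" for e
      proof -
        have 1: "-2 * K \<le> H e" "H e \<le> 2 * K" "-2 * K \<le> H' e" "H' e \<le> 2 * K"
          using H(1) H' by (auto simp: X_def)
        have eq: "H\<epsilon> e = (1 - \<epsilon>) * H e + \<epsilon> * H' e" by (simp add: H\<epsilon>_def algebra_simps)
        have "(1 - \<epsilon>) * H e + \<epsilon> * H' e \<le> (1 - \<epsilon>) * (2 * K) + \<epsilon> * (2 * K)"
          "(1 - \<epsilon>) * (-2 * K) + \<epsilon> * (-2 * K) \<le> (1 - \<epsilon>) * H e + \<epsilon> * H' e"
          using eps 1 by (intro add_mono mult_left_mono; simp)+
        then show ?thesis unfolding eq by (simp add: algebra_simps)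
      qed
      then show ?thesis unfolding X_def by (intro PiE_I) auto
    qed
    have dvH: "dv H\<epsilon> x = dv H x + \<epsilon> * (dv H' x - dv H x)" for x
    proof -
      have "dv H\<epsilon> x = (\<Sum>y\<in>S. w x y * G H x y + \<epsilon> * (w x y * G H' x y - w x y * G H x y))"
        unfolding dv_def by (intro sum.cong refl) (simp add: G_def H\<epsilon>_def field_simps)
      then show ?thesis
        by (simp add: dv_def sum.distrib sum_subtractf sum_distrib_left[symmetric])
    qed
    have "Q H\<epsilon> = Q H - 2 * \<epsilon> * p + \<epsilon>\<^sup>2 * q"
    proof -
      have "(b x - dv H\<epsilon> x)\<^sup>2 = (b x - dv H x)\<^sup>2 - 2 * \<epsilon> * (\<phi> x * (dv H' x - dv H x))
          + \<epsilon>\<^sup>2 * (dv H' x - dv H x)\<^sup>2" for x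
        unfolding dvH \<phi>_def by (simp add: power2_eq_square algebra_simps)
      then show ?thesis
        by (simp add: Q_def p_def q_def sum.distrib sum_subtractf sum_distrib_left)
    qed
    moreover have "\<epsilon>\<^sup>2 * q < 2 * \<epsilon> * p"
    proof -
      have "\<epsilon> * q \<le> p" "0 < p" using eps p by (auto simp: algebra_simps)
      then have "\<epsilon> * q < 2 * p" by linarith
      then have "\<epsilon> * (\<epsilon> * q) < \<epsilon> * (2 * p)" using eps by simp
      then show ?thesis by (simp add: power2_eq_square algebra_simps)
    qed
    ultimately show False using H(2)[OF mem] by linarith
  qed
  \<comment> \<open>The sign field saturates the box and attains the right-hand side of
    \<open>dual\<close>. Hence \<open>\<phi>\<close> pairs with \<open>b\<close> no more than with
    \<open>dv H\<close>, while the difference of these pairings is the sum of squares of the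
    residual.\<close>
  define H' where "H' = (\<lambda>(x, y). 2 * K * sgn (\<phi> x - \<phi> y))"
  have "H' \<in> X" using K by (auto simp: X_def H'_def sgn_if)
  then have "(\<Sum>x\<in>S. \<phi> x * dv H' x) \<le> (\<Sum>x\<in>S. \<phi> x * dv H x)" by (rule first_order)
  moreover have "(\<Sum>x\<in>S. \<phi> x * dv H' x) = K * (\<Sum>x\<in>S. \<Sum>y\<in>S. w x y * \<bar>\<phi> x - \<phi> y\<bar>)"
  proof -
    have "w x y * (\<phi> x - \<phi> y) * G H' x y = 2 * K * (w x y * \<bar>\<phi> x - \<phi> y\<bar>)" for x y
      by (simp add: G_def H'_def sgn_if algebra_simps)
    then have "(\<Sum>x\<in>S. \<phi> x * dv H' x) = (\<Sum>x\<in>S. \<Sum>y\<in>S. 2 * K * (w x y * \<bar>\<phi> x - \<phi> y\<bar>)) / 2"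
      by (simp only: pairing)
    then show ?thesis by (simp add: sum_distrib_left[symmetric])
  qed
  ultimately have "(\<Sum>x\<in>S. \<phi> x * b x) \<le> (\<Sum>x\<in>S. \<phi> x * dv H x)"
    using dual[of \<phi>] by linarith
  moreover have "(\<Sum>x\<in>S. \<phi> x * b x) - (\<Sum>x\<in>S. \<phi> x * dv H x) = (\<Sum>x\<in>S. (\<phi> x)\<^sup>2)"
    by (simp add: sum_subtractf[symmetric] right_diff_distrib[symmetric] \<phi>_def power2_eq_square)
  ultimately have "(\<Sum>x\<in>S. (\<phi> x)\<^sup>2) \<le> 0" by linarith
  then have "(\<Sum>x\<in>S. (\<phi> x)\<^sup>2) = 0" by (simp add: antisym sum_nonneg)
  then have zero: "\<forall>x\<in>S. \<phi> x = 0" by (simp add: sum_nonneg_eq_0_iff[OF S])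
  show thesis
  proof
    fix x y
    show "G H x y = - G H y x" by (simp add: G_def field_simps)
    have "-2 * K \<le> H e \<and> H e \<le> 2 * K" for e using H(1) by (auto simp: X_def)
    from this[of "(x, y)"] this[of "(y, x)"]
    show "\<bar>G H x y\<bar> \<le> 2 * K" by (simp add: G_def abs_le_iff)
  next
    fix x assume "x \<in> S"
    then show "(\<Sum>y\<in>S. w x y * G H x y) = b x"
      using zero by (auto simp: \<phi>_def dv_def)
  qed
qed

section \<open>Oscillation, divergence, and the bound of \<open>Mplus\<close> by
  \<open>Nmax\<close>\<close>

context weighted_graph
begin

definition osc :: "('v \<Rightarrow> real) \<Rightarrow> 'v \<Rightarrow> real \<Rightarrow> real" where
  "osc f z r = (\<Sum>y\<in>B z r. \<bar>f y - avg \<mu> (B z r) f\<bar> * m y)"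

lemma osc_nonneg [simp]: "0 \<le> osc f z r"
  by (simp add: osc_def sum_nonneg)

lemma Nmax_eq: "Nmax \<mu> f x = (SUP (z, r) \<in> {(z, r). 0 < r \<and> x \<in> B z r}.
    ennreal (1 / (r * V z r) * osc f z r))"
  by (simp add: Nmax_def osc_def)

lemma osc_le_Nmax:
  "0 < r \<Longrightarrow> x \<in> B z r \<Longrightarrow> ennreal (1 / (r * V z r) * osc f z r) \<le> Nmax \<mu> f x"
  unfolding Nmax_eq by (intro SUP_upper2[of "(z, r)"]) auto

lemma Nmax_le:
  "(\<And>z r. 0 < r \<Longrightarrow> x \<in> B z r \<Longrightarrow> ennreal (1 / (r * V z r) * osc f z r) \<le> K) \<Longrightarrow> Nmax \<mu> f x \<le> K"
  unfolding Nmax_eq by (auto intro: SUP_least)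

lemma avg_mult_V: "0 < r \<Longrightarrow> avg \<mu> (B z r) f * V z r = (\<Sum>x\<in>B z r. f x * m x)"
  using V_pos[of r z] by (simp add: avg_def less_imp_neq[symmetric])

lemma sum_minus_avg: "0 < r \<Longrightarrow> (\<Sum>x\<in>B z r. (f x - avg \<mu> (B z r) f) * m x) = 0"
  by (simp add: left_diff_distrib sum_subtractf sum_distrib_left[symmetric] avg_mult_V vol_def[symmetric])

lemma avg_singleton: "avg \<mu> {z} f = f z"
  using vmass_pos[of z] by (simp add: avg_def vol_def)

lemma osc_small: "0 < r \<Longrightarrow> r < 1 \<Longrightarrow> osc f z r = 0"
  by (simp add: osc_def gball_small avg_singleton)

lemma vdiv_mass: "vdiv \<mu> F x * m x = (\<Sum>y | adj \<mu> x y. \<mu> x y * F x y)"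
proof -
  have "vdiv \<mu> F x * m x = (\<Sum>y | adj \<mu> x y. kernel \<mu> x y * F x y * m x)"
    by (simp add: vdiv_def sum_distrib_right)
  also have "\<dots> = (\<Sum>y | adj \<mu> x y. \<mu> x y * F x y)"
    by (intro sum.cong refl) (simp add: kernel_def)
  finally show ?thesis .
qed

lemma not_adj_weight: "\<not> adj \<mu> x y \<Longrightarrow> \<mu> x y = 0"
  using weight_nonneg[of x y] by (simp add: adj_def)

lemma vdiv_mass_on:
  assumes "finite S" "\<And>y. y \<notin> S \<Longrightarrow> F x y = 0"
  shows "vdiv \<mu> F x * m x = (\<Sum>y\<in>S. \<mu> x y * F x y)"
proof -
  have "(\<Sum>y | adj \<mu> x y. \<mu> x y * F x y) = (\<Sum>y\<in>{y. adj \<mu> x y} \<inter> S. \<mu> x y * F x y)"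
    by (rule sum.mono_neutral_right) (auto simp: assms)
  also have "\<dots> = (\<Sum>y\<in>S. \<mu> x y * F x y)"
    by (rule sum.mono_neutral_left) (use assms not_adj_weight in auto)
  finally show ?thesis by (simp add: vdiv_mass)
qed

lemma sum_vdiv_eq_0:
  assumes S: "finite S" and anti: "\<And>x y. F x y = - F y x" and supp: "\<And>x y. y \<notin> S \<Longrightarrow> F x y = 0"
  shows "(\<Sum>x\<in>S. vdiv \<mu> F x * m x) = 0"
proof -
  have "(\<Sum>x\<in>S. vdiv \<mu> F x * m x) = (\<Sum>x\<in>S. \<Sum>y\<in>S. \<mu> x y * F x y)"
    by (intro sum.cong refl vdiv_mass_on S supp)
  also have "\<dots> = (\<Sum>x\<in>S. \<Sum>y\<in>S. \<mu> y x * F y x)" by (rule sum.swap)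
  also have "\<dots> = (\<Sum>x\<in>S. \<Sum>y\<in>S. - (\<mu> x y * F x y))"
    by (intro sum.cong refl) (use anti weight_sym in \<open>metis mult_minus_right\<close>)
  also have "\<dots> = - (\<Sum>x\<in>S. \<Sum>y\<in>S. \<mu> x y * F x y)" by (simp add: sum_negf)
  also have "\<dots> = - (\<Sum>x\<in>S. vdiv \<mu> F x * m x)"
    by (intro arg_cong[of _ _ uminus] sum.cong refl vdiv_mass_on[symmetric] S supp)
  finally show ?thesis by simp
qed

lemma Mplus_le_Nmax: "Mplus \<mu> f x \<le> Nmax \<mu> f x"
  unfolding Mplus_def
proof (rule SUP_least, clarify)
  fix z r F
  assume r: "0 < r" and x: "x \<in> B z r" and F: "test_field \<mu> z r F"
  let ?I = "vinterior \<mu> (B z r)"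
  let ?c = "avg \<mu> (B z r) f" and ?k = "1 / (r * V z r)"
  have sub: "?I \<subseteq> B z r" by (auto simp: vinterior_def)
  then have fin: "finite ?I" using finite_subset finite_gball by blast
  have k: "0 \<le> ?k" using r V_pos[OF r, of z] by simp
  have div: "\<bar>vdiv \<mu> F y\<bar> \<le> ?k" if "y \<in> ?I" for y
  proof -
    have "ennreal \<bar>vdiv \<mu> F y\<bar> \<le> ennreal ?k"
      using F that unfolding test_field_def by (meson SUP_upper order_trans)
    then show ?thesis using k ennreal_le_iff by blast
  qed
  have "(\<Sum>y\<in>?I. vdiv \<mu> F y * m y) = 0"
  proof (rule sum_vdiv_eq_0[OF fin])
    show "F x y = - F y x" for x y using F unfolding test_field_def by blast
    show "F x y = 0" if "y \<notin> ?I" for x y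
      using F that unfolding test_field_def edges_in_def by blast
  qed
  then have "(\<Sum>y\<in>?I. f y * vdiv \<mu> F y * m y) = (\<Sum>y\<in>?I. f y * vdiv \<mu> F y * m y) - ?c * (\<Sum>y\<in>?I. vdiv \<mu> F y * m y)"
    by simp
  also have "\<dots> = (\<Sum>y\<in>?I. (f y - ?c) * vdiv \<mu> F y * m y)"
    by (simp add: sum_distrib_left sum_subtractf[symmetric] algebra_simps)
  finally have "\<bar>\<Sum>y\<in>?I. f y * vdiv \<mu> F y * m y\<bar> = \<bar>\<Sum>y\<in>?I. (f y - ?c) * vdiv \<mu> F y * m y\<bar>"
    by simp
  also have "\<dots> \<le> (\<Sum>y\<in>?I. \<bar>(f y - ?c) * vdiv \<mu> F y * m y\<bar>)" by (rule sum_abs)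
  also have "\<dots> \<le> (\<Sum>y\<in>?I. ?k * (\<bar>f y - ?c\<bar> * m y))"
  proof (rule sum_mono)
    fix y assume "y \<in> ?I"
    have "\<bar>f y - ?c\<bar> * m y * \<bar>vdiv \<mu> F y\<bar> \<le> \<bar>f y - ?c\<bar> * m y * ?k"
      using div[OF \<open>y \<in> ?I\<close>] by (intro mult_left_mono) auto
    then show "\<bar>(f y - ?c) * vdiv \<mu> F y * m y\<bar> \<le> ?k * (\<bar>f y - ?c\<bar> * m y)"
      by (simp add: abs_mult mult_ac)
  qed
  also have "\<dots> \<le> (\<Sum>y\<in>B z r. ?k * (\<bar>f y - ?c\<bar> * m y))"
    using k by (intro sum_mono2 sub) auto
  also have "\<dots> = ?k * osc f z r" by (simp add: osc_def sum_distrib_left)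
  finally show "ennreal \<bar>\<Sum>y\<in>?I. f y * vdiv \<mu> F y * m y\<bar> \<le> Nmax \<mu> f x"
    using osc_le_Nmax[OF r x, of f] by (meson ennreal_leI order_trans)
qed

end

section \<open>Solving the divergence equation by means of the Poincare inequality\<close>

locale poincare_graph = doubling_graph \<mu> Cd for \<mu> :: "'v \<Rightarrow> 'v \<Rightarrow> real" and Cd +
  fixes \<alpha> Cp :: real
  assumes \<alpha>_pos: "0 < \<alpha>" and kernel_ge: "adj \<mu> x y \<Longrightarrow> \<alpha> * m x \<le> \<mu> x y"
    and Cp_pos: "0 < Cp"
    and poincare: "0 < r \<Longrightarrow> osc f z r \<le> Cp * r * (\<Sum>x\<in>B z r. grad \<mu> f x * m x)"
begin

text \<open>Converts the quadratic gradient of the Poincare inequality into the weighted edge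
  differences that \<open>flow_duality\<close> requires. The lower bound on edge weights lets
  \<open>m x\<close> be replaced by \<open>\<mu> x y / \<alpha>\<close> on each edge.\<close>

lemma grad_mass_le: "grad \<mu> f x * m x \<le> 1 / \<alpha> * (\<Sum>y | adj \<mu> x y. \<mu> x y * \<bar>f y - f x\<bar>)"
proof -
  have "\<bar>f y - f x\<bar> * m x \<le> 1 / \<alpha> * (\<mu> x y * \<bar>f y - f x\<bar>)" if "adj \<mu> x y" for y
    using mult_right_mono[OF kernel_ge[OF that], of "\<bar>f y - f x\<bar>"] \<alpha>_pos
    by (simp add: field_simps)
  then have "(\<Sum>y | adj \<mu> x y. \<bar>f y - f x\<bar> * m x) \<le> (\<Sum>y | adj \<mu> x y. 1 / \<alpha> * (\<mu> x y * \<bar>f y - f x\<bar>))"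
    by (intro sum_mono) auto
  moreover have "grad \<mu> f x * m x \<le> (\<Sum>y | adj \<mu> x y. \<bar>f y - f x\<bar>) * m x"
    by (intro mult_right_mono grad_le_sum) simp
  ultimately show ?thesis by (simp add: sum_distrib_left sum_distrib_right)
qed

text \<open>Dominates both \<open>2 * Cp / \<alpha>\<close>, the size of a solution field per unit
  of radius, and \<open>1\<close>, the size of its divergence, so that one division normalises both
  quantities of a test field.\<close>

definition Cf :: real where "Cf = 4 * Cp / \<alpha> + 2"

lemma Cf_pos: "Cf > 0"
  using \<alpha>_pos Cp_pos by (simp add: Cf_def add_pos_pos)

text \<open>Testing a mean-zero \<open>h\<close> bounded by 1 against \<open>\<phi>\<close> sees
  only the oscillation of \<open>\<phi>\<close>, and Poincare bounds that by edge differences, which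
  is the hypothesis of \<open>flow_duality\<close>. The field needs \<open>B z (r + 1)\<close>
  because the gradient on \<open>B z r\<close> also involves edges leaving
  \<open>B z r\<close>.\<close>

lemma divergence_solution:
  assumes r: "0 < r" and h: "\<And>x. x \<in> B z r \<Longrightarrow> \<bar>h x\<bar> \<le> 1" "\<And>x. x \<notin> B z r \<Longrightarrow> h x = 0"
    and mean: "(\<Sum>x\<in>B z r. h x * m x) = 0"
  obtains F where "\<And>x y. F x y = - F y x" "\<And>x y. \<bar>F x y\<bar> \<le> 2 * Cp / \<alpha> * r"
    "\<And>x y. (x, y) \<notin> edges_in \<mu> (B z (r + 1)) \<Longrightarrow> F x y = 0"
    "\<And>x. x \<in> B z (r + 1) \<Longrightarrow> vdiv \<mu> F x = h x"
proof -
  let ?S = "B z (r + 1)" and ?K = "Cp / \<alpha> * r"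
  have sub: "B z r \<subseteq> ?S" by (rule gball_mono) simp
  have nbr: "y \<in> ?S" if "x \<in> B z r" "adj \<mu> x y" for x y
    using that gdist_adj[of x y] d_triangle[of z y x] by (simp add: mem_gball)
  have K: "0 \<le> ?K" using r Cp_pos \<alpha>_pos by simp
  have dual: "(\<Sum>x\<in>?S. \<phi> x * (h x * m x)) \<le> ?K * (\<Sum>x\<in>?S. \<Sum>y\<in>?S. \<mu> x y * \<bar>\<phi> x - \<phi> y\<bar>)" for \<phi>
  proof -
    let ?c = "avg \<mu> (B z r) \<phi>"
    have "(\<Sum>x\<in>?S. \<phi> x * (h x * m x)) = (\<Sum>x\<in>B z r. \<phi> x * (h x * m x))"
      by (rule sum.mono_neutral_right) (use sub h in auto)
    also have "\<dots> = (\<Sum>x\<in>B z r. \<phi> x * (h x * m x)) - ?c * (\<Sum>x\<in>B z r. h x * m x)"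
      by (simp add: mean)
    also have "\<dots> = (\<Sum>x\<in>B z r. (\<phi> x - ?c) * h x * m x)"
      by (simp add: sum_distrib_left sum_subtractf[symmetric] algebra_simps)
    also have "\<dots> \<le> osc \<phi> z r"
      unfolding osc_def
    proof (rule sum_mono)
      fix x assume "x \<in> B z r"
      have "(\<phi> x - ?c) * h x \<le> \<bar>(\<phi> x - ?c) * h x\<bar>" by (rule abs_ge_self)
      also have "\<dots> \<le> \<bar>\<phi> x - ?c\<bar>"
        using mult_left_mono[OF h(1)[OF \<open>x \<in> B z r\<close>], of "\<bar>\<phi> x - ?c\<bar>"] by (simp add: abs_mult)
      finally show "(\<phi> x - ?c) * h x * m x \<le> \<bar>\<phi> x - ?c\<bar> * m x" by (intro mult_right_mono) auto
    qed
    also have "\<dots> \<le> Cp * r * (\<Sum>x\<in>B z r. grad \<mu> \<phi> x * m x)" by (rule poincare[OF r])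
    also have "\<dots> \<le> Cp * r * (\<Sum>x\<in>B z r. 1 / \<alpha> * (\<Sum>y | adj \<mu> x y. \<mu> x y * \<bar>\<phi> y - \<phi> x\<bar>))"
      using r Cp_pos by (intro mult_left_mono sum_mono grad_mass_le) auto
    also have "\<dots> = ?K * (\<Sum>x\<in>B z r. (\<Sum>y | adj \<mu> x y. \<mu> x y * \<bar>\<phi> y - \<phi> x\<bar>))"
      by (simp add: sum_distrib_left)
    also have "\<dots> \<le> ?K * (\<Sum>x\<in>B z r. (\<Sum>y\<in>?S. \<mu> x y * \<bar>\<phi> y - \<phi> x\<bar>))"
      by (intro mult_left_mono[OF _ K] sum_mono sum_mono2) (auto simp: nbr weight_nonneg)
    also have "\<dots> \<le> ?K * (\<Sum>x\<in>?S. (\<Sum>y\<in>?S. \<mu> x y * \<bar>\<phi> y - \<phi> x\<bar>))"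
      by (intro mult_left_mono[OF _ K] sum_mono2 sub) (auto simp: weight_nonneg intro!: sum_nonneg)
    finally show ?thesis by (simp add: abs_minus_commute)
  qed
  obtain F where F: "\<And>x y. F x y = - F y x" "\<And>x y. \<bar>F x y\<bar> \<le> 2 * ?K"
    "\<And>x. x \<in> ?S \<Longrightarrow> (\<Sum>y\<in>?S. \<mu> x y * F x y) = h x * m x"
    using flow_duality[of ?S \<mu> ?K "\<lambda>x. h x * m x", OF finite_gball weight_sym K dual] by blast
  \<comment> \<open>Values off the edges inside the ball carry no weight in the solved equation and
    can be erased.\<close>
  define F' where "F' = (\<lambda>x y. if (x, y) \<in> edges_in \<mu> ?S then F x y else 0)"
  show thesis
  proof
    fix x y
    have "(x, y) \<in> edges_in \<mu> ?S \<longleftrightarrow> (y, x) \<in> edges_in \<mu> ?S"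
      using adj_sym by (auto simp: edges_in_def)
    then show "F' x y = - F' y x" using F(1)[of x y] by (auto simp: F'_def)
    show "\<bar>F' x y\<bar> \<le> 2 * Cp / \<alpha> * r" using F(2)[of x y] K by (auto simp: F'_def)
    show "(x, y) \<notin> edges_in \<mu> ?S \<Longrightarrow> F' x y = 0" by (simp add: F'_def)
  next
    fix x assume x: "x \<in> ?S"
    have "vdiv \<mu> F' x * m x = (\<Sum>y\<in>?S. \<mu> x y * F' x y)"
      by (intro vdiv_mass_on) (auto simp: F'_def edges_in_def)
    also have "\<dots> = (\<Sum>y\<in>?S. \<mu> x y * F x y)"
      using x by (intro sum.cong refl) (auto simp: F'_def edges_in_def not_adj_weight)
    also have "\<dots> = h x * m x" by (rule F(3)[OF x])
    finally show "vdiv \<mu> F' x = h x" by simp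
  qed
qed

text \<open>The oscillation is a pairing of \<open>f\<close> with a mean-zero function made from the
  sign of \<open>f\<close> minus its average, and that function is a divergence. The ball of radius
  \<open>3 * r\<close> turns the solution into a test field: since \<open>1 \<le> r\<close>, it
  contains \<open>B z (r + 1)\<close> together with all neighbours.\<close>

lemma osc_le_Mplus:
  assumes r: "1 \<le> r" and x: "x \<in> B z r"
  shows "ennreal (1 / (r * V z r) * osc f z r) \<le> ennreal (6 * Cf * Cd\<^sup>2) * Mplus \<mu> f x"
proof -
  let ?c = "avg \<mu> (B z r) f" and ?S = "B z (r + 1)" and ?R = "3 * r"
  let ?I = "vinterior \<mu> (B z ?R)"
  have r0: "0 < r" using r by simp
  define s where "s = (\<lambda>y. sgn (f y - ?c))"
  \<comment> \<open>Recentring the sign restores mean zero; the half keeps the bound 1 and reappears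
    as the factor 2 in \<open>osc_eq\<close>.\<close>
  define h where "h = (\<lambda>y. if y \<in> B z r then (s y - avg \<mu> (B z r) s) / 2 else 0)"
  have avs: "\<bar>avg \<mu> (B z r) s\<bar> \<le> 1"
  proof -
    have "\<bar>avg \<mu> (B z r) s * V z r\<bar> \<le> (\<Sum>x\<in>B z r. \<bar>s x * m x\<bar>)"
      unfolding avg_mult_V[OF r0] by (rule sum_abs)
    also have "\<dots> \<le> (\<Sum>x\<in>B z r. m x)"
      by (intro sum_mono) (auto simp: s_def sgn_if)
    also have "\<dots> = V z r" by (simp add: vol_def)
    finally show ?thesis using V_pos[OF r0, of z] by (simp add: abs_mult)
  qed
  have h1: "\<bar>h y\<bar> \<le> 1" for y
  proof -
    have "\<bar>s y\<bar> \<le> 1" by (simp add: s_def sgn_if)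
    with avs show ?thesis by (simp add: h_def abs_le_iff)
  qed
  have h0: "h y = 0" if "y \<notin> B z r" for y using that by (simp add: h_def)
  have mean: "(\<Sum>y\<in>B z r. h y * m y) = 0"
  proof -
    have "(\<Sum>y\<in>B z r. h y * m y) = (\<Sum>y\<in>B z r. (s y - avg \<mu> (B z r) s) * m y) / 2"
      unfolding sum_divide_distrib by (intro sum.cong refl) (simp add: h_def)
    then show ?thesis by (simp add: sum_minus_avg[OF r0])
  qed
  have osc_eq: "osc f z r = 2 * (\<Sum>y\<in>B z r. f y * h y * m y)"
  proof -
    have "2 * (\<Sum>y\<in>B z r. f y * h y * m y) = 2 * (\<Sum>y\<in>B z r. f y * h y * m y) - 2 * ?c * (\<Sum>y\<in>B z r. h y * m y)"
      by (simp add: mean)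
    also have "\<dots> = (\<Sum>y\<in>B z r. (f y - ?c) * (2 * h y) * m y)"
      by (simp add: sum_distrib_left sum_subtractf[symmetric] algebra_simps)
    also have "\<dots> = (\<Sum>y\<in>B z r. \<bar>f y - ?c\<bar> * m y - avg \<mu> (B z r) s * ((f y - ?c) * m y))"
    proof (intro sum.cong refl)
      fix y assume y: "y \<in> B z r"
      have "(f y - ?c) * (2 * h y) * m y = ((f y - ?c) * s y) * m y - avg \<mu> (B z r) s * ((f y - ?c) * m y)"
      proof -
        have "2 * h y = s y - avg \<mu> (B z r) s" using y by (simp add: h_def)
        then show ?thesis by (simp only:) (simp add: algebra_simps)
      qed
      also have "(f y - ?c) * s y = \<bar>f y - ?c\<bar>" by (simp add: s_def abs_sgn)
      finally show "(f y - ?c) * (2 * h y) * m y = \<bar>f y - ?c\<bar> * m y - avg \<mu> (B z r) s * ((f y - ?c) * m y)" .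
    qed
    also have "\<dots> = osc f z r - avg \<mu> (B z r) s * (\<Sum>y\<in>B z r. (f y - ?c) * m y)"
      by (simp add: sum_subtractf sum_distrib_left osc_def)
    finally show ?thesis by (simp add: sum_minus_avg[OF r0])
  qed
  obtain F where F: "\<And>x y. F x y = - F y x" "\<And>x y. \<bar>F x y\<bar> \<le> 2 * Cp / \<alpha> * r"
    "\<And>x y. (x, y) \<notin> edges_in \<mu> ?S \<Longrightarrow> F x y = 0"
    "\<And>x. x \<in> ?S \<Longrightarrow> vdiv \<mu> F x = h x"
    by (rule divergence_solution[OF r0 h1 _ mean], erule h0, rule that)
  have SI: "?S \<subseteq> ?I"
  proof
    fix y assume y: "y \<in> ?S"
    have "w \<in> B z ?R" if "adj \<mu> y w" for w
      using y that gdist_adj[of y w] d_triangle[of z w y] r by (simp add: mem_gball)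
    moreover have "y \<in> B z ?R" using y r by (simp add: mem_gball)
    ultimately show "y \<in> ?I" by (auto simp: vinterior_def vboundary_def)
  qed
  have Fz: "vdiv \<mu> F y = 0" if "y \<notin> ?S" for y
    unfolding vdiv_def using that F(3) by (intro sum.neutral) (auto simp: edges_in_def)
  \<comment> \<open>\<open>W\<close> carries the volume of the larger ball and \<open>Cf\<close>;
    the extra 3 in \<open>\<Phi>\<close> accounts for the radius \<open>3 * r\<close> in the
    divergence bound.\<close>
  define W where "W = r * V z ?R * Cf"
  have VR: "V z ?R > 0" using r by simp
  have W: "W > 0" using r Cf_pos VR by (simp add: W_def)
  define \<Phi> where "\<Phi> = (\<lambda>x y. F x y / (3 * W))"
  have vd: "vdiv \<mu> \<Phi> y = vdiv \<mu> F y / (3 * W)" for y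
    by (simp add: vdiv_def \<Phi>_def sum_divide_distrib)
  have "test_field \<mu> z ?R \<Phi>"
    unfolding test_field_def
  proof (intro conjI allI impI)
    fix x y
    show "\<Phi> x y = - \<Phi> y x" using F(1)[of x y] by (simp add: \<Phi>_def)
    assume "(x, y) \<notin> edges_in \<mu> ?I"
    then have "(x, y) \<notin> edges_in \<mu> ?S" using SI by (auto simp: edges_in_def)
    then show "\<Phi> x y = 0" by (simp add: \<Phi>_def F(3))
  next
    have bound: "\<bar>\<Phi> x y\<bar> \<le> 1 / V z ?R" for x y
    proof -
      have "\<bar>F x y\<bar> \<le> r * Cf"
      proof -
        have "2 * Cp / \<alpha> \<le> Cf" using Cp_pos \<alpha>_pos by (simp add: Cf_def field_simps)
        then show ?thesis using F(2)[of x y] mult_right_mono[of "2 * Cp / \<alpha>" Cf r] r by (simp add: mult.commute)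
      qed
      then have "\<bar>F x y\<bar> * V z ?R \<le> W" using VR by (simp add: W_def mult_right_mono)
      then show ?thesis using W VR by (simp add: \<Phi>_def field_simps)
    qed
    have "(SUP (x, y)\<in>edges_in \<mu> (B z ?R). ennreal \<bar>\<Phi> x y\<bar>) \<le> ennreal (1 / V z ?R)"
      by (intro SUP_least) (use bound in \<open>auto intro!: ennreal_leI\<close>)
    then have "edge_sup_norm \<mu> (B z ?R) \<Phi> \<le> ennreal (1 / V z ?R) / 2"
      unfolding edge_sup_norm_def by (rule divide_right_mono_ennreal)
    also have "\<dots> = ennreal (1 / V z ?R / 2)" using VR by (intro ennreal_divide_numeral) simp
    also have "\<dots> \<le> ennreal (1 / V z ?R)" using VR by (intro ennreal_leI) (simp add: field_simps)
    finally show "edge_sup_norm \<mu> (B z ?R) \<Phi> \<le> ennreal (1 / V z ?R)" .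
  next
    have "\<bar>vdiv \<mu> \<Phi> y\<bar> \<le> 1 / (?R * V z ?R)" for y
    proof -
      have "\<bar>vdiv \<mu> F y\<bar> \<le> 1" using F(4)[of y] Fz[of y] h1[of y] by (cases "y \<in> ?S") auto
      moreover have "r * V z ?R \<le> W"
      proof -
        have "1 \<le> Cf" using Cp_pos \<alpha>_pos by (simp add: Cf_def)
        then show ?thesis using mult_left_mono[of 1 Cf "r * V z ?R"] r VR by (simp add: W_def)
      qed
      ultimately have "\<bar>vdiv \<mu> F y\<bar> / (3 * W) \<le> 1 / (3 * (r * V z ?R))"
        using r VR by (intro frac_le) auto
      then show ?thesis using W by (simp add: vd)
    qed
    then show "(SUP y\<in>?I. ennreal \<bar>vdiv \<mu> \<Phi> y\<bar>) \<le> ennreal (1 / (?R * V z ?R))"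
      by (intro SUP_least ennreal_leI)
  qed
  moreover have "x \<in> B z ?R" using x r by (simp add: mem_gball)
  ultimately have "ennreal \<bar>\<Sum>y\<in>?I. f y * vdiv \<mu> \<Phi> y * m y\<bar> \<le> Mplus \<mu> f x"
    unfolding Mplus_def using r by (intro SUP_upper2[of "(z, ?R, \<Phi>)"]) auto
  moreover have "(\<Sum>y\<in>?I. f y * vdiv \<mu> \<Phi> y * m y) = osc f z r / (6 * W)"
  proof -
    have finI: "finite ?I" by (rule finite_subset[of _ "B z ?R"]) (auto simp: vinterior_def)
    have "B z r \<subseteq> ?S" by (rule gball_mono) simp
    then have BI: "B z r \<subseteq> ?I" using SI by blast
    have hv: "vdiv \<mu> F y = h y" for y
      using F(4)[of y] Fz[of y] \<open>B z r \<subseteq> ?S\<close> by (cases "y \<in> ?S") (auto simp: h_def)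
    have "(\<Sum>y\<in>?I. f y * vdiv \<mu> \<Phi> y * m y) = (\<Sum>y\<in>?I. f y * h y * m y) / (3 * W)"
      unfolding sum_divide_distrib by (intro sum.cong refl) (simp add: vd hv)
    also have "(\<Sum>y\<in>?I. f y * h y * m y) = (\<Sum>y\<in>B z r. f y * h y * m y)"
      by (rule sum.mono_neutral_right[OF finI BI]) (auto simp: h_def)
    finally show ?thesis by (simp add: osc_eq)
  qed
  ultimately have M: "ennreal (osc f z r / (6 * W)) \<le> Mplus \<mu> f x" using W by simp
  have "1 / (r * V z r) \<le> 6 * (Cf * Cd\<^sup>2) / (6 * W)"
  proof -
    have "V z ?R \<le> Cd\<^sup>2 * V z r" using r by (intro vol_le_dilate) auto
    then have "V z ?R * (r * Cf) \<le> Cd\<^sup>2 * V z r * (r * Cf)"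
      using r Cf_pos by (intro mult_right_mono) auto
    then have "W \<le> (r * V z r) * (Cf * Cd\<^sup>2)" by (simp add: W_def algebra_simps)
    then show ?thesis using W r0 by (simp add: field_simps)
  qed
  then have "1 / (r * V z r) * osc f z r \<le> 6 * (Cf * Cd\<^sup>2) / (6 * W) * osc f z r"
    by (intro mult_right_mono) auto
  then have "ennreal (1 / (r * V z r) * osc f z r) \<le> ennreal (6 * Cf * Cd\<^sup>2 * (osc f z r / (6 * W)))"
    by (intro ennreal_leI) (simp add: algebra_simps)
  also have "\<dots> = ennreal (6 * Cf * Cd\<^sup>2) * ennreal (osc f z r / (6 * W))"
    using Cf_pos W by (subst ennreal_mult) auto
  also have "\<dots> \<le> ennreal (6 * Cf * Cd\<^sup>2) * Mplus \<mu> f x" by (intro mult_left_mono M) auto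
  finally show ?thesis .
qed

end

section \<open>Embeddings of seminormed spaces\<close>

definition embeds ::
  "('v \<Rightarrow> real) set \<Rightarrow> (('v \<Rightarrow> real) \<Rightarrow> ennreal) \<Rightarrow>
   ('v \<Rightarrow> real) set \<Rightarrow> (('v \<Rightarrow> real) \<Rightarrow> ennreal) \<Rightarrow> bool" where
  "embeds A nA B nB \<longleftrightarrow> A \<subseteq> B \<and> (\<exists>C>0. \<forall>f\<in>A. nB f \<le> ennreal C * nA f)"

lemma embedsI: "A \<subseteq> B \<Longrightarrow> 0 < C \<Longrightarrow> (\<And>f. f \<in> A \<Longrightarrow> nB f \<le> ennreal C * nA f) \<Longrightarrow> embeds A nA B nB"
  unfolding embeds_def by blast

lemma embeds_trans:
  assumes "embeds A nA B nB" "embeds B nB C nC"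
  shows "embeds A nA C nC"
proof -
  obtain c c' where c: "0 < c" "\<And>f. f \<in> A \<Longrightarrow> nB f \<le> ennreal c * nA f"
    and c': "0 < c'" "\<And>f. f \<in> B \<Longrightarrow> nC f \<le> ennreal c' * nB f"
    using assms unfolding embeds_def by blast
  show ?thesis
  proof (rule embedsI)
    show "A \<subseteq> C" using assms by (auto simp: embeds_def)
    show "0 < c' * c" using c c' by simp
    fix f assume f: "f \<in> A"
    then have "f \<in> B" using assms by (auto simp: embeds_def)
    then have "nC f \<le> ennreal c' * nB f" by (rule c')
    also have "\<dots> \<le> ennreal c' * (ennreal c * nA f)" by (intro mult_left_mono c f) simp
    finally show "nC f \<le> ennreal (c' * c) * nA f" using c c' by (simp add: ennreal_mult mult.assoc)
  qed
qed

lemma same_spaceI: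
  assumes "embeds A nA B nB" "embeds B nB A nA"
  shows "same_space A nA B nB"
proof -
  obtain c c' where c: "0 < c" "\<And>f. f \<in> A \<Longrightarrow> nB f \<le> ennreal c * nA f"
    and c': "0 < c'" "\<And>f. f \<in> B \<Longrightarrow> nA f \<le> ennreal c' * nB f"
    using assms unfolding embeds_def by blast
  have AB: "A = B" using assms unfolding embeds_def by blast
  have "nA f \<le> ennreal (max c c') * nB f \<and> nB f \<le> ennreal (max c c') * nA f" if "f \<in> A" for f
  proof
    have "ennreal c' * nB f \<le> ennreal (max c c') * nB f" "ennreal c * nA f \<le> ennreal (max c c') * nA f"
      by (intro mult_right_mono ennreal_leI; simp)+
    with c(2)[OF that] c'(2)[of f] that AB
    show "nA f \<le> ennreal (max c c') * nB f" "nB f \<le> ennreal (max c c') * nA f"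
      by (auto intro: order_trans)
  qed
  moreover have "max c c' > 0" using c by simp
  ultimately show ?thesis using AB unfolding same_space_def by blast
qed

lemma ennreal_le_mult_INF:
  fixes a :: ennreal
  assumes C: "0 < C" and le: "\<And>x. x \<in> A \<Longrightarrow> a \<le> ennreal C * F x"
  shows "a \<le> ennreal C * (INF x\<in>A. F x)"
proof -
  have "a / ennreal C \<le> (INF x\<in>A. F x)"
    by (intro INF_greatest divide_le_posI_ennreal le) (use C in auto)
  then have "ennreal C * (a / ennreal C) \<le> ennreal C * (INF x\<in>A. F x)"
    by (rule mult_left_mono) simp
  moreover have "ennreal C * (a / ennreal C) = a * ennreal C / ennreal C"
    by (simp only: ennreal_times_divide mult.commute)
  moreover have "\<dots> = a" using C by (intro ennreal_mult_divide_eq) auto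
  ultimately show ?thesis by simp
qed

context weighted_graph
begin

lemma S_embeds_HSmax:
  "embeds (S_space \<mu>) (S_seminorm \<mu>) (HSmax_space \<mu>) (HSmax_seminorm \<mu>)"
proof -
  have le: "HSmax_seminorm \<mu> f \<le> S_seminorm \<mu> f" for f
    unfolding HSmax_seminorm_def S_seminorm_def by (intro nn_integral_mono Mplus_le_Nmax)
  show ?thesis
    by (rule embedsI[of _ _ 1]) (use le in \<open>auto simp: S_space_def HSmax_space_def intro: le_less_trans\<close>)
qed

lemma osc_le_real:
  assumes "Nmax \<mu> f x \<le> ennreal n" "0 \<le> n" "0 < r" "x \<in> B z r"
  shows "osc f z r \<le> n * (r * V z r)"
proof -
  have "ennreal (1 / (r * V z r) * osc f z r) \<le> ennreal n"
    using osc_le_Nmax[OF assms(3,4)] assms(1) by (rule order_trans)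
  then have "1 / (r * V z r) * osc f z r \<le> n" using assms(2) by (simp only: ennreal_le_iff)
  moreover have "0 < r * V z r" using assms(3) by simp
  ultimately show ?thesis by (simp add: field_simps)
qed

end

section \<open>Chaining averages to obtain a Hajlasz gradient\<close>

context doubling_graph
begin

lemma avg_diff_le:
  assumes n: "Nmax \<mu> f x \<le> ennreal n" "0 \<le> n" and r: "0 < r" "x \<in> B z r" "0 < r'"
    and sub: "B z' r' \<subseteq> B z r" and K: "V z r \<le> K * V z' r'"
  shows "\<bar>avg \<mu> (B z' r') f - avg \<mu> (B z r) f\<bar> \<le> K * r * n"
proof -
  let ?c = "avg \<mu> (B z r) f"
  have "(avg \<mu> (B z' r') f - ?c) * V z' r' = (\<Sum>y\<in>B z' r'. (f y - ?c) * m y)"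
    by (simp add: left_diff_distrib avg_mult_V[OF r(3)] sum_subtractf sum_distrib_left[symmetric] vol_def[symmetric])
  then have "\<bar>avg \<mu> (B z' r') f - ?c\<bar> * V z' r' = \<bar>\<Sum>y\<in>B z' r'. (f y - ?c) * m y\<bar>"
    by (metis abs_mult abs_of_nonneg vol_nonneg)
  also have "\<dots> \<le> (\<Sum>y\<in>B z' r'. \<bar>(f y - ?c) * m y\<bar>)" by (rule sum_abs)
  also have "\<dots> \<le> (\<Sum>y\<in>B z r. \<bar>(f y - ?c) * m y\<bar>)" by (intro sum_mono2 sub) auto
  also have "\<dots> = osc f z r" by (simp add: osc_def abs_mult)
  also have "\<dots> \<le> n * (r * V z r)" by (rule osc_le_real) (use n r in auto)
  also have "\<dots> \<le> n * (r * (K * V z' r'))" using K n r by (intro mult_left_mono) auto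
  finally have "\<bar>avg \<mu> (B z' r') f - ?c\<bar> * V z' r' \<le> (K * r * n) * V z' r'" by (simp add: mult_ac)
  then show ?thesis using V_pos[OF r(3), of z'] by (simp only: mult_le_cancel_right_pos)
qed

text \<open>Each halving of the radius costs \<open>Cd * r * n\<close> at the current radius, and
  these costs form a geometric series. The chain stops because below radius 1 the ball is
  \<open>{x}\<close> and the average is \<open>f x\<close>; \<open>k\<close> bounds the number of
  halvings.\<close>

lemma point_minus_avg:
  assumes n: "Nmax \<mu> f x \<le> ennreal n" "0 \<le> n" and r: "0 < r" "r < 2 ^ k"
  shows "\<bar>f x - avg \<mu> (B x r) f\<bar> \<le> 2 * Cd * r * n"
  using r
proof (induction k arbitrary: r)
  case 0
  then show ?case using n(2) by (simp add: gball_small avg_singleton)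
next
  case (Suc k)
  have "\<bar>f x - avg \<mu> (B x (r / 2)) f\<bar> \<le> 2 * Cd * (r / 2) * n"
    using Suc.prems by (intro Suc.IH) auto
  moreover have "\<bar>avg \<mu> (B x (r / 2)) f - avg \<mu> (B x r) f\<bar> \<le> Cd * r * n"
    using Suc.prems V_double[of "r / 2" x]
    by (intro avg_diff_le[OF n]) (auto intro!: gball_mono)
  ultimately show ?case by (simp add: algebra_simps)
qed

lemma hajlasz_of_Nmax:
  assumes n: "\<And>x. Nmax \<mu> f x \<le> ennreal (n x)" "\<And>x. 0 \<le> n x"
  shows "\<bar>f x - f y\<bar> \<le> d x y * (6 * Cd\<^sup>2 * n x + 6 * Cd\<^sup>2 * n y)"
proof (cases "x = y")
  case False
  let ?D = "d x y"
  have D: "1 \<le> ?D" using False gdist_eq_0_iff[of x y] by linarith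
  obtain k where k: "2 * ?D < 2 ^ k" using real_arch_pow[of 2] by auto
  have "\<bar>f x - avg \<mu> (B x ?D) f\<bar> \<le> 2 * Cd * ?D * n x"
    by (rule point_minus_avg[OF n, where k = k]; use D k in linarith)
  moreover have "\<bar>f y - avg \<mu> (B y (2 * ?D)) f\<bar> \<le> 2 * Cd * (2 * ?D) * n y"
    by (rule point_minus_avg[OF n, where k = k]; use D k in linarith)
  \<comment> \<open>The smaller ball fits into \<open>B y (2 * ?D)\<close>, so this link is charged
    to the point \<open>y\<close>; hence the asymmetric choice of radii.\<close>
  moreover have "\<bar>avg \<mu> (B x ?D) f - avg \<mu> (B y (2 * ?D)) f\<bar> \<le> Cd\<^sup>2 * (2 * ?D) * n y"
    using D d_sym[of x y]
    by (intro avg_diff_le[OF n] vol_le_dilate gball_subset) auto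
  ultimately have "\<bar>f x - f y\<bar> \<le> 2 * (Cd * (?D * n x)) + 4 * (Cd * (?D * n y)) + 2 * (Cd\<^sup>2 * (?D * n y))"
    by (simp add: algebra_simps)
  also have "\<dots> \<le> 6 * (Cd\<^sup>2 * (?D * n x)) + 6 * (Cd\<^sup>2 * (?D * n y))"
  proof -
    have "Cd \<le> Cd\<^sup>2" using Cd_ge_1 by (simp add: power2_eq_square)
    then have "Cd * (?D * n x) \<le> Cd\<^sup>2 * (?D * n x)" "Cd * (?D * n y) \<le> Cd\<^sup>2 * (?D * n y)"
      using n(2) by (auto intro!: mult_right_mono mult_nonneg_nonneg)
    moreover have "0 \<le> Cd\<^sup>2 * (?D * n x)" using n(2) by simp
    ultimately show ?thesis by linarith
  qed
  finally show ?thesis by (simp add: algebra_simps)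
qed simp

lemma S_embeds_M: "embeds (S_space \<mu>) (S_seminorm \<mu>) (M_space \<mu>) (M_seminorm \<mu>)"
proof -
  have key: "\<exists>g\<in>hajlasz_gradients \<mu> f. Lp_norm \<mu> 1 g \<le> ennreal (6 * Cd\<^sup>2) * S_seminorm \<mu> f"
    if f: "f \<in> S_space \<mu>" for f
  proof -
    have int: "(\<integral>\<^sup>+x. Nmax \<mu> f x \<partial>vmeasure \<mu>) < \<infinity>"
      using f by (simp add: S_space_def S_seminorm_def)
    define n where "n = (\<lambda>x. enn2real (Nmax \<mu> f x))"
    have n: "Nmax \<mu> f x = ennreal (n x)" for x
      using finite_point_if_integrable[OF int, of x] by (simp add: n_def)
    have n0: "0 \<le> n x" for x by (simp add: n_def)
    define g where "g = (\<lambda>x. 6 * Cd\<^sup>2 * n x)"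
    have "Lp_norm \<mu> 1 g = (\<integral>\<^sup>+x. ennreal (6 * Cd\<^sup>2) * Nmax \<mu> f x \<partial>vmeasure \<mu>)"
      unfolding Lp_norm_1
      by (intro nn_integral_cong) (simp add: g_def n n0 abs_mult ennreal_mult)
    also have "\<dots> = ennreal (6 * Cd\<^sup>2) * S_seminorm \<mu> f"
      unfolding S_seminorm_def by (intro nn_integral_cmult borel_measurable_vmeasure)
    finally have L: "Lp_norm \<mu> 1 g = ennreal (6 * Cd\<^sup>2) * S_seminorm \<mu> f" .
    moreover have "\<dots> < \<infinity>"
      using int by (simp add: S_seminorm_def ennreal_mult_less_top)
    moreover have "\<bar>f x - f y\<bar> \<le> d x y * (g x + g y)" for x y
      unfolding g_def by (rule hajlasz_of_Nmax) (simp_all add: n n0)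
    moreover have "0 \<le> g x" for x using n0 by (simp add: g_def)
    ultimately show ?thesis by (intro bexI[of _ g]) (auto simp: hajlasz_gradients_def)
  qed
  show ?thesis
  proof (rule embedsI)
    show "S_space \<mu> \<subseteq> M_space \<mu>" using key by (auto simp: M_space_def)
    show "0 < 6 * Cd\<^sup>2" using Cd_ge_1 by simp
    show "M_seminorm \<mu> f \<le> ennreal (6 * Cd\<^sup>2) * S_seminorm \<mu> f" if "f \<in> S_space \<mu>" for f
      unfolding M_seminorm_def using key[OF that] by (meson INF_lower2)
  qed
qed

end

context poincare_graph
begin

lemma HSmax_embeds_S:
  "embeds (HSmax_space \<mu>) (HSmax_seminorm \<mu>) (S_space \<mu>) (S_seminorm \<mu>)"
proof -
  let ?C = "6 * Cf * Cd\<^sup>2"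
  have pw: "Nmax \<mu> f x \<le> ennreal ?C * Mplus \<mu> f x" for f x
  proof (rule Nmax_le)
    fix z r assume "0 < r" "x \<in> B z r"
    then show "ennreal (1 / (r * V z r) * osc f z r) \<le> ennreal ?C * Mplus \<mu> f x"
      using osc_le_Mplus[of r x z f] by (cases "1 \<le> r") (auto simp: osc_small)
  qed
  have le: "S_seminorm \<mu> f \<le> ennreal ?C * HSmax_seminorm \<mu> f" for f
    unfolding HSmax_seminorm_def S_seminorm_def
    by (subst nn_integral_cmult[symmetric]) (auto intro!: nn_integral_mono pw)
  show ?thesis
  proof (rule embedsI[OF _ _ le])
    show "0 < ?C" using Cf_pos Cd_ge_1 by simp
    show "HSmax_space \<mu> \<subseteq> S_space \<mu>"
      unfolding HSmax_space_def S_space_def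
      using le by (auto intro!: le_less_trans[OF le] simp: ennreal_mult_less_top)
  qed
qed

end

section \<open>Atomic decomposition\<close>

context weighted_graph
begin

text \<open>Up to a constant factor, these are \<open>HS_atom\<close>s for all exponents \<open>t > 1\<close> at once.\<close>

definition unit_atom :: "('v \<Rightarrow> real) \<Rightarrow> bool" where
  "unit_atom a \<longleftrightarrow> (\<exists>z r. 0 < r \<and> (\<forall>x. x \<notin> B z r \<longrightarrow> a x = 0) \<and> (\<Sum>x\<in>B z r. a x * m x) = 0 \<and>
    (\<forall>x y. adj \<mu> x y \<longrightarrow> \<bar>a y - a x\<bar> \<le> 1 / V z r))"

text \<open>
  The series is only required to converge on each edge: the coefficients being summable, this
  already implies convergence of the gradients in \<open>L\<^sup>1\<close>.
\<close>

definition atomic_le :: "('v \<Rightarrow> real) \<Rightarrow> real \<Rightarrow> bool" where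
  "atomic_le f K \<longleftrightarrow> (\<exists>(c :: nat \<Rightarrow> real) a. (\<forall>i. unit_atom (a i)) \<and>
    (\<lambda>i. \<bar>c i\<bar>) summable_on UNIV \<and> (\<Sum>\<^sub>\<infinity>i. \<bar>c i\<bar>) \<le> K \<and>
    (\<forall>x y. adj \<mu> x y \<longrightarrow> ((\<lambda>i. c i * (a i y - a i x)) has_sum (f y - f x)) UNIV))"

text \<open>An atom that varies along an edge has an endpoint of it in its ball, whose volume is
  then at least the mass of that endpoint. As the bound is the same for all atoms, a series with
  summable coefficients converges absolutely on each edge.\<close>

lemma unit_atom_diff_le:
  assumes "unit_atom a" "adj \<mu> x y"
  shows "\<bar>a y - a x\<bar> \<le> 1 / m x + 1 / m y"
proof -
  obtain z r where a: "0 < r" "\<And>x. x \<notin> B z r \<Longrightarrow> a x = 0" "\<bar>a y - a x\<bar> \<le> 1 / V z r"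
    using assms unfolding unit_atom_def by blast
  have inv: "1 / V z r \<le> 1 / m w" if "w \<in> B z r" for w
    using m_le_V[OF that] vmass_pos[of w] by (simp add: frac_le)
  have pos: "0 \<le> 1 / m w" for w by simp
  consider "x \<in> B z r" | "y \<in> B z r" | "a x = 0" "a y = 0" using a(2) by blast
  then show ?thesis
  proof cases
    case 1
    then show ?thesis using a(3) inv[of x] pos[of y] by linarith
  next
    case 2
    then show ?thesis using a(3) inv[of y] pos[of x] by linarith
  next
    case 3
    then show ?thesis using pos[of x] pos[of y] by simp
  qed
qed

lemma unit_atom_0: "unit_atom (\<lambda>_. 0)"
  unfolding unit_atom_def by (intro exI[of _ undefined] exI[of _ 1]) auto

lemma atomic_le_mono: "atomic_le f K \<Longrightarrow> K \<le> K' \<Longrightarrow> atomic_le f K'"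
  unfolding atomic_le_def by (meson order_trans)

lemma atomic_le_diff:
  assumes "atomic_le f K" "adj \<mu> x y"
  shows "\<bar>f y - f x\<bar> \<le> K * (1 / m x + 1 / m y)"
proof -
  let ?M = "1 / m x + 1 / m y"
  obtain c :: "nat \<Rightarrow> real" and a where c: "\<And>i. unit_atom (a i)" "(\<lambda>i. \<bar>c i\<bar>) summable_on UNIV"
    "(\<Sum>\<^sub>\<infinity>i. \<bar>c i\<bar>) \<le> K" "((\<lambda>i. c i * (a i y - a i x)) has_sum (f y - f x)) UNIV"
    using assms unfolding atomic_le_def by blast
  have le: "norm (c i * (a i y - a i x)) \<le> \<bar>c i\<bar> * ?M" for i
    using unit_atom_diff_le[OF c(1) assms(2), of i] by (simp add: abs_mult mult_left_mono)
  have sM: "(\<lambda>i. \<bar>c i\<bar> * ?M) summable_on UNIV"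
    using c(2) by (rule summable_on_cmult_left)
  have "\<bar>f y - f x\<bar> \<le> (\<Sum>\<^sub>\<infinity>i. \<bar>c i\<bar> * ?M)"
    using norm_infsum_le[OF c(4) has_sum_infsum[OF sM]] le by simp
  also have "\<dots> = (\<Sum>\<^sub>\<infinity>i. \<bar>c i\<bar>) * ?M"
    by (rule infsum_cmult_left) (use c(2) in simp)
  also have "\<dots> \<le> K * ?M" using c(3) by (intro mult_right_mono) auto
  finally show ?thesis .
qed

lemma atomic_le_const:
  assumes "\<And>x y. adj \<mu> x y \<Longrightarrow> f y = f x" "0 \<le> K"
  shows "atomic_le f K"
  unfolding atomic_le_def
  by (intro exI[of _ "\<lambda>_. 0"] exI[of _ "\<lambda>_ _. 0"]) (use assms unit_atom_0 in auto)

lemma atomic_le_mean_zero: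
  assumes r: "0 < r" and supp: "\<And>x. x \<notin> B z r \<Longrightarrow> b x = 0" and mean: "(\<Sum>x\<in>B z r. b x * m x) = 0"
    and lip: "\<And>x y. adj \<mu> x y \<Longrightarrow> \<bar>b y - b x\<bar> \<le> l" and l: "0 \<le> l"
  shows "atomic_le b (l * V z r)"
proof (cases "l = 0")
  case True
  then show ?thesis using lip by (intro atomic_le_const) auto
next
  case False
  define k where "k = l * V z r"
  have k: "0 < k" using False l r by (simp add: k_def)
  define c where "c = (\<lambda>i :: nat. if i = 0 then k else 0)"
  have "unit_atom (\<lambda>x. b x / k)"
    unfolding unit_atom_def
  proof (intro exI[of _ z] exI[of _ r] conjI allI impI)
    show "(\<Sum>x\<in>B z r. b x / k * m x) = 0"
      using mean by (simp add: sum_divide_distrib[symmetric])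
    fix x y assume "adj \<mu> x y"
    have "\<bar>b y / k - b x / k\<bar> = \<bar>b y - b x\<bar> / k" using k by (simp add: diff_divide_distrib[symmetric])
    also have "\<dots> \<le> l / k" using lip[OF \<open>adj \<mu> x y\<close>] k by (intro divide_right_mono) auto
    also have "\<dots> = 1 / V z r" using False by (simp add: k_def)
    finally show "\<bar>b y / k - b x / k\<bar> \<le> 1 / V z r" .
  qed (use r supp in auto)
  moreover have "((\<lambda>i. \<bar>c i\<bar>) has_sum k) UNIV"
    by (rule has_sum_finite_neutralI[of "{0}"]) (use k in \<open>auto simp: c_def\<close>)
  then have "(\<lambda>i. \<bar>c i\<bar>) summable_on UNIV" "(\<Sum>\<^sub>\<infinity>i. \<bar>c i\<bar>) = k"
    by (auto simp: summable_on_def infsumI)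
  moreover have "((\<lambda>i. c i * (b y / k - b x / k)) has_sum (b y - b x)) UNIV" for x y
    by (rule has_sum_finite_neutralI[of "{0}"]) (use k in \<open>auto simp: c_def diff_divide_distrib[symmetric]\<close>)
  ultimately show ?thesis unfolding atomic_le_def k_def[symmetric]
    by (intro exI[of _ c] exI[of _ "\<lambda>_ x. b x / k"]) auto
qed

text \<open>Since \<open>unit_atom_diff_le\<close> makes the family over all index pairs absolutely
  summable on each edge, the iterated sum agrees with a single sum over an enumeration of the
  pairs.\<close>

lemma atomic_le_infsum:
  fixes f :: "'i :: countable \<Rightarrow> 'v \<Rightarrow> real"
  assumes f: "\<And>i. atomic_le (f i) (K i)" and K: "K summable_on UNIV" "infsum K UNIV \<le> K'"
    and edges: "\<And>x y. adj \<mu> x y \<Longrightarrow> ((\<lambda>i. f i y - f i x) has_sum (F y - F x)) UNIV"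
  shows "atomic_le F K'"
proof -
  have "\<forall>i. \<exists>p :: (nat \<Rightarrow> real) \<times> (nat \<Rightarrow> 'v \<Rightarrow> real). (\<forall>n. unit_atom (snd p n)) \<and>
     (\<lambda>n. \<bar>fst p n\<bar>) summable_on UNIV \<and> (\<Sum>\<^sub>\<infinity>n. \<bar>fst p n\<bar>) \<le> K i \<and>
     (\<forall>x y. adj \<mu> x y \<longrightarrow> ((\<lambda>n. fst p n * (snd p n y - snd p n x)) has_sum (f i y - f i x)) UNIV)"
    using f unfolding atomic_le_def by (simp add: split_paired_Ex)
  from choice[OF this] obtain p :: "'i \<Rightarrow> (nat \<Rightarrow> real) \<times> (nat \<Rightarrow> 'v \<Rightarrow> real)" where
    p: "\<forall>i. (\<forall>n. unit_atom (snd (p i) n)) \<and>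
     (\<lambda>n. \<bar>fst (p i) n\<bar>) summable_on UNIV \<and> (\<Sum>\<^sub>\<infinity>n. \<bar>fst (p i) n\<bar>) \<le> K i \<and>
     (\<forall>x y. adj \<mu> x y \<longrightarrow>
       ((\<lambda>n. fst (p i) n * (snd (p i) n y - snd (p i) n x)) has_sum (f i y - f i x)) UNIV)"
    by blast
  define c where "c = (\<lambda>i. fst (p i))"
  define a where "a = (\<lambda>i. snd (p i))"
  have ca: "\<And>i n. unit_atom (a i n)"
    "\<And>i. (\<lambda>n. \<bar>c i n\<bar>) summable_on UNIV" "\<And>i. (\<Sum>\<^sub>\<infinity>n. \<bar>c i n\<bar>) \<le> K i"
    "\<And>i x y. adj \<mu> x y \<Longrightarrow> ((\<lambda>n. c i n * (a i n y - a i n x)) has_sum (f i y - f i x)) UNIV"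
    using p unfolding c_def a_def by blast+
  define s where "s = (\<lambda>i. \<Sum>\<^sub>\<infinity>n. \<bar>c i n\<bar>)"
  have s0: "0 \<le> s i" for i unfolding s_def by (rule infsum_nonneg) simp
  have s: "((\<lambda>n. \<bar>c i n\<bar>) has_sum s i) UNIV" for i
    unfolding s_def by (rule has_sum_infsum[OF ca(2)])
  have s_sum: "s summable_on UNIV"
    by (rule summable_on_comparison_test[OF K(1)]) (use ca(3) s0 in \<open>auto simp: s_def\<close>)
  define C where "C = (\<lambda>(i, n). c i n)"
  define A where "A = (\<lambda>(i, n). a i n)"
  have C_sum: "(\<lambda>p. \<bar>C p\<bar>) summable_on UNIV"
    using summable_on_SigmaI[where A = UNIV and f = "\<lambda>p. \<bar>C p\<bar>" and g = s and B = "\<lambda>_. UNIV"] s s_sum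
    by (simp add: C_def)
  have C_inf: "(\<Sum>\<^sub>\<infinity>p. \<bar>C p\<bar>) \<le> K'"
  proof -
    have "((\<lambda>p. \<bar>C p\<bar>) has_sum (infsum s UNIV)) (Sigma UNIV (\<lambda>_. UNIV))"
      by (rule has_sum_SigmaI[where g = s]) (use s s_sum C_sum in \<open>auto simp: C_def\<close>)
    then have "(\<Sum>\<^sub>\<infinity>p. \<bar>C p\<bar>) = infsum s UNIV" by (simp add: infsumI)
    also have "\<dots> \<le> infsum K UNIV"
      by (rule infsum_mono[OF s_sum K(1)]) (use ca(3) in \<open>auto simp: s_def\<close>)
    finally show ?thesis using K(2) by simp
  qed
  have CA: "((\<lambda>p. C p * (A p y - A p x)) has_sum (F y - F x)) UNIV" if xy: "adj \<mu> x y" for x y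
  proof -
    let ?g = "\<lambda>p. C p * (A p y - A p x)"
    let ?M = "1 / m x + 1 / m y"
    have "(\<lambda>p. \<bar>C p\<bar> * ?M) summable_on UNIV" by (rule summable_on_cmult_left[OF C_sum])
    moreover have "norm (?g p) \<le> \<bar>C p\<bar> * ?M" for p
      using unit_atom_diff_le[OF ca(1) xy] by (cases p) (simp add: A_def abs_mult mult_left_mono)
    ultimately have "(\<lambda>p. norm (?g p)) summable_on UNIV" by (rule Infinite_Sum.abs_summable_on_comparison_test')
    then have "?g summable_on UNIV" by (rule Infinite_Sum.abs_summable_summable)
    then have S: "(?g has_sum (infsum ?g UNIV)) UNIV" by (rule has_sum_infsum)
    have "((\<lambda>i. f i y - f i x) has_sum (infsum ?g UNIV)) UNIV"
      by (rule has_sum_SigmaD[where B = "\<lambda>_. UNIV" and f = ?g]) (use S ca(4)[OF xy] in \<open>auto simp: C_def A_def\<close>)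
    then have "infsum ?g UNIV = F y - F x" using edges[OF xy] by (rule has_sum_unique)
    with S show ?thesis by simp
  qed
  have "infinite (UNIV :: ('i \<times> nat) set)" by (simp add: finite_prod)
  then obtain e :: "nat \<Rightarrow> 'i \<times> nat" where e: "bij e"
    using bij_betw_from_nat_into[of "UNIV :: ('i \<times> nat) set"] by auto
  have "(\<lambda>k. \<bar>C (e k)\<bar>) summable_on UNIV"
    using C_sum summable_on_reindex_bij_betw[OF e, of "\<lambda>p. \<bar>C p\<bar>"] by simp
  moreover have "(\<Sum>\<^sub>\<infinity>k. \<bar>C (e k)\<bar>) \<le> K'"
    using C_inf infsum_reindex_bij_betw[OF e, of "\<lambda>p. \<bar>C p\<bar>"] by simp
  moreover have "((\<lambda>k. C (e k) * (A (e k) y - A (e k) x)) has_sum (F y - F x)) UNIV" if "adj \<mu> x y" for x y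
    using CA[OF that] has_sum_reindex_bij_betw[OF e, of "\<lambda>p. C p * (A p y - A p x)"] by simp
  moreover have "unit_atom (A p)" for p using ca(1) by (cases p) (simp add: A_def)
  ultimately show ?thesis unfolding atomic_le_def
    by (intro exI[of _ "\<lambda>k. C (e k)"] exI[of _ "\<lambda>k. A (e k)"]) auto
qed

text \<open>Telescoping delivers only ordered convergence of the edge differences; the bounds
  \<open>K i\<close>, through \<open>atomic_le_diff\<close>, upgrade it to the unordered sums that
  \<open>atomic_le_infsum\<close> expects.\<close>

lemma atomic_le_sums:
  fixes f :: "nat \<Rightarrow> 'v \<Rightarrow> real"
  assumes f: "\<And>i. atomic_le (f i) (K i)" and K0: "\<And>i. 0 \<le> K i" and K: "\<And>n. (\<Sum>i<n. K i) \<le> K'"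
    and edges: "\<And>x y. adj \<mu> x y \<Longrightarrow> (\<lambda>i. f i y - f i x) sums (F y - F x)"
  shows "atomic_le F K'"
proof -
  have "summable K"
    by (rule summableI_nonneg_bounded[of _ K']) (use K0 K in auto)
  moreover from this have "suminf K \<le> K'" using K by (rule suminf_le_const)
  ultimately have hs: "(K has_sum suminf K) UNIV" and le: "suminf K \<le> K'"
    using K0 by (auto intro!: norm_summable_imp_has_sum)
  show ?thesis
  proof (rule atomic_le_infsum[OF f])
    show "K summable_on UNIV" "infsum K UNIV \<le> K'"
      using hs le by (auto simp: summable_on_def infsumI)
    fix x y assume xy: "adj \<mu> x y"
    have "summable (\<lambda>i. K i * (1 / m x + 1 / m y))"
      by (rule summable_mult2) fact
    then have "summable (\<lambda>i. norm (f i y - f i x))"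
      by (rule summable_comparison_test'[where N = 0]) (use atomic_le_diff[OF f xy] in simp)
    then show "((\<lambda>i. f i y - f i x) has_sum (F y - F x)) UNIV"
      using edges[OF xy] by (rule norm_summable_imp_has_sum)
  qed
qed

lemma atomic_le_add:
  assumes "atomic_le f K" "atomic_le g K'"
  shows "atomic_le (\<lambda>x. f x + g x) (K + K')"
proof (rule atomic_le_infsum[where f = "\<lambda>b. if b then f else g" and K = "\<lambda>b. if b then K else K'"])
  fix x y
  show "((\<lambda>i. (if i then f else g) y - (if i then f else g) x) has_sum (f y + g y - (f x + g x))) UNIV"
    by (rule has_sum_finiteI) (auto simp: UNIV_bool)
qed (use assms in \<open>auto simp: UNIV_bool\<close>)

end

section \<open>Lipschitz functions as sums of atoms\<close>

context doubling_graph
begin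

text \<open>The tents \<open>\<theta> k\<close> have the same total mass \<open>M0\<close> as
  \<open>b\<close>, so consecutive differences have mean zero. A tent of that mass spread over the
  ball of radius \<open>R k\<close> has slope of order \<open>M0 / (R k * V z (R k))\<close>;
  multiplied by the volume, this gives a cost decaying like \<open>(1 / 2) ^ k\<close>.\<close>

lemma atomic_le_bump:
  assumes r: "1 \<le> r" and supp: "\<And>x. x \<notin> B z r \<Longrightarrow> b x = 0"
    and lip: "\<And>x y. adj \<mu> x y \<Longrightarrow> \<bar>b y - b x\<bar> \<le> L" and L: "0 \<le> L"
  shows "atomic_le b (48 * Cd\<^sup>2 * L * V z r)"
proof -
  have r0: "0 < r" using r by simp
  have dadj: "\<bar>d z y - d z x\<bar> \<le> 1" if "adj \<mu> x y" for x y
    using d_triangle[of z y x] d_triangle[of z x y] gdist_adj[OF that] d_sym[of x y] by linarith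
  have sup: "\<bar>b x\<bar> \<le> 3 * r * L" for x
  proof (cases "x \<in> B z r")
    case True
    \<comment> \<open>A vertex just outside \<open>B z r\<close>, at integer distance at most
      \<open>r + 1\<close>: there \<open>b\<close> vanishes, and \<open>1 \<le> r\<close> puts it
      within \<open>3 * r\<close> of \<open>x\<close>.\<close>
    obtain w where w: "gdist \<mu> z w = nat \<lfloor>r\<rfloor> + 1" using gdist_attained by blast
    then have "b w = 0" "d z w \<le> r + 1" using r by (auto intro!: supp simp: mem_gball) linarith+
    moreover have "d x w \<le> d z x + d z w" using d_triangle[of x w z] d_sym[of x z] by simp
    ultimately have "d x w \<le> 3 * r" using True r by (simp add: mem_gball)
    moreover have "\<bar>b x\<bar> \<le> L * d x w" using edge_lipschitz[of b L w x, OF lip] \<open>b w = 0\<close> by simp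
    ultimately show ?thesis using mult_left_mono[of "d x w" "3 * r" L] L by (simp add: mult_ac)
  qed (use supp L r0 in simp)
  define M0 where "M0 = (\<Sum>x\<in>B z r. b x * m x)"
  have M0: "\<bar>M0\<bar> \<le> 3 * r * L * V z r"
  proof -
    have "\<bar>M0\<bar> \<le> (\<Sum>x\<in>B z r. \<bar>b x * m x\<bar>)" unfolding M0_def by (rule sum_abs)
    also have "\<dots> \<le> (\<Sum>x\<in>B z r. 3 * r * L * m x)"
      by (intro sum_mono) (simp add: abs_mult mult_right_mono sup)
    finally show ?thesis by (simp add: vol_def sum_distrib_left)
  qed
  define R where "R = (\<lambda>k :: nat. 2 ^ k * r)"
  have R: "r \<le> R k" "0 < R k" "R k \<le> R (Suc k)" "R (Suc k) = 2 * R k" for k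
    using r0 by (auto simp: R_def mult_le_cancel_right1)
  define \<tau> where "\<tau> = (\<lambda>k x. max 0 (1 - d z x / R k))"
  define N where "N = (\<lambda>k. \<Sum>x\<in>B z (R k). \<tau> k x * m x)"
  have \<tau>_supp: "\<tau> k x = 0" if "x \<notin> B z (R k)" for k x
    using that R(2)[of k] by (simp add: \<tau>_def mem_gball field_simps)
  have \<tau>_lip: "\<bar>\<tau> k y - \<tau> k x\<bar> \<le> 1 / R k" if "adj \<mu> x y" for k x y
  proof -
    have "\<bar>d z y / R k - d z x / R k\<bar> \<le> 1 / R k"
      using dadj[OF that] R(2)[of k] by (simp add: diff_divide_distrib[symmetric] divide_right_mono)
    moreover have "0 \<le> 1 / R k" using R(2)[of k] by simp
    ultimately show ?thesis unfolding \<tau>_def by linarith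
  qed
  have \<tau>_0: "0 \<le> \<tau> k x" for k x by (simp add: \<tau>_def)
  have N: "V z (R k) \<le> 2 * Cd * N k" for k
  proof -
    have sub: "B z (R k / 2) \<subseteq> B z (R k)" using R(2)[of k] by (intro gball_mono) simp
    have "V z (R k / 2) \<le> 2 * (\<Sum>x\<in>B z (R k / 2). \<tau> k x * m x)"
      unfolding vol_def sum_distrib_left
    proof (rule sum_mono)
      fix x assume "x \<in> B z (R k / 2)"
      then have "1 \<le> 2 * \<tau> k x" using R(2)[of k] by (simp add: \<tau>_def mem_gball field_simps)
      then show "m x \<le> 2 * (\<tau> k x * m x)" using mult_right_mono[of 1 "2 * \<tau> k x" "m x"] by simp
    qed
    also have "\<dots> \<le> 2 * N k"
      unfolding N_def by (intro mult_left_mono sum_mono2 sub) (auto simp: \<tau>_0)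
    finally have "Cd * V z (R k / 2) \<le> Cd * (2 * N k)" by (rule mult_left_mono) simp
    moreover have "V z (R k) \<le> Cd * V z (R k / 2)" using V_double[of "R k / 2" z] R(2)[of k] by simp
    ultimately show ?thesis by (simp add: mult_ac)
  qed
  have VR: "0 < V z (R k)" for k using R(2) by simp
  have Npos: "0 < N k" for k
  proof -
    have "0 < 2 * Cd * N k" using VR[of k] N[of k] by linarith
    then show ?thesis using Cd_ge_1 by (simp add: zero_less_mult_iff)
  qed
  define \<theta> where "\<theta> = (\<lambda>k x. M0 / N k * \<tau> k x)"
  \<comment> \<open>A Lipschitz constant for \<open>\<theta> k\<close>: the bound
    \<open>3 * r * L * V z r\<close> on \<open>M0\<close>, divided by \<open>R k\<close> and by the
    lower bound \<open>V z (R k) / (2 * Cd)\<close> for \<open>N k\<close>.\<close>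
  define t where "t = (\<lambda>k. 6 * Cd * L * (V z r / V z (R k)) * (1 / 2) ^ k)"
  have t0: "0 \<le> t k" for k using L by (simp add: t_def)
  have \<theta>_lip: "\<bar>\<theta> k y - \<theta> k x\<bar> \<le> t k" if "adj \<mu> x y" for k x y
  proof -
    have "\<theta> k y - \<theta> k x = M0 / N k * (\<tau> k y - \<tau> k x)"
      by (simp add: \<theta>_def right_diff_distrib)
    then have "\<bar>\<theta> k y - \<theta> k x\<bar> = \<bar>M0\<bar> / N k * \<bar>\<tau> k y - \<tau> k x\<bar>"
      using Npos[of k] by (simp add: abs_mult)
    also have "\<dots> \<le> (3 * r * L * V z r) / N k * (1 / R k)"
      using Npos[of k] R(2)[of k] M0 \<tau>_lip[OF that, of k] L r0
      by (intro mult_mono divide_right_mono) auto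
    also have "\<dots> = (3 * r * L * V z r / R k) * (1 / N k)" by simp
    also have "\<dots> \<le> (3 * r * L * V z r / R k) * (2 * Cd / V z (R k))"
    proof (rule mult_left_mono)
      show "1 / N k \<le> 2 * Cd / V z (R k)"
        using N[of k] Npos[of k] VR[of k] by (simp add: field_simps)
      show "0 \<le> 3 * r * L * V z r / R k" using L r0 R(2)[of k] by simp
    qed
    also have "\<dots> = t k" using r0 by (simp add: t_def R_def power_one_over field_simps)
    finally show ?thesis .
  qed
  \<comment> \<open>Prepending \<open>b\<close> to the tents makes the whole decomposition one
    telescoping series.\<close>
  define g where "g = case_nat b \<theta>"
  define f where "f = (\<lambda>k x. g k x - g (Suc k) x)"
  define K where "K = (\<lambda>k. 24 * Cd\<^sup>2 * L * V z r * (1 / 2) ^ k)"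
  have \<theta>_mean: "(\<Sum>x\<in>B z s. \<theta> k x * m x) = M0" if "R k \<le> s" for k s
  proof -
    have "(\<Sum>x\<in>B z s. \<theta> k x * m x) = M0 / N k * (\<Sum>x\<in>B z s. \<tau> k x * m x)"
      by (simp add: \<theta>_def sum_distrib_left mult_ac)
    also have "(\<Sum>x\<in>B z s. \<tau> k x * m x) = N k"
      unfolding N_def
      by (rule sum.mono_neutral_right) (use gball_mono[OF that] \<tau>_supp in auto)
    finally show ?thesis using Npos[of k] by simp
  qed
  have Cd2: "Cd \<le> Cd\<^sup>2" "1 \<le> Cd\<^sup>2" using Cd_ge_1 by (simp add: power2_eq_square, simp add: one_le_power)
  have LV: "0 \<le> L * V z r" using L by simp
  have f_atomic: "atomic_le (f k) (K k)" for k
  proof (cases k)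
    case 0
    have "atomic_le (f 0) ((L + t 0) * V z r)"
    proof (rule atomic_le_mean_zero[OF r0])
      show "f 0 x = 0" if "x \<notin> B z r" for x
        using that supp \<tau>_supp[of x 0] by (simp add: f_def g_def \<theta>_def R_def)
      show "(\<Sum>x\<in>B z r. f 0 x * m x) = 0"
        using \<theta>_mean[of 0 r] by (simp add: f_def g_def left_diff_distrib sum_subtractf M0_def R_def)
      show "\<bar>f 0 y - f 0 x\<bar> \<le> L + t 0" if "adj \<mu> x y" for x y
        using lip[OF that] \<theta>_lip[OF that, of 0] by (simp add: f_def g_def)
    qed (use L t0 in simp)
    moreover have "(L + t 0) * V z r \<le> K 0"
    proof -
      have "t 0 = 6 * Cd * L" using V_pos[OF r0, of z] by (simp add: t_def R_def)
      then have "(L + t 0) * V z r = (1 + 6 * Cd) * (L * V z r)" by (simp add: algebra_simps)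
      also have "\<dots> \<le> (24 * Cd\<^sup>2) * (L * V z r)" using Cd2 by (intro mult_right_mono LV) linarith
      finally show ?thesis by (simp add: K_def mult_ac)
    qed
    ultimately show ?thesis using 0 atomic_le_mono by blast
  next
    case (Suc j)
    have "atomic_le (f k) ((t j + t k) * V z (R k))"
    proof (rule atomic_le_mean_zero[OF R(2)])
      show "f k x = 0" if "x \<notin> B z (R k)" for x
      proof -
        have "x \<notin> B z (R j)" using that gball_mono[OF R(3)[of j], of z] Suc by auto
        with that show ?thesis using \<tau>_supp[of x k] \<tau>_supp[of x j] by (simp add: f_def g_def \<theta>_def Suc)
      qed
      show "(\<Sum>x\<in>B z (R k). f k x * m x) = 0"
        using \<theta>_mean[of j "R k"] \<theta>_mean[of k "R k"] R(3)[of j]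
        by (simp add: f_def g_def left_diff_distrib sum_subtractf Suc)
      show "\<bar>f k y - f k x\<bar> \<le> t j + t k" if "adj \<mu> x y" for x y
        using \<theta>_lip[OF that, of j] \<theta>_lip[OF that, of k] by (simp add: f_def g_def Suc)
    qed (use t0[of j] t0[of k] in linarith)
    moreover have "(t j + t k) * V z (R k) \<le> K k"
    proof -
      have 1: "V z (R k) \<le> Cd * V z (R j)" using V_double[OF R(2)[of j], of z] R(4)[of j] Suc by simp
      have "t j * V z (R k) \<le> t j * (Cd * V z (R j))" by (intro mult_left_mono 1 t0)
      also have "\<dots> = 12 * Cd\<^sup>2 * (L * V z r) * (1 / 2) ^ k"
        using VR[of j] by (simp add: t_def Suc power2_eq_square field_simps)
      finally have "t j * V z (R k) \<le> 12 * Cd\<^sup>2 * (L * V z r) * (1 / 2) ^ k" .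
      moreover have "t k * V z (R k) = 6 * Cd * (L * V z r) * (1 / 2) ^ k"
        using VR[of k] by (simp add: t_def)
      moreover have "6 * Cd * (L * V z r) * (1 / 2) ^ k \<le> 12 * Cd\<^sup>2 * (L * V z r) * (1 / 2) ^ k"
        using Cd2 by (intro mult_right_mono LV) auto
      ultimately have "(t j + t k) * V z (R k) \<le> 24 * Cd\<^sup>2 * (L * V z r) * (1 / 2) ^ k"
        unfolding distrib_right by linarith
      then show ?thesis by (simp add: K_def mult_ac)
    qed
    ultimately show ?thesis using atomic_le_mono by blast
  qed
  show ?thesis
  proof (rule atomic_le_sums[OF f_atomic])
    show "0 \<le> K k" for k using L by (simp add: K_def)
    show "(\<Sum>i<n. K i) \<le> 48 * Cd\<^sup>2 * L * V z r" for n
    proof -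
      have "(\<Sum>i<n. (1 / 2 :: real) ^ i) \<le> 2" by (simp add: sum_gp_strict)
      then have "24 * Cd\<^sup>2 * L * V z r * (\<Sum>i<n. (1 / 2) ^ i) \<le> 24 * Cd\<^sup>2 * L * V z r * 2"
        using L by (intro mult_left_mono) auto
      then show ?thesis by (simp add: K_def sum_distrib_left)
    qed
    fix x y assume xy: "adj \<mu> x y"
    \<comment> \<open>The slopes of the tents tend to 0, so nothing is left over on an edge although
      the mass \<open>M0\<close> never disappears.\<close>
    have "(\<lambda>k. \<theta> k y - \<theta> k x) \<longlonglongrightarrow> 0"
    proof (rule Lim_null_comparison)
      have "\<bar>\<theta> k y - \<theta> k x\<bar> \<le> 6 * Cd * L * (1 / 2) ^ k" for k
      proof -
        have "V z r / V z (R k) \<le> 1" using VR[of k] V_mono[OF R(1)[of k], of z] by simp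
        then have "6 * Cd * L * (V z r / V z (R k)) * (1 / 2) ^ k \<le> 6 * Cd * L * 1 * (1 / 2) ^ k"
          using L by (intro mult_right_mono mult_left_mono) auto
        then show ?thesis using \<theta>_lip[OF xy, of k] by (simp add: t_def)
      qed
      then show "\<forall>\<^sub>F k in sequentially. norm (\<theta> k y - \<theta> k x) \<le> 6 * Cd * L * (1 / 2) ^ k" by simp
      show "(\<lambda>k. 6 * Cd * L * (1 / 2) ^ k) \<longlonglongrightarrow> 0"
        by (intro tendsto_mult_right_zero LIMSEQ_power_zero) simp
    qed
    then have "(\<lambda>k. g (Suc k) y - g (Suc k) x) \<longlonglongrightarrow> 0" by (simp add: g_def)
    then have "(\<lambda>k. g k y - g k x) \<longlonglongrightarrow> 0" by (rule LIMSEQ_imp_Suc)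
    from telescope_sums'[OF this] show "(\<lambda>k. f k y - f k x) sums (b y - b x)"
      by (simp add: f_def g_def algebra_simps)
  qed
qed

text \<open>Whitney decomposition. As \<open>u\<close> vanishes off \<open>\<Omega>\<close>, its
  size at \<open>x\<close> is at most \<open>L\<close> times the distance \<open>D x\<close> to the
  complement, so pieces at scale \<open>D x\<close> can keep slopes of order \<open>L\<close>. A
  piece costs about \<open>L * V x (D x)\<close>; disjoint balls of a tenth of that radius lie in
  \<open>\<Omega>\<close>, which bounds the total by a multiple of \<open>L * M\<close>. The vertex
  \<open>w\<close> keeps the complement nonempty and \<open>D\<close> meaningful.\<close>

lemma atomic_le_supported_lipschitz:
  assumes L: "0 \<le> L" and lip: "\<And>x y. \<bar>u x - u y\<bar> \<le> L * d x y"
    and supp: "\<And>x. x \<notin> \<Omega> \<Longrightarrow> u x = 0" and w: "w \<notin> \<Omega>"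
    and mass: "emeasure (vmeasure \<mu>) \<Omega> \<le> ennreal M" and M: "0 \<le> M"
  shows "atomic_le u (288 * Cd ^ 6 * L * M)"
proof -
  define D where "D = (\<lambda>x. LEAST n. \<exists>y. y \<notin> \<Omega> \<and> gdist \<mu> x y = n)"
  have D_ex: "\<exists>y. y \<notin> \<Omega> \<and> gdist \<mu> x y = D x" for x
    unfolding D_def by (rule LeastI_ex) (use w in blast)
  have D_le: "D x \<le> gdist \<mu> x y" if "y \<notin> \<Omega>" for x y
    unfolding D_def by (rule Least_le) (use that in blast)
  have D_ge_1: "1 \<le> real (D x)" if "x \<in> \<Omega>" for x
  proof -
    have "D x \<noteq> 0" using D_ex[of x] that gdist_eq_0_iff by metis
    then show ?thesis by linarith
  qed
  have D_lip: "real (D x) \<le> real (D y) + d x y" for x y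
  proof -
    obtain v where v: "v \<notin> \<Omega>" "gdist \<mu> y v = D y" using D_ex by blast
    show ?thesis using D_le[OF v(1), of x] v(2) d_triangle[of x v y] by linarith
  qed
  have u_le: "\<bar>u x\<bar> \<le> L * real (D x)" for x
  proof -
    obtain v where v: "v \<notin> \<Omega>" "gdist \<mu> x v = D x" using D_ex by blast
    show ?thesis using lip[of x v] supp[OF v(1)] v(2) by simp
  qed
  \<comment> \<open>With a tenth, intersecting balls give
    \<open>d x y \<le> (D x + D y) / 10\<close>; as \<open>D y \<le> D x + d x y\<close>, this
    forces \<open>d x y \<le> D x / 4\<close>, well within the radius \<open>D x / 2\<close> used
    for covering.\<close>
  define \<rho> where "\<rho> = (\<lambda>x. real (D x) / 10)"
  define \<F> where "\<F> = {I. I \<subseteq> \<Omega> \<and> pairwise (\<lambda>x y. disjnt (B x (\<rho> x)) (B y (\<rho> y))) I}"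
  \<comment> \<open>Zorn provides a maximal disjoint family; maximality is what makes the enlarged
    balls cover \<open>\<Omega>\<close>.\<close>
  have "\<exists>I\<in>\<F>. \<forall>J\<in>\<F>. I \<subseteq> J \<longrightarrow> J = I"
  proof (rule subset_Zorn')
    fix C assume C: "subset.chain \<F> C"
    have "pairwise (\<lambda>x y. disjnt (B x (\<rho> x)) (B y (\<rho> y))) (\<Union>C)"
    proof (rule pairwiseI)
      fix x y assume xy: "x \<in> \<Union>C" "y \<in> \<Union>C" "x \<noteq> y"
      then obtain I J where IJ: "I \<in> C" "x \<in> I" "J \<in> C" "y \<in> J" by blast
      then have "I \<subseteq> J \<or> J \<subseteq> I" using C by (auto simp: subset.chain_def subset_chain_def)
      moreover have "I \<in> \<F>" "J \<in> \<F>" using C IJ by (auto simp: subset_chain_def)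
      ultimately obtain T where "T \<in> \<F>" "x \<in> T" "y \<in> T" using IJ by blast
      with xy(3) show "disjnt (B x (\<rho> x)) (B y (\<rho> y))" by (auto simp: \<F>_def pairwise_def)
    qed
    moreover have "\<Union>C \<subseteq> \<Omega>" using C by (auto simp: subset_chain_def \<F>_def)
    ultimately show "\<Union>C \<in> \<F>" by (simp add: \<F>_def)
  qed
  then obtain I where I: "I \<in> \<F>" and I_max: "\<And>J. J \<in> \<F> \<Longrightarrow> I \<subseteq> J \<Longrightarrow> J = I" by blast
  have I\<Omega>: "I \<subseteq> \<Omega>" using I by (simp add: \<F>_def)
  have cover: "\<exists>x\<in>I. d x y \<le> real (D x) / 2" if y: "y \<in> \<Omega>" for y
  proof (cases "y \<in> I")
    case True
    then show ?thesis by (intro bexI[of _ y]) auto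
  next
    case False
    then have "insert y I \<notin> \<F>" using I_max[of "insert y I"] by blast
    then obtain x where x: "x \<in> I" "\<not> disjnt (B x (\<rho> x)) (B y (\<rho> y))"
      using I y unfolding \<F>_def by (auto simp: pairwise_insert) (metis disjnt_sym)+
    then obtain v where v: "d x v \<le> \<rho> x" "d y v \<le> \<rho> y" by (auto simp: disjnt_def mem_gball)
    have "d x y \<le> \<rho> x + \<rho> y" using v d_triangle[of x y v] d_sym[of v y] by linarith
    then have "d x y \<le> real (D x) / 2"
      using D_lip[of y x] d_sym[of x y] unfolding \<rho>_def by linarith
    with x show ?thesis by blast
  qed
  obtain e :: "nat \<Rightarrow> 'v" where e: "bij e" by (rule vertex_enumeration)
  \<comment> \<open>The slope \<open>3 * L\<close> is dictated by covering: where
    \<open>d x y \<le> D x / 2\<close> the tent is at least \<open>3 / 2 * L * D x\<close>, and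
    \<open>\<bar>u y\<bar> \<le> L * D y\<close> is no larger than that.\<close>
  define T where "T = (\<lambda>x y. if x \<in> I then 3 * L * max 0 (real (D x) - d x y) else 0)"
  \<comment> \<open>All vertices are enumerated, those outside \<open>I\<close> with a zero tent, so
    finite and infinite \<open>I\<close> need no distinction.\<close>
  define S where "S = rec_nat (\<lambda>_. 0) (\<lambda>n s y. max (s y) (T (e n) y))"
  have S_0: "S 0 = (\<lambda>_. 0)" and S_Suc: "S (Suc n) = (\<lambda>y. max (S n y) (T (e n) y))" for n
    by (simp_all add: S_def)
  have T_ge_0: "0 \<le> T x y" for x y using L by (simp add: T_def)
  have T_lip: "\<bar>T x v - T x y\<bar> \<le> 3 * L" if "adj \<mu> y v" for x y v
  proof -
    have "\<bar>d x v - d x y\<bar> \<le> 1"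
      using d_triangle[of x v y] d_triangle[of x y v] gdist_adj[OF that] d_sym[of v y] by linarith
    then have "\<bar>max 0 (real (D x) - d x v) - max 0 (real (D x) - d x y)\<bar> \<le> 1" by linarith
    then have "3 * L * \<bar>max 0 (real (D x) - d x v) - max 0 (real (D x) - d x y)\<bar> \<le> 3 * L * 1"
      using L by (intro mult_left_mono) auto
    then show ?thesis using L by (simp add: T_def right_diff_distrib[symmetric] abs_mult)
  qed
  have T_supp: "T x y = 0" if "y \<notin> B x (real (D x)) \<or> x \<notin> I" for x y
    using that by (auto simp: T_def mem_gball)
  have S_ge_0: "0 \<le> S n y" for n y by (induction n) (auto simp: S_0 S_Suc le_max_iff_disj)
  have S_lip: "\<bar>S n v - S n y\<bar> \<le> 3 * L" if "adj \<mu> y v" for n y v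
  proof (induction n)
    case (Suc n)
    then show ?case using T_lip[OF that, of "e n"] by (simp add: S_Suc max_def abs_le_iff)
  qed (use L in \<open>simp add: S_0\<close>)
  have S_mono: "S n y \<le> S n' y" if "n \<le> n'" for n n' y
    by (rule lift_Suc_mono_le[of "\<lambda>n. S n y"]) (simp_all add: S_Suc that)
  \<comment> \<open>Clamping \<open>u\<close> between running maxima of tents replaces a partition of unity: it does not
    increase the Lipschitz constant, and consecutive clamps differ only on one Whitney ball.\<close>
  define v where "v = (\<lambda>n y. max (- S n y) (min (u y) (S n y)))"
  define f where "f = (\<lambda>n y. v (Suc n) y - v n y)"
  \<comment> \<open>\<open>288 = 48 * 6\<close>: the difference of two clamps of slope
    \<open>3 * L\<close> is a bump of slope \<open>6 * L\<close>.\<close>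
  define K where "K = (\<lambda>n. if e n \<in> I then 288 * Cd\<^sup>2 * L * V (e n) (real (D (e n))) else 0)"
  have u_lip: "\<bar>u y' - u y\<bar> \<le> 3 * L" if "adj \<mu> y y'" for y y'
  proof -
    have "L * d y' y \<le> L * 1" using gdist_adj[OF adj_sym[OF that]] L by (intro mult_left_mono) auto
    then show ?thesis using lip[of y' y] L by linarith
  qed
  have v_lip: "\<bar>v n y' - v n y\<bar> \<le> 3 * L" if "adj \<mu> y y'" for n y y'
    using S_lip[OF that, of n] u_lip[OF that] unfolding v_def by linarith
  have f_lip: "\<bar>f n y' - f n y\<bar> \<le> 6 * L" if "adj \<mu> y y'" for n y y'
    using v_lip[OF that, of n] v_lip[OF that, of "Suc n"] unfolding f_def by linarith
  have f_supp: "f n y = 0" if "y \<notin> B (e n) (real (D (e n))) \<or> e n \<notin> I" for n y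
    using T_supp[OF that] S_ge_0[of n y] by (simp add: f_def v_def S_Suc max_absorb1)
  have f_atomic: "atomic_le (f n) (K n)" for n
  proof (cases "e n \<in> I")
    case True
    have "atomic_le (f n) (48 * Cd\<^sup>2 * (6 * L) * V (e n) (real (D (e n))))"
      using True I\<Omega> L f_supp f_lip by (intro atomic_le_bump D_ge_1) auto
    then show ?thesis using True by (simp add: K_def mult.assoc)
  next
    case False
    then show ?thesis using f_supp by (simp add: K_def atomic_le_const)
  qed
  show ?thesis
  proof (rule atomic_le_sums[OF f_atomic])
    show "0 \<le> K n" for n using L by (simp add: K_def)
    show "(\<Sum>i<n. K i) \<le> 288 * Cd ^ 6 * L * M" for n
    proof -
      define J where "J = {i. i < n \<and> e i \<in> I}"
      have J: "finite J" "J \<subseteq> {..<n}" by (auto simp: J_def)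
      have inj: "e i = e j \<longleftrightarrow> i = j" for i j using e by (simp add: bij_def inj_eq)
      have \<rho>_pos: "0 < \<rho> x" if "x \<in> I" for x using D_ge_1[of x] that I\<Omega> by (auto simp: \<rho>_def)
      have "(\<Sum>i<n. K i) = (\<Sum>i\<in>J. K i)"
        by (rule sum.mono_neutral_right) (auto simp: J_def K_def)
      also have "\<dots> \<le> (\<Sum>i\<in>J. 288 * Cd ^ 6 * L * V (e i) (\<rho> (e i)))"
      proof (rule sum_mono)
        fix i assume i: "i \<in> J"
        \<comment> \<open>Four doublings undo the division by 10.\<close>
        then have "V (e i) (real (D (e i))) \<le> Cd ^ 4 * V (e i) (\<rho> (e i))"
          using \<rho>_pos[of "e i"] by (intro vol_le_dilate) (auto simp: J_def \<rho>_def)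
        then have "288 * Cd\<^sup>2 * L * V (e i) (real (D (e i))) \<le> 288 * Cd\<^sup>2 * L * (Cd ^ 4 * V (e i) (\<rho> (e i)))"
          using L by (intro mult_left_mono) auto
        also have "\<dots> = 288 * (Cd\<^sup>2 * Cd ^ 4) * L * V (e i) (\<rho> (e i))" by simp
        also have "Cd\<^sup>2 * Cd ^ 4 = Cd ^ 6" by (simp add: power_add[symmetric])
        finally show "K i \<le> 288 * Cd ^ 6 * L * V (e i) (\<rho> (e i))"
          using i by (simp add: K_def J_def)
      qed
      also have "\<dots> = 288 * Cd ^ 6 * L * (\<Sum>i\<in>J. V (e i) (\<rho> (e i)))" by (simp add: sum_distrib_left)
      also have "(\<Sum>i\<in>J. V (e i) (\<rho> (e i))) = vol \<mu> (\<Union>i\<in>J. B (e i) (\<rho> (e i)))"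
        unfolding vol_def
      proof (rule sum.UNION_disjoint[symmetric])
        show "\<forall>i\<in>J. \<forall>j\<in>J. i \<noteq> j \<longrightarrow> B (e i) (\<rho> (e i)) \<inter> B (e j) (\<rho> (e j)) = {}"
          using I by (auto simp: J_def \<F>_def pairwise_def disjnt_def inj)
      qed (use J in auto)
      also have "vol \<mu> (\<Union>i\<in>J. B (e i) (\<rho> (e i))) \<le> M"
      proof -
        have "(\<Union>i\<in>J. B (e i) (\<rho> (e i))) \<subseteq> \<Omega>"
        proof
          fix y assume "y \<in> (\<Union>i\<in>J. B (e i) (\<rho> (e i)))"
          then obtain i where i: "i \<in> J" "d (e i) y \<le> \<rho> (e i)" by (auto simp: mem_gball)
          have "0 < \<rho> (e i)" using i \<rho>_pos by (auto simp: J_def)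
          then have "d (e i) y < real (D (e i))" using i(2) by (simp add: \<rho>_def)
          then show "y \<in> \<Omega>" using D_le[of y "e i"] by (cases "y \<in> \<Omega>") auto
        qed
        then have "emeasure (vmeasure \<mu>) (\<Union>i\<in>J. B (e i) (\<rho> (e i))) \<le> emeasure (vmeasure \<mu>) \<Omega>"
          by (intro emeasure_mono) auto
        also have "\<dots> \<le> ennreal M" by (rule mass)
        finally show ?thesis using M J by (simp add: emeasure_vmeasure_finite)
      qed
      finally show ?thesis using L by (simp add: mult_left_mono)
    qed
    fix x y assume "adj \<mu> x y"
    have conv: "(\<lambda>n. v n y) \<longlonglongrightarrow> u y" for y
    proof (cases "y \<in> \<Omega>")
      case True
      obtain x where x: "x \<in> I" "d x y \<le> real (D x) / 2" using cover[OF True] by blast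
      obtain k where k: "e k = x" using e by (metis bij_pointE)
      have "\<bar>u y\<bar> \<le> L * (3 / 2 * real (D x))"
        using u_le[of y] D_lip[of y x] x(2) d_sym[of x y] L
        by (intro order_trans[OF u_le[of y]] mult_left_mono) auto
      also have "\<dots> \<le> T x y" 
      proof -
        have "real (D x) / 2 \<le> max 0 (real (D x) - d x y)" using x(2) by linarith
        from mult_left_mono[OF this, of "3 * L"] show ?thesis using L x(1) by (simp add: T_def mult_ac)
      qed
      also have "\<dots> \<le> S (Suc k) y" by (simp add: S_Suc k)
      finally have "v n y = u y" if "Suc k \<le> n" for n
        using S_mono[OF that, of y] unfolding v_def by linarith
      then have "\<forall>\<^sub>F n in sequentially. v n y = u y" by (auto simp: eventually_sequentially)
      then show ?thesis by (rule tendsto_eventually)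
    next
      case False
      then have "v n y = u y" for n using supp[of y] S_ge_0[of n y] by (simp add: v_def)
      then show ?thesis by simp
    qed
    have "(\<lambda>n. v n y - v n x) \<longlonglongrightarrow> u y - u x" by (intro tendsto_diff conv)
    from telescope_sums[OF this] show "(\<lambda>i. f i y - f i x) sums (u y - u x)"
      by (simp add: f_def v_def S_0 algebra_simps)
  qed
qed

section \<open>Dyadic level sets of a Hajlasz gradient\<close>

definition mcshane :: "('v \<Rightarrow> real) \<Rightarrow> ('v \<Rightarrow> real) \<Rightarrow> real \<Rightarrow> 'v \<Rightarrow> real" where
  "mcshane f g s x = (INF y\<in>{y. g y \<le> s}. f y + 2 * s * d x y)"

text \<open>On \<open>{g \<le> s}\<close> the Hajlasz inequality makes \<open>f\<close> Lipschitz
  with constant \<open>s + s\<close>, hence the slope \<open>2 * s\<close> of the extension. The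
  point \<open>y0\<close> keeps the infimum over a nonempty set and, through the Lipschitz bound,
  bounded below.\<close>

lemma
  assumes haj: "\<And>x y. \<bar>f x - f y\<bar> \<le> d x y * (g x + g y)" and s: "0 \<le> s" and ne: "g y0 \<le> s"
  shows mcshane_lipschitz: "\<bar>mcshane f g s x - mcshane f g s x'\<bar> \<le> 2 * s * d x x'"
    and mcshane_eq: "g x \<le> s \<Longrightarrow> mcshane f g s x = f x"
proof -
  have fl: "f x \<le> f y + 2 * s * d x y" if "g x \<le> s" "g y \<le> s" for x y
  proof -
    have "d x y * (g x + g y) \<le> d x y * (2 * s)" using that by (intro mult_left_mono) auto
    then show ?thesis using haj[of x y] by (simp add: mult_ac abs_le_iff)
  qed
  have bdd: "bdd_below ((\<lambda>y. f y + 2 * s * d x y) ` {y. g y \<le> s})" for x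
  proof (rule bdd_belowI2)
    fix y assume "y \<in> {y. g y \<le> s}"
    then have "f y0 \<le> f y + 2 * s * d y0 y" using fl[OF ne] by simp
    also have "\<dots> \<le> f y + 2 * s * (d y0 x + d x y)"
      using d_triangle s by (intro add_left_mono mult_left_mono) auto
    finally show "f y0 - 2 * s * d y0 x \<le> f y + 2 * s * d x y" by (simp add: algebra_simps)
  qed
  have le: "mcshane f g s x \<le> f y + 2 * s * d x y" if "g y \<le> s" for x y
    unfolding mcshane_def by (rule cINF_lower[OF bdd]) (use that in simp)
  have half: "mcshane f g s x \<le> mcshane f g s x' + 2 * s * d x x'" for x x'
  proof -
    have "mcshane f g s x - 2 * s * d x x' \<le> mcshane f g s x'"
      unfolding mcshane_def[of f g s x']
    proof (rule cINF_greatest)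
      fix y assume "y \<in> {y. g y \<le> s}"
      then have "mcshane f g s x \<le> f y + 2 * s * d x y" using le by simp
      also have "\<dots> \<le> f y + 2 * s * (d x x' + d x' y)"
        using d_triangle s by (intro add_left_mono mult_left_mono) auto
      finally show "mcshane f g s x - 2 * s * d x x' \<le> f y + 2 * s * d x' y" by (simp add: algebra_simps)
    qed (use ne in auto)
    then show ?thesis by simp
  qed
  show "\<bar>mcshane f g s x - mcshane f g s x'\<bar> \<le> 2 * s * d x x'"
    using half[of x x'] half[of x' x] d_sym[of x x'] by (simp add: abs_le_iff)
  show "mcshane f g s x = f x" if "g x \<le> s"
  proof (rule antisym)
    show "mcshane f g s x \<le> f x" using le[OF that, of x] by simp
    show "f x \<le> mcshane f g s x"
      unfolding mcshane_def by (rule cINF_greatest) (use ne fl that in auto)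
  qed
qed

text \<open>As the level grows the extensions eventually agree with \<open>f\<close> at each point,
  and as it shrinks their slopes tend to 0, so on edges \<open>f\<close> is the sum of the dyadic
  layers. A layer at height \<open>s\<close> costs a multiple of \<open>s * M s\<close>. Layers
  above and below level 1 are summed separately.\<close>

lemma hajlasz_atomic_le:
  assumes g: "\<And>x. 0 \<le> g x" and haj: "\<And>x y. \<bar>f x - f y\<bar> \<le> d x y * (g x + g y)"
    and G: "(\<integral>\<^sup>+x. ennreal (g x) \<partial>vmeasure \<mu>) = ennreal G" "0 \<le> G"
  shows "atomic_le f (6912 * Cd ^ 6 * G)"
proof -
  define \<Omega> where "\<Omega> = (\<lambda>s. {x. s < g x})"
  define M where "M = (\<lambda>s. enn2real (emeasure (vmeasure \<mu>) (\<Omega> s)))"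
  have fin: "emeasure (vmeasure \<mu>) (\<Omega> s) < \<infinity>" if s: "0 < s" for s
  proof -
    have "ennreal s * emeasure (vmeasure \<mu>) (\<Omega> s) = (\<integral>\<^sup>+x. ennreal s * indicator (\<Omega> s) x \<partial>vmeasure \<mu>)"
      by (subst nn_integral_cmult_indicator) auto
    also have "\<dots> \<le> (\<integral>\<^sup>+x. ennreal (g x) \<partial>vmeasure \<mu>)"
      by (intro nn_integral_mono) (auto simp: \<Omega>_def indicator_def intro!: ennreal_leI)
    finally have "ennreal s * emeasure (vmeasure \<mu>) (\<Omega> s) < \<infinity>" using G by (simp add: le_less_trans)
    then show ?thesis using s by (auto simp: ennreal_mult_less_top)
  qed
  have M: "emeasure (vmeasure \<mu>) (\<Omega> s) = ennreal (M s)" "0 \<le> M s" if "0 < s" for s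
    using fin[OF that] by (auto simp: M_def)
  \<comment> \<open>Infinite total mass enters here: a set of finite measure is not everything, so
    there are points to extend from at every positive level.\<close>
  have ne: "\<exists>y. g y \<le> s" if s: "0 < s" for s
  proof (rule ccontr)
    assume "\<not> ?thesis"
    then have "\<Omega> s = UNIV" by (auto simp: \<Omega>_def not_le)
    then show False using fin[OF s] emeasure_vertices by simp
  qed
  let ?h = "mcshane f g"
  have h_lip: "\<bar>?h s x - ?h s y\<bar> \<le> 2 * s * d x y" if s: "0 < s" for s x y
  proof -
    obtain y0 where "g y0 \<le> s" using ne[OF s] by blast
    then show ?thesis by (rule mcshane_lipschitz[OF haj less_imp_le[OF s]])
  qed
  have h_eq: "?h s x = f x" if "0 < s" "g x \<le> s" for s x
    using mcshane_eq[OF haj] that by (meson less_imp_le)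
  \<comment> \<open>The slopes \<open>4 * s\<close> and \<open>2 * s\<close> add up to
    \<open>6 * s\<close>, and both extensions agree with \<open>f\<close> where
    \<open>g \<le> s\<close>.\<close>
  have layer: "atomic_le (\<lambda>x. ?h (2 * s) x - ?h s x) (1728 * Cd ^ 6 * (s * M s))" if s: "0 < s" for s
  proof -
    have "atomic_le (\<lambda>x. ?h (2 * s) x - ?h s x) (288 * Cd ^ 6 * (6 * s) * M s)"
    proof (rule atomic_le_supported_lipschitz[where \<Omega> = "\<Omega> s"])
      fix x y
      show "\<bar>(?h (2 * s) x - ?h s x) - (?h (2 * s) y - ?h s y)\<bar> \<le> 6 * s * d x y"
        using h_lip[of "2 * s" x y] h_lip[of s x y] s by linarith
      show "?h (2 * s) x - ?h s x = 0" if "x \<notin> \<Omega> s"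
        using that s by (simp add: \<Omega>_def h_eq)
      show "(SOME y. g y \<le> s) \<notin> \<Omega> s"
        using someI_ex[OF ne[OF s]] by (simp add: \<Omega>_def)
    qed (use s M[OF s] in auto)
    then show ?thesis by (simp add: mult_ac)
  qed
  \<comment> \<open>Layer-cake estimate for a family of levels; \<open>bound\<close> says that the
    levels below a value \<open>t\<close> add up to at most \<open>2 * t\<close>. Both halves of the
    dyadic scale satisfy it.\<close>
  have level_sum: "(\<Sum>n<N. 1728 * Cd ^ 6 * (l n * M (l n))) \<le> 3456 * Cd ^ 6 * G"
    if l: "\<And>n. 0 < l n" and bound: "\<And>t. 0 \<le> t \<Longrightarrow> (\<Sum>n<N. if l n < t then l n else 0) \<le> 2 * t" for l :: "nat \<Rightarrow> real" and N
  proof -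
    have "ennreal (\<Sum>n<N. l n * M (l n)) = (\<Sum>n<N. ennreal (l n) * emeasure (vmeasure \<mu>) (\<Omega> (l n)))"
      using l M by (subst sum_ennreal[symmetric]) (auto simp: ennreal_mult less_imp_le)
    also have "\<dots> = (\<Sum>n<N. \<integral>\<^sup>+x. ennreal (l n) * indicator (\<Omega> (l n)) x \<partial>vmeasure \<mu>)"
      by (intro sum.cong refl) (subst nn_integral_cmult_indicator, auto)
    also have "\<dots> = (\<integral>\<^sup>+x. (\<Sum>n<N. ennreal (l n) * indicator (\<Omega> (l n)) x) \<partial>vmeasure \<mu>)"
      by (rule nn_integral_sum[symmetric]) (rule borel_measurable_vmeasure)
    also have "\<dots> \<le> (\<integral>\<^sup>+x. ennreal 2 * ennreal (g x) \<partial>vmeasure \<mu>)"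
    proof (rule nn_integral_mono)
      fix x
      have "(\<Sum>n<N. ennreal (l n) * indicator (\<Omega> (l n)) x) = (\<Sum>n<N. ennreal (if l n < g x then l n else 0))"
        by (intro sum.cong refl) (auto simp: \<Omega>_def indicator_def)
      also have "\<dots> = ennreal (\<Sum>n<N. if l n < g x then l n else 0)"
        using l by (intro sum_ennreal) (simp add: less_imp_le)
      also have "\<dots> \<le> ennreal (2 * g x)" by (intro ennreal_leI bound g)
      finally show "(\<Sum>n<N. ennreal (l n) * indicator (\<Omega> (l n)) x) \<le> ennreal 2 * ennreal (g x)"
        using g[of x] by (simp add: ennreal_mult)
    qed
    also have "\<dots> = ennreal 2 * ennreal G"
      by (subst nn_integral_cmult) (simp_all add: G borel_measurable_vmeasure)
    also have "\<dots> = ennreal (2 * G)" using G by (simp add: ennreal_mult)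
    finally have "(\<Sum>n<N. l n * M (l n)) \<le> 2 * G" using G(2) by (simp add: ennreal_le_iff)
    then have "1728 * Cd ^ 6 * (\<Sum>n<N. l n * M (l n)) \<le> 1728 * Cd ^ 6 * (2 * G)"
      by (intro mult_left_mono) auto
    then show ?thesis by (simp add: sum_distrib_left)
  qed
  have dyadic: "(\<Sum>n<N. if (2::real) ^ n < t then 2 ^ n else 0) \<le> 2 * t" if "0 \<le> t" for t N
  proof (induction N)
    case (Suc N)
    show ?case
    proof (cases "2 ^ N < t")
      case True
      have "(\<Sum>n<Suc N. if (2::real) ^ n < t then 2 ^ n else 0) \<le> (\<Sum>n<Suc N. (2::real) ^ n)"
        by (intro sum_mono) auto
      also have "\<dots> = 2 ^ Suc N - 1" by (simp add: sum_gp_strict)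
      finally show ?thesis using True by simp
    qed (use Suc in simp)
  qed (use that in simp)
  have up: "atomic_le (\<lambda>x. f x - ?h 1 x) (3456 * Cd ^ 6 * G)"
  proof (rule atomic_le_sums)
    show "atomic_le (\<lambda>x. ?h (2 * 2 ^ i) x - ?h (2 ^ i) x) (1728 * Cd ^ 6 * (2 ^ i * M (2 ^ i)))" for i :: nat
      by (rule layer) simp
    show "0 \<le> 1728 * Cd ^ 6 * (2 ^ i * M (2 ^ i))" for i :: nat using M(2)[of "2 ^ i"] by simp
    show "(\<Sum>i<n. 1728 * Cd ^ 6 * (2 ^ i * M (2 ^ i))) \<le> 3456 * Cd ^ 6 * G" for n
      by (rule level_sum[of "\<lambda>i. 2 ^ i"]) (use dyadic in auto)
    fix x y
    have lim: "(\<lambda>n. ?h (2 ^ n) x) \<longlonglongrightarrow> f x" for x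
    proof -
      obtain k :: nat where k: "g x < 2 ^ k" using real_arch_pow[of 2] by auto
      have "?h (2 ^ n) x = f x" if "k \<le> n" for n
      proof -
        have "(2::real) ^ k \<le> 2 ^ n" using that by (intro power_increasing) auto
        then have "g x \<le> 2 ^ n" using k by linarith
        then show ?thesis by (intro h_eq) auto
      qed
      then have "\<forall>\<^sub>F n in sequentially. ?h (2 ^ n) x = f x" by (auto simp: eventually_sequentially)
      then show ?thesis by (rule tendsto_eventually)
    qed
    have "(\<lambda>n. ?h (2 ^ n) y - ?h (2 ^ n) x) \<longlonglongrightarrow> f y - f x" by (intro tendsto_diff lim)
    from telescope_sums[OF this]
    show "(\<lambda>i. ?h (2 * 2 ^ i) y - ?h (2 ^ i) y - (?h (2 * 2 ^ i) x - ?h (2 ^ i) x)) sums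
        (f y - ?h 1 y - (f x - ?h 1 x))"
      by (simp add: algebra_simps)
  qed
  have down: "atomic_le (?h 1) (3456 * Cd ^ 6 * G)"
  proof (rule atomic_le_sums)
    let ?l = "\<lambda>i :: nat. 1 / 2 ^ Suc i :: real"
    show "atomic_le (\<lambda>x. ?h (2 * ?l i) x - ?h (?l i) x) (1728 * Cd ^ 6 * (?l i * M (?l i)))" for i :: nat
      by (rule layer) simp
    show "0 \<le> 1728 * Cd ^ 6 * (?l i * M (?l i))" for i :: nat using M(2)[of "?l i"] by simp
    show "(\<Sum>i<n. 1728 * Cd ^ 6 * (?l i * M (?l i))) \<le> 3456 * Cd ^ 6 * G" for n
    proof (rule level_sum[of ?l])
      fix t :: real assume t: "0 \<le> t"
      \<comment> \<open>Reading the levels backwards and scaling by \<open>2 ^ n\<close> turns them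
        into \<open>2 ^ i\<close>, so that \<open>dyadic\<close> serves again.\<close>
      have "(\<Sum>i<n. if ?l i < t then ?l i else 0) = (\<Sum>i<n. if ?l (n - Suc i) < t then ?l (n - Suc i) else 0)"
        by (rule sum.nat_diff_reindex[symmetric])
      also have "\<dots> = (\<Sum>i<n. (if 2 ^ i < 2 ^ n * t then 2 ^ i else 0) / 2 ^ n)"
      proof (intro sum.cong refl)
        fix i assume "i \<in> {..<n}"
        then have "Suc (n - Suc i) = n - i" "i \<le> n" by auto
        then have "?l (n - Suc i) = 2 ^ i / 2 ^ n" by (simp add: power_diff)
        then show "(if ?l (n - Suc i) < t then ?l (n - Suc i) else 0) = (if 2 ^ i < 2 ^ n * t then 2 ^ i else 0) / 2 ^ n"
          by (simp only:) (simp add: field_simps)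
      qed
      also have "\<dots> = (\<Sum>i<n. if 2 ^ i < 2 ^ n * t then 2 ^ i else 0) / 2 ^ n"
        by (simp only: sum_divide_distrib)
      also have "\<dots> \<le> 2 * (2 ^ n * t) / 2 ^ n"
        using t by (intro divide_right_mono dyadic) auto
      finally show "(\<Sum>i<n. if ?l i < t then ?l i else 0) \<le> 2 * t" by simp
    qed simp
    fix x y
    have "(\<lambda>n. ?h (1 / 2 ^ n) y - ?h (1 / 2 ^ n) x) \<longlonglongrightarrow> 0"
    proof (rule Lim_null_comparison)
      show "\<forall>\<^sub>F n in sequentially. norm (?h (1 / 2 ^ n) y - ?h (1 / 2 ^ n) x) \<le> 2 * d y x * (1 / 2) ^ n"
        using h_lip[of "1 / 2 ^ _" y x] by (simp add: power_one_over mult_ac)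
      show "(\<lambda>n. 2 * d y x * (1 / 2) ^ n) \<longlonglongrightarrow> 0"
        by (intro tendsto_mult_right_zero LIMSEQ_power_zero) simp
    qed
    from telescope_sums'[OF this]
    show "(\<lambda>i. ?h (2 * ?l i) y - ?h (?l i) y - (?h (2 * ?l i) x - ?h (?l i) x)) sums (?h 1 y - ?h 1 x)"
      by (simp add: algebra_simps)
  qed
  show ?thesis using atomic_le_add[OF up down] by (simp add: algebra_simps)
qed

text \<open>The gradient sits on \<open>B z (r + 1)\<close>, whose volume may exceed
  \<open>V z r\<close> by the factor \<open>Cd\<^sup>2\<close>. Dividing the atom by
  \<open>Cd\<^sup>2\<close> pays for this uniformly in the exponent, because
  \<open>(Cd\<^sup>2 * V z r) powr (1 - p)\<close> is at most \<open>V z r powr (1 - p)\<close> for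
  \<open>1 < p\<close>.\<close>

lemma HS_atom_of_unit_atom:
  assumes a: "unit_atom a" and t: "1 < t"
  shows "HS_atom \<mu> t (\<lambda>x. a x / Cd\<^sup>2)"
proof -
  obtain z r where r: "0 < r" and supp: "\<And>x. x \<notin> B z r \<Longrightarrow> a x = 0"
    and mean: "(\<Sum>x\<in>B z r. a x * m x) = 0"
    and lip: "\<And>x y. adj \<mu> x y \<Longrightarrow> \<bar>a y - a x\<bar> \<le> 1 / V z r"
    using a unfolding unit_atom_def by blast
  let ?a = "\<lambda>x. a x / Cd\<^sup>2" and ?l = "1 / (Cd\<^sup>2 * V z r)"
  have V: "0 < V z r" using r by simp
  have Cd2: "1 \<le> Cd\<^sup>2" using Cd_ge_1 by (simp add: one_le_power)
  have l: "0 \<le> ?l" using V by simp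
  have grad: "grad \<mu> ?a x \<le> ?l" for x
  proof (rule grad_le_sup[OF _ l])
    fix y assume "adj \<mu> x y"
    have "\<bar>?a y - ?a x\<bar> = \<bar>a y - a x\<bar> / Cd\<^sup>2"
      using Cd2 by (simp add: diff_divide_distrib[symmetric] abs_divide)
    also have "\<dots> \<le> (1 / V z r) / Cd\<^sup>2" by (intro divide_right_mono lip \<open>adj \<mu> x y\<close>) simp
    finally show "\<bar>?a y - ?a x\<bar> \<le> ?l" by (simp add: mult.commute)
  qed
  have grad0: "grad \<mu> ?a x = 0" if "x \<notin> B z (r + 1)" for x
    by (rule grad_support[OF _ that]) (simp add: supp)
  have "Lp_norm \<mu> t (grad \<mu> ?a) \<le> ennreal (V z r powr - (1 - enn2real (1 / t)))"
  proof (cases "t = \<infinity>")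
    case True
    have "?l \<le> 1 / V z r" using mult_right_mono[OF Cd2, of "V z r"] V by (intro frac_le) auto
    then have "grad \<mu> ?a x \<le> 1 / V z r" for x using grad[of x] by linarith
    then have "Lp_norm \<mu> t (grad \<mu> ?a) \<le> ennreal (1 / V z r)"
      unfolding Lp_norm_def using True by (auto intro!: SUP_least ennreal_leI)
    also have "1 / V z r = V z r powr - (1 - enn2real (1 / t))"
      using True V by (simp add: powr_minus_divide)
    finally show ?thesis .
  next
    case False
    then obtain p where p: "t = ennreal p" "0 \<le> p" by (cases t) auto
    then have p1: "1 < p" using t by (simp add: ennreal_less_iff flip: ennreal_1)
    have inv: "enn2real (1 / t) = 1 / p"
      using p1 by (simp add: p divide_ennreal flip: ennreal_1)
    define I where "I = (\<integral>\<^sup>+x. ennreal (\<bar>grad \<mu> ?a x\<bar> powr p) \<partial>vmeasure \<mu>)"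
    have "I \<le> (\<integral>\<^sup>+x. ennreal (?l powr p) * indicator (B z (r + 1)) x \<partial>vmeasure \<mu>)"
      unfolding I_def
    proof (rule nn_integral_mono)
      fix x
      have "\<bar>grad \<mu> ?a x\<bar> powr p \<le> ?l powr p"
        using grad[of x] p by (intro powr_mono2) auto
      then show "ennreal (\<bar>grad \<mu> ?a x\<bar> powr p) \<le> ennreal (?l powr p) * indicator (B z (r + 1)) x"
        using grad0[of x] p p1 by (auto simp: indicator_def intro: ennreal_leI)
    qed
    also have "\<dots> = ennreal (\<Sum>x\<in>B z (r + 1). ?l powr p * m x)"
      by (intro nn_integral_vmeasure_finite) auto
    also have "(\<Sum>x\<in>B z (r + 1). ?l powr p * m x) = ?l powr p * V z (r + 1)"
      by (simp add: vol_def sum_distrib_left)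
    finally have I: "I \<le> ennreal (?l powr p * V z (r + 1))" .
    have "?l powr p * V z (r + 1) \<le> ?l powr p * (Cd\<^sup>2 * V z r)"
      by (intro mult_left_mono V_add_1 r) simp
    also have "\<dots> = (Cd\<^sup>2 * V z r) powr (1 - p)"
    proof -
      have "0 < Cd\<^sup>2 * V z r" using Cd2 V by (intro mult_pos_pos) auto
      then show ?thesis by (simp add: powr_diff powr_one_gt_zero_iff powr_divide)
    qed
    also have "\<dots> \<le> (V z r) powr (1 - p)"
      using p1 Cd2 V by (intro powr_mono2') (auto simp: mult_le_cancel_right1)
    finally have le: "?l powr p * V z (r + 1) \<le> V z r powr (1 - p)" .
    have If: "I < \<infinity>" using I by (rule le_less_trans) simp
    have "enn2real I \<le> V z r powr (1 - p)"
      using I le by (intro enn2real_leI) (auto intro: order_trans ennreal_leI)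
    then have "enn2real I powr (1 / p) \<le> (V z r powr (1 - p)) powr (1 / p)"
      using p by (intro powr_mono2) auto
    also have "\<dots> = V z r powr - (1 - enn2real (1 / t))"
    proof -
      have "(1 - p) * (1 / p) = - (1 - 1 / p)" using p1 by (simp add: field_simps)
      then show ?thesis by (simp only: powr_powr inv)
    qed
    finally have "ennreal (enn2real I powr (1 / p)) \<le> ennreal (V z r powr - (1 - enn2real (1 / t)))"
      by (rule ennreal_leI)
    moreover have "Lp_norm \<mu> t (grad \<mu> ?a) = ennreal (enn2real I powr (1 / p))"
    proof -
      have "enn2real t = p" using p by simp
      moreover have "I \<noteq> \<infinity>" using If by simp
      ultimately show ?thesis using False by (simp only: Lp_norm_def Let_def I_def if_False)
    qed
    ultimately show ?thesis by (simp only:)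
  qed
  moreover have "(\<Sum>x\<in>B z r. ?a x * m x) = 0"
    using mean by (simp add: sum_divide_distrib[symmetric])
  ultimately show ?thesis
    unfolding HS_atom_def using r supp by (intro exI[of _ z] exI[of _ r]) auto
qed

text \<open>An unsquared edge sum dominates \<open>grad\<close> and is easy to estimate termwise
  along a series. Its integral is uniform in the atom: at most \<open>N\<close> neighbours,
  differences at most \<open>1 / V z r\<close>, on a set of volume at most
  \<open>Cd\<^sup>2 * V z r\<close>.\<close>

lemma unit_atom_gradient_integral:
  "\<exists>E\<ge>0. \<forall>a. unit_atom a \<longrightarrow> (\<integral>\<^sup>+x. (\<Sum>y | adj \<mu> x y. ennreal \<bar>a y - a x\<bar>) \<partial>vmeasure \<mu>) \<le> ennreal E"
proof -
  obtain N where N: "\<And>x. card (B x 1) \<le> N" using locally_uniformly_finite by blast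
  have deg: "card {y. adj \<mu> x y} \<le> N" for x
    using card_mono[OF finite_gball nbrs_subset_gball, of x] N[of x] by simp
  have "(\<integral>\<^sup>+x. (\<Sum>y | adj \<mu> x y. ennreal \<bar>a y - a x\<bar>) \<partial>vmeasure \<mu>) \<le> ennreal (real N * Cd\<^sup>2)"
    if a: "unit_atom a" for a
  proof -
    obtain z r where r: "0 < r" and supp: "\<And>x. x \<notin> B z r \<Longrightarrow> a x = 0"
      and lip: "\<And>x y. adj \<mu> x y \<Longrightarrow> \<bar>a y - a x\<bar> \<le> 1 / V z r"
      using a unfolding unit_atom_def by blast
    have V: "0 < V z r" using r by simp
    have "(\<integral>\<^sup>+x. (\<Sum>y | adj \<mu> x y. ennreal \<bar>a y - a x\<bar>) \<partial>vmeasure \<mu>)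
        \<le> (\<integral>\<^sup>+x. ennreal (real N * (1 / V z r)) * indicator (B z (r + 1)) x \<partial>vmeasure \<mu>)"
    proof (rule nn_integral_mono)
      fix x
      show "(\<Sum>y | adj \<mu> x y. ennreal \<bar>a y - a x\<bar>)
          \<le> ennreal (real N * (1 / V z r)) * indicator (B z (r + 1)) x"
      proof (cases "x \<in> B z (r + 1)")
        case True
        have "(\<Sum>y | adj \<mu> x y. \<bar>a y - a x\<bar>) \<le> real (card {y. adj \<mu> x y}) * (1 / V z r)"
          by (rule sum_bounded_above) (use lip in auto)
        also have "\<dots> \<le> real N * (1 / V z r)" using deg[of x] V by (intro mult_right_mono) auto
        finally show ?thesis using True by (simp add: sum_ennreal ennreal_leI)
      next
        case False
        have "a y = 0 \<and> a x = 0" if "adj \<mu> x y" for y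
          using False d_triangle[of z x y] gdist_adj[OF adj_sym[OF that]] supp
          by (auto simp: mem_gball)
        then show ?thesis by simp
      qed
    qed
    also have "\<dots> = ennreal (\<Sum>x\<in>B z (r + 1). real N * (1 / V z r) * m x)"
      using V by (intro nn_integral_vmeasure_finite) auto
    also have "(\<Sum>x\<in>B z (r + 1). real N * (1 / V z r) * m x) = real N * (1 / V z r) * V z (r + 1)"
      by (simp add: vol_def sum_distrib_left)
    also have "\<dots> \<le> real N * (1 / V z r) * (Cd\<^sup>2 * V z r)"
      using V by (intro mult_left_mono V_add_1 r) auto
    also have "\<dots> = real N * Cd\<^sup>2" using V by simp
    finally show ?thesis by (simp add: ennreal_leI)
  qed
  then show ?thesis by (intro exI[of _ "real N * Cd\<^sup>2"]) auto
qed

text \<open>On each edge the remainder of the series is the tail of an absolutely convergent sum;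
  integrating termwise bounds the \<open>L1\<close> norm of its gradient by \<open>E\<close> times
  the tail of the coefficients, which tends to 0.\<close>

lemma HSato_of_atomic_le:
  assumes f: "atomic_le f K" and t: "1 < t"
  shows "f \<in> HSato_space \<mu> t" "HSato_seminorm \<mu> t f \<le> ennreal (Cd\<^sup>2 * K)"
proof -
  obtain c :: "nat \<Rightarrow> real" and a where a: "\<And>i. unit_atom (a i)"
    and c: "(\<lambda>i. \<bar>c i\<bar>) summable_on UNIV" "(\<Sum>\<^sub>\<infinity>i. \<bar>c i\<bar>) \<le> K"
    and sums: "\<And>x y. adj \<mu> x y \<Longrightarrow> ((\<lambda>i. c i * (a i y - a i x)) has_sum (f y - f x)) UNIV"
    using f unfolding atomic_le_def by blast
  obtain E where E: "0 \<le> E"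
    "\<And>a. unit_atom a \<Longrightarrow> (\<integral>\<^sup>+x. (\<Sum>y | adj \<mu> x y. ennreal \<bar>a y - a x\<bar>) \<partial>vmeasure \<mu>) \<le> ennreal E"
    using unit_atom_gradient_integral by blast
  have c_sums: "(\<lambda>i. \<bar>c i\<bar>) sums (\<Sum>\<^sub>\<infinity>i. \<bar>c i\<bar>)"
    using c(1) by (intro has_sum_imp_sums has_sum_infsum)
  then have c_summable: "summable (\<lambda>i. \<bar>c i\<bar>)" by (rule sums_summable)
  have c_suminf: "(\<Sum>i. \<bar>c i\<bar>) = (\<Sum>\<^sub>\<infinity>i. \<bar>c i\<bar>)" using c_sums by (rule sums_unique[symmetric])
  have C: "0 < Cd\<^sup>2" using Cd_ge_1 by simp
  define h where "h = (\<lambda>k x. f x - (\<Sum>i\<le>k. c i * a i x))"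
  have h_edge: "ennreal \<bar>h k y - h k x\<bar> \<le> (\<Sum>i. ennreal \<bar>c (i + Suc k)\<bar> * ennreal \<bar>a (i + Suc k) y - a (i + Suc k) x\<bar>)"
    if xy: "adj \<mu> x y" for k x y
  proof -
    let ?g = "\<lambda>i. c (i + Suc k) * (a (i + Suc k) y - a (i + Suc k) x)"
    have hh: "h k y - h k x = f y - f x - (\<Sum>i<Suc k. c i * (a i y - a i x))"
      by (simp add: h_def lessThan_Suc_atMost right_diff_distrib sum_subtractf)
    have "(\<lambda>i. c i * (a i y - a i x)) sums (f y - f x)" by (rule has_sum_imp_sums[OF sums[OF xy]])
    then have g: "?g sums (h k y - h k x)"
      by (subst sums_iff_shift) (simp add: hh del: sum.lessThan_Suc)
    have "summable (\<lambda>i. \<bar>c i\<bar> * (1 / m x + 1 / m y))" by (rule summable_mult2[OF c_summable])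
    then have "summable (\<lambda>i. \<bar>c i * (a i y - a i x)\<bar>)"
      by (rule summable_comparison_test'[where N = 0])
        (use unit_atom_diff_le[OF a xy] in \<open>simp add: abs_mult mult_left_mono\<close>)
    then have abs: "summable (\<lambda>i. \<bar>?g i\<bar>)" by (rule summable_ignore_initial_segment)
    have "\<bar>h k y - h k x\<bar> \<le> (\<Sum>i. \<bar>?g i\<bar>)" using summable_rabs[OF abs] sums_unique[OF g] by simp
    then have "ennreal \<bar>h k y - h k x\<bar> \<le> ennreal (\<Sum>i. \<bar>?g i\<bar>)" by (rule ennreal_leI)
    also have "\<dots> = (\<Sum>i. ennreal \<bar>?g i\<bar>)" by (rule suminf_ennreal2[symmetric, OF _ abs]) simp
    finally show ?thesis by (simp add: abs_mult ennreal_mult)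
  qed
  have h_norm: "Lp_norm \<mu> 1 (grad \<mu> (h k)) \<le> ennreal (E * (\<Sum>i. \<bar>c (i + Suc k)\<bar>))" for k
  proof -
    have "Lp_norm \<mu> 1 (grad \<mu> (h k)) \<le> (\<integral>\<^sup>+x. (\<Sum>y | adj \<mu> x y. ennreal \<bar>h k y - h k x\<bar>) \<partial>vmeasure \<mu>)"
      unfolding Lp_norm_1
    proof (rule nn_integral_mono)
      fix x
      show "ennreal \<bar>grad \<mu> (h k) x\<bar> \<le> (\<Sum>y | adj \<mu> x y. ennreal \<bar>h k y - h k x\<bar>)"
        using grad_le_sum[of "h k" x] by (simp add: sum_ennreal ennreal_leI)
    qed
    also have "\<dots> \<le> (\<integral>\<^sup>+x. (\<Sum>i. ennreal \<bar>c (i + Suc k)\<bar> *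
        (\<Sum>y | adj \<mu> x y. ennreal \<bar>a (i + Suc k) y - a (i + Suc k) x\<bar>)) \<partial>vmeasure \<mu>)"
    proof (rule nn_integral_mono)
      fix x
      have "(\<Sum>y | adj \<mu> x y. ennreal \<bar>h k y - h k x\<bar>)
        \<le> (\<Sum>y | adj \<mu> x y. \<Sum>i. ennreal \<bar>c (i + Suc k)\<bar> * ennreal \<bar>a (i + Suc k) y - a (i + Suc k) x\<bar>)"
        by (intro sum_mono h_edge) simp
      also have "\<dots> = (\<Sum>i. \<Sum>y | adj \<mu> x y. ennreal \<bar>c (i + Suc k)\<bar> * ennreal \<bar>a (i + Suc k) y - a (i + Suc k) x\<bar>)"
        by (rule suminf_sum[symmetric]) simp
      finally show "(\<Sum>y | adj \<mu> x y. ennreal \<bar>h k y - h k x\<bar>) \<le> (\<Sum>i. ennreal \<bar>c (i + Suc k)\<bar> *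
        (\<Sum>y | adj \<mu> x y. ennreal \<bar>a (i + Suc k) y - a (i + Suc k) x\<bar>))"
        by (simp only: sum_distrib_left)
    qed
    also have "\<dots> = (\<Sum>i. ennreal \<bar>c (i + Suc k)\<bar> *
        (\<integral>\<^sup>+x. (\<Sum>y | adj \<mu> x y. ennreal \<bar>a (i + Suc k) y - a (i + Suc k) x\<bar>) \<partial>vmeasure \<mu>))"
      by (simp add: nn_integral_suminf nn_integral_cmult borel_measurable_vmeasure)
    also have "\<dots> \<le> (\<Sum>i. ennreal \<bar>c (i + Suc k)\<bar> * ennreal E)"
      by (intro suminf_le mult_left_mono E(2) a) auto
    also have "\<dots> = (\<Sum>i. ennreal (\<bar>c (i + Suc k)\<bar> * E))"
      using E(1) by (simp add: ennreal_mult)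
    also have "\<dots> = ennreal (\<Sum>i. \<bar>c (i + Suc k)\<bar> * E)"
      using E(1) by (intro suminf_ennreal2 summable_mult2 summable_ignore_initial_segment[OF c_summable]) auto
    also have "(\<Sum>i. \<bar>c (i + Suc k)\<bar> * E) = E * (\<Sum>i. \<bar>c (i + Suc k)\<bar>)"
      by (subst suminf_mult2[OF summable_ignore_initial_segment[OF c_summable], symmetric]) (simp only: mult.commute)
    finally show ?thesis .
  qed
  have "(\<lambda>k. \<Sum>i. \<bar>c (i + Suc k)\<bar>) \<longlonglongrightarrow> 0"
  proof -
    have "(\<lambda>k. (\<Sum>i. \<bar>c i\<bar>) - (\<Sum>i<Suc k. \<bar>c i\<bar>)) \<longlonglongrightarrow> (\<Sum>i. \<bar>c i\<bar>) - (\<Sum>i. \<bar>c i\<bar>)"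
      by (intro tendsto_diff tendsto_const LIMSEQ_Suc summable_LIMSEQ c_summable)
    then show ?thesis using suminf_minus_initial_segment[OF c_summable, of "Suc _"] by simp
  qed
  then have "(\<lambda>k. ennreal (E * (\<Sum>i. \<bar>c (i + Suc k)\<bar>))) \<longlonglongrightarrow> ennreal (E * 0)"
    by (intro tendsto_ennrealI tendsto_mult tendsto_const)
  then have up: "(\<lambda>k. ennreal (E * (\<Sum>i. \<bar>c (i + Suc k)\<bar>))) \<longlonglongrightarrow> 0"
    by (simp only: mult_zero_right ennreal_0)
  have lim: "(\<lambda>k. Lp_norm \<mu> 1 (grad \<mu> (h k))) \<longlonglongrightarrow> 0"
  proof (rule tendsto_sandwich[OF _ _ tendsto_const up])
    show "\<forall>\<^sub>F k in sequentially. 0 \<le> Lp_norm \<mu> 1 (grad \<mu> (h k))" by simp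
    show "\<forall>\<^sub>F k in sequentially. Lp_norm \<mu> 1 (grad \<mu> (h k)) \<le> ennreal (E * (\<Sum>i. \<bar>c (i + Suc k)\<bar>))"
      by (rule always_eventually) (intro allI h_norm)
  qed
  \<comment> \<open>The factor \<open>Cd\<^sup>2\<close> taken out of the atoms moves into the
    coefficients and from there into the seminorm bound.\<close>
  define c' where "c' = (\<lambda>i. Cd\<^sup>2 * c i)"
  have dec: "atomic_decomp \<mu> t f c' (\<lambda>i x. a i x / Cd\<^sup>2)"
    unfolding atomic_decomp_def
  proof (intro conjI allI)
    show "summable (\<lambda>i. \<bar>c' i\<bar>)" using summable_mult[OF c_summable, of "Cd\<^sup>2"] by (simp add: c'_def abs_mult)
    show "HS_atom \<mu> t (\<lambda>x. a i x / Cd\<^sup>2)" for i by (rule HS_atom_of_unit_atom[OF a t])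
    have "c' i * (a i x / Cd\<^sup>2) = c i * a i x" for i x using C by (simp add: c'_def)
    then show "(\<lambda>k. Lp_norm \<mu> 1 (grad \<mu> (\<lambda>x. f x - (\<Sum>i\<le>k. c' i * (a i x / Cd\<^sup>2))))) \<longlonglongrightarrow> 0"
      using lim by (simp add: h_def)
  qed
  then show "f \<in> HSato_space \<mu> t" by (auto simp: HSato_space_def)
  have "HSato_seminorm \<mu> t f \<le> ennreal (\<Sum>i. \<bar>c' i\<bar>)"
    unfolding HSato_seminorm_def
    by (rule INF_lower2[of "(c', \<lambda>i x. a i x / Cd\<^sup>2)"]) (use dec in auto)
  also have "(\<Sum>i. \<bar>c' i\<bar>) = Cd\<^sup>2 * (\<Sum>i. \<bar>c i\<bar>)"
    by (simp add: c'_def abs_mult suminf_mult[OF c_summable])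
  also have "\<dots> \<le> Cd\<^sup>2 * K" using c(2) C by (simp add: c_suminf)
  finally show "HSato_seminorm \<mu> t f \<le> ennreal (Cd\<^sup>2 * K)" by (simp add: ennreal_leI)
qed

lemma M_embeds_HSato:
  assumes t: "1 < t"
  shows "embeds (M_space \<mu>) (M_seminorm \<mu>) (HSato_space \<mu> t) (HSato_seminorm \<mu> t)"
proof -
  let ?C = "6912 * Cd ^ 8"
  have key: "f \<in> HSato_space \<mu> t \<and> HSato_seminorm \<mu> t f \<le> ennreal ?C * Lp_norm \<mu> 1 g"
    if g: "g \<in> hajlasz_gradients \<mu> f" for f g
  proof -
    have g0: "0 \<le> g x" and haj: "\<bar>f x - f y\<bar> \<le> d x y * (g x + g y)" for x y
      using g by (auto simp: hajlasz_gradients_def)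
    have "Lp_norm \<mu> 1 g < \<infinity>" using g by (simp add: hajlasz_gradients_def)
    then obtain G where G: "0 \<le> G" "Lp_norm \<mu> 1 g = ennreal G"
      by (cases "Lp_norm \<mu> 1 g") auto
    then have "atomic_le f (6912 * Cd ^ 6 * G)"
      using g0 by (intro hajlasz_atomic_le[OF g0 haj]) (simp_all add: Lp_norm_1)
    from HSato_of_atomic_le[OF this t]
    have "f \<in> HSato_space \<mu> t" "HSato_seminorm \<mu> t f \<le> ennreal (Cd\<^sup>2 * (6912 * Cd ^ 6 * G))" .
    moreover have "Cd\<^sup>2 * (6912 * Cd ^ 6 * G) = ?C * G"
      by (simp add: power_add[symmetric] mult_ac flip: mult.assoc)
    ultimately show ?thesis using G by (simp add: ennreal_mult)
  qed
  show ?thesis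
  proof (rule embedsI)
    show "M_space \<mu> \<subseteq> HSato_space \<mu> t" using key by (auto simp: M_space_def)
    show C: "0 < ?C" using Cd_ge_1 by simp
    fix f assume f: "f \<in> M_space \<mu>"
    show "HSato_seminorm \<mu> t f \<le> ennreal ?C * M_seminorm \<mu> f"
      unfolding M_seminorm_def using key by (intro ennreal_le_mult_INF C) blast
  qed
qed

end

section \<open>The maximal function of an atom\<close>

context weighted_graph
begin

text \<open>Greedy selection: a pair of largest radius is kept, every ball meeting it is swallowed
  by its threefold dilate, and induction handles the rest. Pairs are selected rather than sets
  because one set may be a ball for several centres and radii.\<close>

lemma vitali_finite_balls:
  assumes "finite P" "\<forall>p\<in>P. 0 < snd p"
  shows "\<exists>Q\<subseteq>P. (\<forall>p\<in>Q. \<forall>q\<in>Q. p \<noteq> q \<longrightarrow> B (fst p) (snd p) \<inter> B (fst q) (snd q) = {}) \<and>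
    (\<forall>p\<in>P. \<exists>q\<in>Q. B (fst p) (snd p) \<subseteq> B (fst q) (3 * snd q))"
  using assms
proof (induction "card P" arbitrary: P rule: less_induct)
  case less
  show ?case
  proof (cases "P = {}")
    case False
    have "Max (snd ` P) \<in> snd ` P" using less.prems(1) False by (intro Max_in) auto
    then obtain p where p1: "p \<in> P" "snd p = Max (snd ` P)" by force
    have p: "p \<in> P" "\<And>q. q \<in> P \<Longrightarrow> snd q \<le> snd p"
      using p1 less.prems(1) by auto
    define P' where "P' = {q\<in>P. B (fst q) (snd q) \<inter> B (fst p) (snd p) = {}}"
    have p0: "0 < snd p" using p(1) less.prems(2) by simp
    then have "fst p \<in> B (fst p) (snd p)" by simp
    then have "p \<notin> P'" unfolding P'_def by blast
    then have "P' \<subset> P" using p(1) by (auto simp: P'_def)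
    then have "card P' < card P" using less.prems(1) by (rule psubset_card_mono[rotated])
    moreover have "finite P'" "\<forall>q\<in>P'. 0 < snd q" using less.prems by (auto simp: P'_def)
    ultimately obtain Q where Q: "Q \<subseteq> P'"
      "\<forall>p\<in>Q. \<forall>q\<in>Q. p \<noteq> q \<longrightarrow> B (fst p) (snd p) \<inter> B (fst q) (snd q) = {}"
      "\<forall>p\<in>P'. \<exists>q\<in>Q. B (fst p) (snd p) \<subseteq> B (fst q) (3 * snd q)"
      by (drule_tac less.hyps) (assumption, assumption, elim exE conjE, rule that)
    show ?thesis
    proof (intro exI[of _ "insert p Q"] conjI)
      show "insert p Q \<subseteq> P" using p(1) Q(1) by (auto simp: P'_def)
      show "\<forall>q\<in>insert p Q. \<forall>q'\<in>insert p Q. q \<noteq> q' \<longrightarrow> B (fst q) (snd q) \<inter> B (fst q') (snd q') = {}"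
        using Q(1,2) unfolding P'_def by blast
      show "\<forall>q\<in>P. \<exists>q'\<in>insert p Q. B (fst q) (snd q) \<subseteq> B (fst q') (3 * snd q')"
      proof
        fix q assume q: "q \<in> P"
        show "\<exists>q'\<in>insert p Q. B (fst q) (snd q) \<subseteq> B (fst q') (3 * snd q')"
        proof (cases "q \<in> P'")
          case False
          then obtain v where v: "d (fst q) v \<le> snd q" "d (fst p) v \<le> snd p"
            using q by (auto simp: P'_def mem_gball)
          have "d (fst p) (fst q) + snd q \<le> 3 * snd p"
            using v p(2)[OF q] d_triangle[of "fst p" "fst q" v] d_sym[of v "fst q"] by linarith
          then show ?thesis using gball_subset by blast
        qed (use Q(3) in blast)
      qed
    qed
  qed auto
qed

lemma vol_UN_le:
  assumes "finite Q" "\<And>q. finite (C q)"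
  shows "vol \<mu> (\<Union>q\<in>Q. C q) \<le> (\<Sum>q\<in>Q. vol \<mu> (C q))"
  using assms(1)
proof induction
  case empty
  show ?case by (simp add: vol_def)
next
  case (insert p Q)
  have "vol \<mu> (C p \<union> (\<Union>q\<in>Q. C q)) + vol \<mu> (C p \<inter> (\<Union>q\<in>Q. C q)) = vol \<mu> (C p) + vol \<mu> (\<Union>q\<in>Q. C q)"
    unfolding vol_def using insert.hyps assms(2) by (intro sum.union_inter) auto
  then have "vol \<mu> (C p \<union> (\<Union>q\<in>Q. C q)) \<le> vol \<mu> (C p) + vol \<mu> (\<Union>q\<in>Q. C q)"
    using vol_nonneg[of "C p \<inter> (\<Union>q\<in>Q. C q)"] by linarith
  with insert show ?case by simp
qed

text \<open>The uncentred Hardy-Littlewood maximal function: like \<open>Nmax\<close> it ranges over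
  all balls containing \<open>x\<close>, so the two compare ball by ball.\<close>

definition hl_max :: "('v \<Rightarrow> real) \<Rightarrow> 'v \<Rightarrow> ennreal" where
  "hl_max h x = (SUP (w, \<rho>) \<in> {(w, \<rho>). 0 < \<rho> \<and> x \<in> B w \<rho>}.
    ennreal (1 / V w \<rho> * (\<Sum>y\<in>B w \<rho>. h y * m y)))"

lemma osc_add_le:
  assumes r: "0 < r"
  shows "osc (\<lambda>x. f x + g x) z r \<le> osc f z r + osc g z r"
proof -
  have "avg \<mu> (B z r) (\<lambda>x. f x + g x) = avg \<mu> (B z r) f + avg \<mu> (B z r) g"
    by (simp add: avg_def sum.distrib distrib_right distrib_left add_divide_distrib)
  then show ?thesis
    unfolding osc_def sum.distrib[symmetric]
    by (intro sum_mono) (simp add: distrib_right[symmetric] mult_right_mono)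
qed

lemma osc_cmult: "osc (\<lambda>x. c * f x) z r = \<bar>c\<bar> * osc f z r"
proof -
  have "avg \<mu> (B z r) (\<lambda>x. c * f x) = c * avg \<mu> (B z r) f"
    by (simp add: avg_def sum_distrib_left mult_ac)
  then have "osc (\<lambda>x. c * f x) z r = (\<Sum>y\<in>B z r. \<bar>c\<bar> * (\<bar>f y - avg \<mu> (B z r) f\<bar> * m y))"
    unfolding osc_def
    by (intro sum.cong refl) (simp add: right_diff_distrib[symmetric] abs_mult)
  then show ?thesis by (simp add: osc_def sum_distrib_left)
qed

lemma osc_zero: "0 < r \<Longrightarrow> (\<And>x. x \<in> B z r \<Longrightarrow> f x = 0) \<Longrightarrow> osc f z r = 0"
  by (simp add: osc_def avg_def)

lemma osc_sum_le:
  assumes r: "0 < r"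
  shows "osc (\<lambda>x. \<Sum>i\<le>k. c i * a i x) z r \<le> (\<Sum>i\<le>(k::nat). \<bar>c i\<bar> * osc (a i) z r)"
proof (induction k)
  case 0
  then show ?case by (simp add: osc_cmult)
next
  case (Suc k)
  have "osc (\<lambda>x. (\<Sum>i\<le>k. c i * a i x) + c (Suc k) * a (Suc k) x) z r
      \<le> osc (\<lambda>x. \<Sum>i\<le>k. c i * a i x) z r + osc (\<lambda>x. c (Suc k) * a (Suc k) x) z r"
    by (rule osc_add_le[OF r])
  with Suc show ?case by (simp add: osc_cmult)
qed

lemma osc_le_twice_norm:
  assumes r: "0 < r"
  shows "osc f z r \<le> 2 * (\<Sum>x\<in>B z r. \<bar>f x\<bar> * m x)"
proof -
  let ?c = "avg \<mu> (B z r) f"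
  have "osc f z r \<le> (\<Sum>x\<in>B z r. \<bar>f x\<bar> * m x + \<bar>?c\<bar> * m x)"
    unfolding osc_def by (intro sum_mono) (simp add: distrib_right[symmetric] mult_right_mono)
  also have "\<dots> = (\<Sum>x\<in>B z r. \<bar>f x\<bar> * m x) + \<bar>?c * V z r\<bar>"
    by (simp add: sum.distrib sum_distrib_left[symmetric] vol_def[symmetric] abs_mult)
  also have "\<bar>?c * V z r\<bar> \<le> (\<Sum>x\<in>B z r. \<bar>f x * m x\<bar>)"
    unfolding avg_mult_V[OF r] by (rule sum_abs)
  finally show ?thesis by (simp add: abs_mult)
qed

end

section \<open>Weak type and local integrability of the maximal function\<close>

context doubling_graph
begin

text \<open>Vitali's covering argument, with \<open>Cd\<^sup>2\<close> paying for the threefold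
  dilation. Finite \<open>A\<close> and finitely supported \<open>h\<close> keep the families of
  balls finite, and suffice because atoms live on finite balls.\<close>

lemma weak_type_1_1:
  assumes h: "\<And>x. 0 \<le> h x" "finite S" "\<And>x. x \<notin> S \<Longrightarrow> h x = 0" and l: "0 < l" and A: "finite A"
    and avg: "\<And>x. x \<in> A \<Longrightarrow> \<exists>w \<rho>. 0 < \<rho> \<and> x \<in> B w \<rho> \<and> l * V w \<rho> < (\<Sum>y\<in>B w \<rho>. h y * m y)"
  shows "l * vol \<mu> A \<le> Cd\<^sup>2 * (\<Sum>x\<in>S. h x * m x)"
proof -
  have "\<forall>x\<in>A. \<exists>p. 0 < snd p \<and> x \<in> B (fst p) (snd p) \<and>
      l * V (fst p) (snd p) < (\<Sum>y\<in>B (fst p) (snd p). h y * m y)"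
    using avg by simp
  from bchoice[OF this] obtain b where b: "\<And>x. x \<in> A \<Longrightarrow> 0 < snd (b x) \<and> x \<in> B (fst (b x)) (snd (b x)) \<and>
      l * V (fst (b x)) (snd (b x)) < (\<Sum>y\<in>B (fst (b x)) (snd (b x)). h y * m y)"
    by blast
  have fP: "finite (b ` A)" using A by simp
  have pos: "\<forall>p\<in>b ` A. 0 < snd p" using b by simp
  note vitali_finite_balls[OF fP pos]
  then obtain Q where Q: "Q \<subseteq> b ` A"
    "\<forall>p\<in>Q. \<forall>q\<in>Q. p \<noteq> q \<longrightarrow> B (fst p) (snd p) \<inter> B (fst q) (snd q) = {}"
    "\<forall>p\<in>b ` A. \<exists>q\<in>Q. B (fst p) (snd p) \<subseteq> B (fst q) (3 * snd q)"
    by (auto 0 0 simp only:)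
  have fQ: "finite Q" using Q(1) fP by (rule finite_subset)
  have cover: "A \<subseteq> (\<Union>q\<in>Q. B (fst q) (3 * snd q))"
  proof
    fix x assume x: "x \<in> A"
    then obtain q where "q \<in> Q" "B (fst (b x)) (snd (b x)) \<subseteq> B (fst q) (3 * snd q)"
      using Q(3) by blast
    with b[OF x] show "x \<in> (\<Union>q\<in>Q. B (fst q) (3 * snd q))" by blast
  qed
  have "vol \<mu> A \<le> vol \<mu> (\<Union>q\<in>Q. B (fst q) (3 * snd q))" by (intro vol_mono cover) (simp add: fQ)
  also have "\<dots> \<le> (\<Sum>q\<in>Q. V (fst q) (3 * snd q))"
    by (rule vol_UN_le) (use fQ in auto)
  also have "\<dots> \<le> (\<Sum>q\<in>Q. Cd\<^sup>2 * V (fst q) (snd q))"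
  proof (rule sum_mono)
    fix q assume "q \<in> Q"
    then have "0 < snd q" using Q(1) pos by auto
    then show "V (fst q) (3 * snd q) \<le> Cd\<^sup>2 * V (fst q) (snd q)" by (intro vol_le_dilate) auto
  qed
  finally have "l * vol \<mu> A \<le> l * (\<Sum>q\<in>Q. Cd\<^sup>2 * V (fst q) (snd q))"
    using l by (intro mult_left_mono) auto
  also have "\<dots> = Cd\<^sup>2 * (\<Sum>q\<in>Q. l * V (fst q) (snd q))" by (simp add: sum_distrib_left mult_ac)
  also have "\<dots> \<le> Cd\<^sup>2 * (\<Sum>q\<in>Q. \<Sum>y\<in>B (fst q) (snd q). h y * m y)"
  proof (intro mult_left_mono sum_mono)
    fix q assume "q \<in> Q"
    then obtain x where "x \<in> A" "q = b x" using Q(1) by blast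
    then show "l * V (fst q) (snd q) \<le> (\<Sum>y\<in>B (fst q) (snd q). h y * m y)"
      using b by (simp add: less_imp_le)
  qed simp
  also have "(\<Sum>q\<in>Q. \<Sum>y\<in>B (fst q) (snd q). h y * m y) = (\<Sum>y\<in>(\<Union>q\<in>Q. B (fst q) (snd q)). h y * m y)"
    by (rule sum.UNION_disjoint[symmetric]) (use fQ Q(2) in auto)
  also have "\<dots> = (\<Sum>y\<in>(\<Union>q\<in>Q. B (fst q) (snd q)) \<inter> S. h y * m y)"
    by (rule sum.mono_neutral_right) (use fQ h in auto)
  also have "\<dots> \<le> (\<Sum>y\<in>S. h y * m y)" using h by (intro sum_mono2) auto
  finally show ?thesis by (simp add: mult_left_mono)
qed

text \<open>Truncation at height \<open>l\<close>: values up to \<open>l\<close> add at most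
  \<open>l\<close> to any average, so an average above \<open>2 * l\<close> forces the truncated
  part to average above \<open>l\<close>. On that part
  \<open>h \<le> l powr (1 - s) * h powr s\<close>, which improves the decay in \<open>l\<close>
  from order 1 to order \<open>s\<close>.\<close>

lemma hl_max_level:
  assumes h: "\<And>x. 0 \<le> h x" "finite S" "\<And>x. x \<notin> S \<Longrightarrow> h x = 0" and l: "0 < l" and s: "1 < s"
    and A: "finite A" and big: "\<And>x. x \<in> A \<Longrightarrow> ennreal (2 * l) < hl_max h x"
  shows "vol \<mu> A \<le> Cd\<^sup>2 * l powr - s * (\<Sum>x\<in>S. h x powr s * m x)"
proof -
  define g where "g = (\<lambda>x. if l < h x then h x else 0)"
  have hg: "h y \<le> g y + l" for y using l by (simp add: g_def)
  have "l * vol \<mu> A \<le> Cd\<^sup>2 * (\<Sum>x\<in>S. g x * m x)"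
  proof (rule weak_type_1_1[OF _ h(2) _ l A])
    fix x assume "x \<in> A"
    from big[OF this] obtain w \<rho> where w: "0 < \<rho>" "x \<in> B w \<rho>"
      "ennreal (2 * l) < ennreal (1 / V w \<rho> * (\<Sum>y\<in>B w \<rho>. h y * m y))"
      unfolding hl_max_def less_SUP_iff by auto
    have V: "0 < V w \<rho>" using w by simp
    have "2 * l < 1 / V w \<rho> * (\<Sum>y\<in>B w \<rho>. h y * m y)"
      using w(3) l by (simp only: ennreal_less_iff)
    then have "2 * l * V w \<rho> < (\<Sum>y\<in>B w \<rho>. h y * m y)" using V by (simp add: field_simps)
    also have "\<dots> \<le> (\<Sum>y\<in>B w \<rho>. (g y + l) * m y)" by (intro sum_mono mult_right_mono hg) simp
    also have "\<dots> = (\<Sum>y\<in>B w \<rho>. g y * m y) + l * V w \<rho>"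
      by (simp add: distrib_right sum.distrib sum_distrib_left vol_def)
    finally show "\<exists>w \<rho>. 0 < \<rho> \<and> x \<in> B w \<rho> \<and> l * V w \<rho> < (\<Sum>y\<in>B w \<rho>. g y * m y)"
      using w by (intro exI[of _ w] exI[of _ \<rho>]) auto
  qed (use h in \<open>auto simp: g_def\<close>)
  also have "(\<Sum>x\<in>S. g x * m x) \<le> (\<Sum>x\<in>S. l powr (1 - s) * (h x powr s * m x))"
  proof (rule sum_mono)
    fix x
    have "g x \<le> l powr (1 - s) * h x powr s"
    proof (cases "l < h x")
      case True
      then have hx: "0 < h x" using l by linarith
      have "h x = h x powr (1 - s) * h x powr s" using hx by (simp flip: powr_add)
      also have "\<dots> \<le> l powr (1 - s) * h x powr s"
        using True l s by (intro mult_right_mono powr_mono2') auto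
      finally show ?thesis using True by (simp add: g_def)
    qed (simp add: g_def)
    from mult_right_mono[OF this m_nonneg]
    show "g x * m x \<le> l powr (1 - s) * (h x powr s * m x)"
      by (simp add: mult.assoc)
  qed
  finally have "l * vol \<mu> A \<le> Cd\<^sup>2 * (l powr (1 - s) * (\<Sum>x\<in>S. h x powr s * m x))"
    by (simp add: sum_distrib_left mult_left_mono)
  also have "l powr (1 - s) = l * l powr - s" using l by (simp add: powr_diff powr_minus_divide)
  finally have "l * vol \<mu> A \<le> l * (Cd\<^sup>2 * l powr - s * (\<Sum>x\<in>S. h x powr s * m x))" by (simp add: mult_ac)
  then show ?thesis using l by (simp only: mult_le_cancel_left_pos)
qed

text \<open>One term of the series is enough: the level just below a finite \<open>c < v\<close>,
  where \<open>2 * (2 ^ k * l) < c \<le> 4 * (2 ^ k * l)\<close>. Approximation by such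
  \<open>c\<close> takes care of an infinite \<open>v\<close>.\<close>

lemma ennreal_dyadic_le:
  fixes v :: ennreal
  assumes l: "0 < l"
  shows "v \<le> ennreal (2 * l) + (\<Sum>k. ennreal (2 ^ k * (4 * l)) * (if ennreal (2 * (2 ^ k * l)) < v then 1 else 0))"
    (is "v \<le> _ + (\<Sum>k. ?g k)")
proof (rule dense_le)
  fix c assume c: "c < v"
  then obtain c' where c': "0 \<le> c'" "c = ennreal c'" by (cases c) auto
  show "c \<le> ennreal (2 * l) + (\<Sum>k. ?g k)"
  proof (cases "c' \<le> 2 * l")
    case True
    then show ?thesis using c' by (intro add_increasing2) (auto intro: ennreal_leI)
  next
    case False
    obtain n0 :: nat where n0: "c' / (2 * l) < 2 ^ n0" using real_arch_pow[of 2] by auto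
    define n where "n = (LEAST n. c' \<le> 2 * (2 ^ n * l))"
    have n: "c' \<le> 2 * (2 ^ n * l)"
      unfolding n_def by (rule LeastI[of _ n0]) (use n0 l in \<open>simp add: field_simps\<close>)
    have "n \<noteq> 0" using n False by (cases n) auto
    then obtain k where k: "n = Suc k" using not0_implies_Suc by blast
    have "\<not> c' \<le> 2 * (2 ^ k * l)"
      using not_less_Least[of k "\<lambda>n. c' \<le> 2 * (2 ^ n * l)"] k by (simp add: n_def)
    then have "ennreal (2 * (2 ^ k * l)) < c" using c' l by (simp add: ennreal_less_iff)
    then have "ennreal (2 * (2 ^ k * l)) < v" using c by (rule less_trans)
    then have "c \<le> ?g k" using n k c' by (simp add: ennreal_leI mult_ac)
    also have "\<dots> \<le> (\<Sum>k. ?g k)" using sum_le_suminf[of ?g "{k}"] by simp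
    finally show ?thesis by (simp add: add_increasing)
  qed
qed

text \<open>The part below \<open>2 * l\<close> is bounded trivially on \<open>A\<close>; above it
  the dyadic levels give a geometric series of ratio \<open>2 powr (1 - s)\<close>, convergent since
  \<open>1 < s\<close>. The height \<open>l\<close> is left free: for an atom the choice
  \<open>1 / V z r\<close> balances the two terms.\<close>

lemma hl_max_local_integral:
  assumes h: "\<And>x. 0 \<le> h x" "finite S" "\<And>x. x \<notin> S \<Longrightarrow> h x = 0" and l: "0 < l" and s: "1 < s"
    and A: "finite A"
  shows "(\<integral>\<^sup>+x. hl_max h x * indicator A x \<partial>vmeasure \<mu>)
    \<le> ennreal (2 * l * vol \<mu> A + 4 * Cd\<^sup>2 / (1 - 2 powr (1 - s)) * l powr (1 - s) * (\<Sum>x\<in>S. h x powr s * m x))"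
proof -
  let ?H = "\<Sum>x\<in>S. h x powr s * m x" and ?q = "2 powr (1 - s)"
  let ?lev = "\<lambda>k. {x\<in>A. ennreal (2 * (2 ^ k * l)) < hl_max h x}"
  have H: "0 \<le> ?H" by (intro sum_nonneg) auto
  have q: "0 < ?q" "?q < 1" using s powr_less_mono[of "1 - s" 0 2] by auto
  have lev: "ennreal (2 ^ k * (4 * l)) * emeasure (vmeasure \<mu>) (?lev k)
      \<le> ennreal (4 * Cd\<^sup>2 * l powr (1 - s) * ?H * ?q ^ k)" for k :: nat
  proof -
    have pos: "0 < 2 ^ k * l" using l by simp
    have "vol \<mu> (?lev k) \<le> Cd\<^sup>2 * (2 ^ k * l) powr - s * ?H"
      by (rule hl_max_level[OF h pos s]) (use A in auto)
    then have "2 ^ k * (4 * l) * vol \<mu> (?lev k) \<le> 2 ^ k * (4 * l) * (Cd\<^sup>2 * (2 ^ k * l) powr - s * ?H)"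
      using l by (intro mult_left_mono) auto
    also have "\<dots> = 4 * Cd\<^sup>2 * ((2 ^ k * l) * (2 ^ k * l) powr - s) * ?H" by simp
    also have "(2 ^ k * l) * (2 ^ k * l) powr - s = (2 ^ k * l) powr (1 - s)"
      using pos by (simp add: powr_diff powr_minus_divide)
    also have "\<dots> = ?q ^ k * l powr (1 - s)"
      using l by (simp add: powr_mult powr_realpow[symmetric] powr_powr mult.commute)
    finally have "2 ^ k * (4 * l) * vol \<mu> (?lev k) \<le> 4 * Cd\<^sup>2 * l powr (1 - s) * ?H * ?q ^ k"
      by (simp add: mult_ac)
    moreover have "ennreal (2 ^ k * (4 * l)) * emeasure (vmeasure \<mu>) (?lev k)
        = ennreal (2 ^ k * (4 * l) * vol \<mu> (?lev k))"
      using A l by (simp add: emeasure_vmeasure_finite ennreal_mult)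
    ultimately show ?thesis by (simp add: ennreal_leI)
  qed
  have "(\<integral>\<^sup>+x. hl_max h x * indicator A x \<partial>vmeasure \<mu>)
     \<le> (\<integral>\<^sup>+x. ennreal (2 * l) * indicator A x + (\<Sum>k. ennreal (2 ^ k * (4 * l)) * indicator (?lev k) x) \<partial>vmeasure \<mu>)"
  proof (rule nn_integral_mono)
    fix x
    show "hl_max h x * indicator A x \<le> ennreal (2 * l) * indicator A x + (\<Sum>k. ennreal (2 ^ k * (4 * l)) * indicator (?lev k) x)"
      using ennreal_dyadic_le[OF l, of "hl_max h x"] by (cases "x \<in> A") (auto simp: indicator_def of_bool_def)
  qed
  also have "\<dots> = ennreal (2 * l) * emeasure (vmeasure \<mu>) A + (\<Sum>k. ennreal (2 ^ k * (4 * l)) * emeasure (vmeasure \<mu>) (?lev k))"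
    by (simp add: nn_integral_add nn_integral_suminf nn_integral_cmult_indicator borel_measurable_vmeasure)
  also have "\<dots> \<le> ennreal (2 * l) * ennreal (vol \<mu> A) + (\<Sum>k. ennreal (4 * Cd\<^sup>2 * l powr (1 - s) * ?H * ?q ^ k))"
    by (intro add_mono suminf_le lev) (auto simp: emeasure_vmeasure_finite A)
  also have "(\<Sum>k. ennreal (4 * Cd\<^sup>2 * l powr (1 - s) * ?H * ?q ^ k)) = ennreal (\<Sum>k. 4 * Cd\<^sup>2 * l powr (1 - s) * ?H * ?q ^ k)"
    by (intro suminf_ennreal2 summable_mult summable_geometric) (use H q in auto)
  also have "(\<Sum>k. 4 * Cd\<^sup>2 * l powr (1 - s) * ?H * ?q ^ k) = 4 * Cd\<^sup>2 * l powr (1 - s) * ?H * (1 / (1 - ?q))"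
    by (subst suminf_mult) (use q in \<open>auto simp: suminf_geometric\<close>)
  also have "ennreal (2 * l) * ennreal (vol \<mu> A) + ennreal (4 * Cd\<^sup>2 * l powr (1 - s) * ?H * (1 / (1 - ?q)))
     = ennreal (2 * l * vol \<mu> A + 4 * Cd\<^sup>2 / (1 - ?q) * l powr (1 - s) * ?H)"
    using l H q by (subst ennreal_plus) (auto simp: ennreal_mult mult_ac)
  finally show ?thesis .
qed

end

context poincare_graph
begin

lemma Nmax_le_hl_max: "Nmax \<mu> f x \<le> ennreal Cp * hl_max (grad \<mu> f) x"
proof (rule Nmax_le)
  fix z r assume r: "0 < r" and x: "x \<in> B z r"
  have "1 / (r * V z r) * osc f z r \<le> 1 / (r * V z r) * (Cp * r * (\<Sum>y\<in>B z r. grad \<mu> f y * m y))"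
    using r by (intro mult_left_mono poincare) auto
  also have "\<dots> = Cp * (1 / V z r * (\<Sum>y\<in>B z r. grad \<mu> f y * m y))" using r by simp
  finally have "ennreal (1 / (r * V z r) * osc f z r) \<le> ennreal (Cp * (1 / V z r * (\<Sum>y\<in>B z r. grad \<mu> f y * m y)))"
    by (rule ennreal_leI)
  also have "\<dots> = ennreal Cp * ennreal (1 / V z r * (\<Sum>y\<in>B z r. grad \<mu> f y * m y))"
    using Cp_pos by (intro ennreal_mult) (auto intro!: divide_nonneg_nonneg sum_nonneg)
  also have "\<dots> \<le> ennreal Cp * hl_max (grad \<mu> f) x"
    unfolding hl_max_def by (intro mult_left_mono SUP_upper2[of "(z, r)"]) (use r x in auto)
  finally show "ennreal (1 / (r * V z r) * osc f z r) \<le> ennreal Cp * hl_max (grad \<mu> f) x" .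
qed

end

context doubling_graph
begin

text \<open>Reduces every exponent to a finite power \<open>s\<close>, chosen before the atom so
  that later constants depend on \<open>t\<close> alone: \<open>s = t\<close> for finite
  \<open>t\<close>, and \<open>s = 2\<close> for \<open>t = \<infinity>\<close>. In the latter case
  a sup bound is integrated over \<open>B z (r + 1)\<close>, whence
  \<open>Cd\<^sup>2\<close>.\<close>

lemma HS_atom_gradient_power:
  assumes t: "1 < t"
  shows "\<exists>s>1. \<forall>a. HS_atom \<mu> t a \<longrightarrow> (\<exists>z r. 0 < r \<and> (\<forall>x. x \<notin> B z r \<longrightarrow> a x = 0) \<and>
    (\<Sum>x\<in>B z r. a x * m x) = 0 \<and>
    (\<Sum>x\<in>B z (r + 1). grad \<mu> a x powr s * m x) \<le> Cd\<^sup>2 * V z r powr (1 - s))"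
proof (cases "t = \<infinity>")
  case True
  show ?thesis
  proof (intro exI[of _ 2] conjI allI impI)
    fix a assume "HS_atom \<mu> t a"
    then obtain z r where r: "0 < r" and a: "\<forall>x. x \<notin> B z r \<longrightarrow> a x = 0" "(\<Sum>x\<in>B z r. a x * m x) = 0"
      and L: "Lp_norm \<mu> t (grad \<mu> a) \<le> ennreal (V z r powr - (1 - enn2real (1 / t)))"
      unfolding HS_atom_def by blast
    have V: "0 < V z r" using r by simp
    have "(SUP x. ennreal \<bar>grad \<mu> a x\<bar>) \<le> ennreal (1 / V z r)"
      using L True V by (simp add: Lp_norm_def powr_minus_divide)
    then have "ennreal \<bar>grad \<mu> a x\<bar> \<le> ennreal (1 / V z r)" for x by (meson SUP_upper UNIV_I order_trans)
    then have g: "grad \<mu> a x \<le> 1 / V z r" for x using V by (simp add: ennreal_le_iff)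
    have "(\<Sum>x\<in>B z (r + 1). grad \<mu> a x powr 2 * m x) \<le> (\<Sum>x\<in>B z (r + 1). (1 / V z r) powr 2 * m x)"
      by (intro sum_mono mult_right_mono powr_mono2) (auto simp: g)
    also have "\<dots> = (1 / V z r) powr 2 * V z (r + 1)" by (simp add: vol_def sum_distrib_left)
    also have "\<dots> \<le> (1 / V z r) powr 2 * (Cd\<^sup>2 * V z r)" by (intro mult_left_mono V_add_1 r) auto
    also have "\<dots> = Cd\<^sup>2 * V z r powr (1 - 2)"
      using V by (simp add: powr_minus_divide power2_eq_square field_simps)
    finally show "\<exists>z r. 0 < r \<and> (\<forall>x. x \<notin> B z r \<longrightarrow> a x = 0) \<and> (\<Sum>x\<in>B z r. a x * m x) = 0 \<and>
        (\<Sum>x\<in>B z (r + 1). grad \<mu> a x powr 2 * m x) \<le> Cd\<^sup>2 * V z r powr (1 - 2)"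
      using r a by blast
  qed simp
next
  case False
  then obtain p where p: "t = ennreal p" "0 \<le> p" by (cases t) auto
  then have p1: "1 < p" using t by (simp add: ennreal_less_iff flip: ennreal_1)
  have inv: "enn2real (1 / t) = 1 / p"
    using p1 by (simp add: p divide_ennreal flip: ennreal_1)
  show ?thesis
  proof (intro exI[of _ p] conjI allI impI p1)
    fix a assume "HS_atom \<mu> t a"
    then obtain z r where r: "0 < r" and a: "\<forall>x. x \<notin> B z r \<longrightarrow> a x = 0" "(\<Sum>x\<in>B z r. a x * m x) = 0"
      and L: "Lp_norm \<mu> t (grad \<mu> a) \<le> ennreal (V z r powr - (1 - enn2real (1 / t)))"
      unfolding HS_atom_def by blast
    have V: "0 < V z r" using r by simp
    define I where "I = (\<integral>\<^sup>+x. ennreal (\<bar>grad \<mu> a x\<bar> powr p) \<partial>vmeasure \<mu>)"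
    have L': "(if I = \<infinity> then \<infinity> else ennreal (enn2real I powr (1 / p))) \<le> ennreal (V z r powr - (1 - 1 / p))"
    proof -
      have "enn2real t = p" using p by simp
      then have "Lp_norm \<mu> t (grad \<mu> a) = (if I = \<infinity> then \<infinity> else ennreal (enn2real I powr (1 / p)))"
        using False by (simp add: Lp_norm_def Let_def I_def)
      then show ?thesis using L unfolding inv by simp
    qed
    then have If: "I \<noteq> \<infinity>" by (auto simp: top_unique split: if_splits)
    with L' have "enn2real I powr (1 / p) \<le> V z r powr - (1 - 1 / p)" by simp
    then have "(enn2real I powr (1 / p)) powr p \<le> (V z r powr - (1 - 1 / p)) powr p"
      using p by (intro powr_mono2) auto
    moreover have "- (1 - 1 / p) * p = 1 - p" "1 / p * p = 1" using p1 by (auto simp: field_simps)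
    ultimately have I: "enn2real I \<le> V z r powr (1 - p)" by (simp only: powr_powr) simp
    have "ennreal (\<Sum>x\<in>B z (r + 1). grad \<mu> a x powr p * m x)
        = (\<integral>\<^sup>+x. ennreal (grad \<mu> a x powr p) * indicator (B z (r + 1)) x \<partial>vmeasure \<mu>)"
      by (intro nn_integral_vmeasure_finite[symmetric]) auto
    also have "\<dots> \<le> I"
      unfolding I_def by (intro nn_integral_mono) (auto simp: indicator_def)
    also have "\<dots> = ennreal (enn2real I)" using If by (simp add: top.not_eq_extremum)
    finally have "(\<Sum>x\<in>B z (r + 1). grad \<mu> a x powr p * m x) \<le> enn2real I"
      by (simp add: ennreal_le_iff)
    also have "\<dots> \<le> V z r powr (1 - p)" by (rule I)
    also have "\<dots> \<le> Cd\<^sup>2 * V z r powr (1 - p)"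
      using mult_right_mono[of 1 "Cd\<^sup>2" "V z r powr (1 - p)"] Cd_ge_1 by (simp add: one_le_power)
    finally show "\<exists>z r. 0 < r \<and> (\<forall>x. x \<notin> B z r \<longrightarrow> a x = 0) \<and> (\<Sum>x\<in>B z r. a x * m x) = 0 \<and>
        (\<Sum>x\<in>B z (r + 1). grad \<mu> a x powr p * m x) \<le> Cd\<^sup>2 * V z r powr (1 - p)"
      using r a by blast
  qed
qed

end

section \<open>Integrating the maximal function of an atom and of an atomic series\<close>

context poincare_graph
begin

text \<open>Near the support, \<open>Nmax\<close> is controlled by \<open>hl_max\<close> of the
  gradient, which the power bound makes locally integrable. Far away, a ball reaching both
  \<open>x\<close> and the support must be large, while the \<open>L1\<close> norm of
  \<open>a\<close> is of order \<open>r\<close>: mean zero turns that norm into an oscillation, to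
  which Poincare applies.\<close>

lemma Nmax_atom_integral:
  assumes s: "1 < s" and r: "0 < r" and supp: "\<And>x. x \<notin> B z r \<Longrightarrow> a x = 0"
    and mean: "(\<Sum>x\<in>B z r. a x * m x) = 0"
    and pow: "(\<Sum>x\<in>B z (r + 1). grad \<mu> a x powr s * m x) \<le> Cd\<^sup>2 * V z r powr (1 - s)"
  shows "(\<integral>\<^sup>+x. Nmax \<mu> a x \<partial>vmeasure \<mu>)
    \<le> ennreal (Cp * (2 * Cd\<^sup>2 + 4 * Cd ^ 4 / (1 - 2 powr (1 - s))) + 32 * Cp * (1 + Cd\<^sup>2) * Cd ^ 3)"
proof (cases "1 \<le> r")
  case False
  \<comment> \<open>A one-point ball leaves no room for a nonzero function of mean zero.\<close>
  then have Bz: "B z r = {z}" using r by (simp add: gball_small)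
  have "a z = 0" using mean by (simp add: Bz)
  then have "a x = 0" for x using supp[of x] Bz by (cases "x = z") auto
  then have "osc a w \<rho> = 0" if "0 < \<rho>" for w \<rho> using that by (simp add: osc_zero)
  then have "Nmax \<mu> a x = 0" for x
    using Nmax_le[of x a 0] by simp
  then show ?thesis by simp
next
  case True
  let ?h = "grad \<mu> a" and ?A = "B z (4 * r)"
  define l where "l = 1 / V z r"
  have V: "0 < V z r" using r by simp
  have l: "0 < l" using V by (simp add: l_def)
  have lpow: "l powr (1 - s) * V z r powr (1 - s) = 1"
    using V by (simp add: l_def powr_divide)
  define H where "H = (\<Sum>x\<in>B z (r + 1). ?h x powr s * m x)"
  have H: "l powr (1 - s) * H \<le> Cd\<^sup>2"
  proof -
    have "l powr (1 - s) * H \<le> l powr (1 - s) * (Cd\<^sup>2 * V z r powr (1 - s))"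
      unfolding H_def by (intro mult_left_mono pow) simp
    also have "\<dots> = Cd\<^sup>2 * (l powr (1 - s) * V z r powr (1 - s))" by simp
    finally show ?thesis by (simp add: lpow)
  qed
  have h0: "?h x = 0" if "x \<notin> B z (r + 1)" for x by (rule grad_support[OF supp that])
  have q: "2 powr (1 - s) < (1 :: real)" using s powr_less_mono[of "1 - s" 0 2] by auto
  have near: "(\<integral>\<^sup>+x. hl_max ?h x * indicator ?A x \<partial>vmeasure \<mu>)
      \<le> ennreal (2 * Cd\<^sup>2 + 4 * Cd ^ 4 / (1 - 2 powr (1 - s)))"
  proof (rule order_trans[OF hl_max_local_integral[OF _ _ h0 l s]])
    have "V z (4 * r) \<le> Cd\<^sup>2 * V z r" using r by (intro vol_le_dilate) auto
    then have "2 * l * V z (4 * r) \<le> 2 * l * (Cd\<^sup>2 * V z r)" using l by (intro mult_left_mono) auto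
    also have "\<dots> = 2 * Cd\<^sup>2" using V by (simp add: l_def)
    finally have "2 * l * V z (4 * r) \<le> 2 * Cd\<^sup>2" .
    moreover have "4 * Cd\<^sup>2 / (1 - 2 powr (1 - s)) * (l powr (1 - s) * H) \<le> 4 * Cd\<^sup>2 / (1 - 2 powr (1 - s)) * Cd\<^sup>2"
      using q by (intro mult_left_mono H) auto
    moreover have "4 * Cd\<^sup>2 / (1 - 2 powr (1 - s)) * Cd\<^sup>2 = 4 * Cd ^ 4 / (1 - 2 powr (1 - s))"
      by (simp add: power_add[symmetric])
    ultimately show "ennreal (2 * l * V z (4 * r) + 4 * Cd\<^sup>2 / (1 - 2 powr (1 - s)) * l powr (1 - s) *
        (\<Sum>x\<in>B z (r + 1). ?h x powr s * m x)) \<le> ennreal (2 * Cd\<^sup>2 + 4 * Cd ^ 4 / (1 - 2 powr (1 - s)))"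
      by (intro ennreal_leI) (simp add: H_def mult.assoc)
  qed auto
  have grad_norm: "(\<Sum>x\<in>B z r. ?h x * m x) \<le> 1 + Cd\<^sup>2"
  proof -
    have "(\<Sum>x\<in>B z r. ?h x * m x) \<le> (\<Sum>x\<in>B z r. l * m x + l powr (1 - s) * (?h x powr s * m x))"
    proof (rule sum_mono)
      fix x
      \<comment> \<open>Pointwise splitting at height \<open>l\<close> takes the place of Hoelder's
        inequality.\<close>
      have "?h x \<le> l + l powr (1 - s) * ?h x powr s"
      proof (cases "?h x \<le> l")
        case False
        then have hx: "0 < ?h x" using l by linarith
        have "?h x = ?h x powr (1 - s) * ?h x powr s" using hx by (simp flip: powr_add)
        also have "\<dots> \<le> l powr (1 - s) * ?h x powr s"
          using False l s by (intro mult_right_mono powr_mono2') auto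
        finally show ?thesis using l by linarith
      qed (simp add: add_increasing2)
      from mult_right_mono[OF this m_nonneg]
      show "?h x * m x \<le> l * m x + l powr (1 - s) * (?h x powr s * m x)" by (simp add: algebra_simps)
    qed
    also have "\<dots> = l * V z r + l powr (1 - s) * (\<Sum>x\<in>B z r. ?h x powr s * m x)"
      by (simp add: sum.distrib sum_distrib_left vol_def)
    also have "\<dots> \<le> l * V z r + l powr (1 - s) * H"
      unfolding H_def by (intro add_left_mono mult_left_mono sum_mono2 gball_mono) auto
    also have "\<dots> \<le> 1 + Cd\<^sup>2" using H V by (simp add: l_def)
    finally show ?thesis .
  qed
  define A1 where "A1 = (\<Sum>x\<in>B z r. \<bar>a x\<bar> * m x)"
  have A1: "A1 \<le> Cp * r * (1 + Cd\<^sup>2)"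
  proof -
    have "avg \<mu> (B z r) a = 0" using mean by (simp add: avg_def)
    then have "A1 = osc a z r" by (simp add: A1_def osc_def)
    also have "\<dots> \<le> Cp * r * (\<Sum>x\<in>B z r. ?h x * m x)" by (rule poincare[OF r])
    also have "\<dots> \<le> Cp * r * (1 + Cd\<^sup>2)" using Cp_pos r by (intro mult_left_mono grad_norm) auto
    finally show ?thesis .
  qed
  define C where "C = 16 * Cp * (1 + Cd\<^sup>2) * Cd ^ 3"
  have C: "0 \<le> C" using Cp_pos by (simp add: C_def)
  define R where "R = (\<lambda>k :: nat. 2 ^ k * r)"
  have R: "0 < R k" for k using r by (simp add: R_def)
  \<comment> \<open>Weights for a dominating sum over full dyadic balls: division by
    \<open>V z (R k)\<close> makes the term of index \<open>k\<close> integrate to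
    \<open>C * (1 / 2) ^ k\<close>.\<close>
  define w where "w = (\<lambda>k. C * (1 / 2) ^ k / V z (R k))"
  have w0: "0 \<le> w k" for k using C by (simp add: w_def)
  have far: "Nmax \<mu> a x \<le> (\<Sum>k. ennreal (w k) * indicator (B z (R k)) x)" if x: "x \<notin> ?A" for x
  proof (rule Nmax_le)
    fix v \<rho> assume \<rho>: "0 < \<rho>" and xv: "x \<in> B v \<rho>"
    show "ennreal (1 / (\<rho> * V v \<rho>) * osc a v \<rho>) \<le> (\<Sum>k. ennreal (w k) * indicator (B z (R k)) x)"
    proof (cases "B v \<rho> \<inter> B z r = {}")
      case True
      then have "osc a v \<rho> = 0" using \<rho> supp by (intro osc_zero) auto
      then show ?thesis by simp
    next
      case False
      then obtain y where y: "d v y \<le> \<rho>" "d z y \<le> r" by (auto simp: mem_gball)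
      have dx: "4 * r < d z x" using x by (simp add: mem_gball)
      have vx: "d v x \<le> \<rho>" using xv by (simp add: mem_gball)
      have zv: "d z v \<le> r + \<rho>" using y d_triangle[of z v y] d_sym[of y v] by linarith
      \<comment> \<open>Here \<open>d z x \<le> r + 2 * \<rho>\<close>, and
        \<open>4 * r < d z x\<close> absorbs the \<open>r\<close>, so the radius is at least a fixed
        multiple of the distance.\<close>
      then have \<rho>_ge: "3 * d z x \<le> 8 * \<rho>" using dx vx d_triangle[of z x v] by linarith
      define k where "k = (LEAST k. d z x \<le> R k)"
      have "\<exists>k. d z x \<le> R k"
      proof -
        obtain k where "d z x / r < 2 ^ k" using real_arch_pow[of 2] by auto
        then have "d z x \<le> R k" using r by (simp add: R_def field_simps)
        then show ?thesis by blast
      qed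
      then have k: "d z x \<le> R k" unfolding k_def by (rule LeastI_ex)
      have "k \<noteq> 0" using k dx r by (cases k) (auto simp: R_def)
      then obtain j where j: "k = Suc j" using not0_implies_Suc by blast
      have "\<not> d z x \<le> R j" using not_less_Least[of j "\<lambda>k. d z x \<le> R k"] j by (simp add: k_def)
      then have k2: "R k \<le> 2 * d z x" by (simp add: j R_def)
      have Vle: "V z (R k) \<le> Cd ^ 3 * V v \<rho>"
        using zv k2 \<rho>_ge dx vx d_triangle[of z x v] d_sym[of v z] \<rho>
        by (intro vol_le_dilate) auto
      have Rle: "R k \<le> 8 * \<rho>" using k2 \<rho>_ge dx r by linarith
      have "osc a v \<rho> \<le> 2 * (\<Sum>x\<in>B v \<rho>. \<bar>a x\<bar> * m x)" by (rule osc_le_twice_norm[OF \<rho>])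
      also have "(\<Sum>x\<in>B v \<rho>. \<bar>a x\<bar> * m x) = (\<Sum>x\<in>B v \<rho> \<inter> B z r. \<bar>a x\<bar> * m x)"
        by (rule sum.mono_neutral_right) (auto simp: supp)
      also have "\<dots> \<le> A1" unfolding A1_def by (intro sum_mono2) auto
      finally have "osc a v \<rho> \<le> 2 * (Cp * r * (1 + Cd\<^sup>2))" using A1 by linarith
      then have "1 / (\<rho> * V v \<rho>) * osc a v \<rho> \<le> 1 / (\<rho> * V v \<rho>) * (2 * (Cp * r * (1 + Cd\<^sup>2)))"
        using \<rho> by (intro mult_left_mono) auto
      also have "\<dots> \<le> 8 * Cd ^ 3 / (R k * V z (R k)) * (2 * (Cp * r * (1 + Cd\<^sup>2)))"
      proof (rule mult_right_mono)
        have "R k * V z (R k) \<le> (8 * \<rho>) * (Cd ^ 3 * V v \<rho>)"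
          using Rle Vle \<rho> R[of k] by (intro mult_mono) auto
        moreover have "0 < R k * V z (R k)" "0 < \<rho> * V v \<rho>" using R[of k] \<rho> by auto
        ultimately show "1 / (\<rho> * V v \<rho>) \<le> 8 * Cd ^ 3 / (R k * V z (R k))"
          by (simp add: field_simps)
        show "0 \<le> 2 * (Cp * r * (1 + Cd\<^sup>2))" using Cp_pos r by simp
      qed
      also have "\<dots> = w k"
      proof -
        have "r / R k = (1 / 2) ^ k" using r by (simp add: R_def power_one_over)
        then have "w k = C * (r / R k) / V z (R k)" by (simp add: w_def)
        then show ?thesis by (simp add: C_def)
      qed
      finally have "ennreal (1 / (\<rho> * V v \<rho>) * osc a v \<rho>) \<le> ennreal (w k) * indicator (B z (R k)) x"
        using k by (simp add: ennreal_leI mem_gball)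
      also have "\<dots> \<le> (\<Sum>k. ennreal (w k) * indicator (B z (R k)) x)"
      proof -
        have "g k \<le> (\<Sum>k. g k)" for g :: "nat \<Rightarrow> ennreal"
          using sum_le_suminf[of g "{k}"] by simp
        then show ?thesis .
      qed
      finally show ?thesis .
    qed
  qed
  have "(\<integral>\<^sup>+x. Nmax \<mu> a x \<partial>vmeasure \<mu>)
      \<le> (\<integral>\<^sup>+x. ennreal Cp * (hl_max ?h x * indicator ?A x) + (\<Sum>k. ennreal (w k) * indicator (B z (R k)) x) \<partial>vmeasure \<mu>)"
  proof (rule nn_integral_mono)
    fix x
    show "Nmax \<mu> a x \<le> ennreal Cp * (hl_max ?h x * indicator ?A x) + (\<Sum>k. ennreal (w k) * indicator (B z (R k)) x)"
    proof (cases "x \<in> ?A")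
      case True
      then show ?thesis using Nmax_le_hl_max[of a x] by (simp add: add_increasing2)
    qed (use far[of x] in simp)
  qed
  also have "\<dots> = ennreal Cp * (\<integral>\<^sup>+x. hl_max ?h x * indicator ?A x \<partial>vmeasure \<mu>)
      + (\<Sum>k. ennreal (w k) * emeasure (vmeasure \<mu>) (B z (R k)))"
    by (simp add: nn_integral_add nn_integral_cmult nn_integral_suminf nn_integral_cmult_indicator borel_measurable_vmeasure)
  also have "(\<Sum>k. ennreal (w k) * emeasure (vmeasure \<mu>) (B z (R k))) = (\<Sum>k. ennreal (C * (1 / 2) ^ k))"
  proof (rule suminf_cong)
    fix k
    have "0 < V z (R k)" using R by simp
    then have "w k * V z (R k) = C * (1 / 2) ^ k" by (simp add: w_def)
    then show "ennreal (w k) * emeasure (vmeasure \<mu>) (B z (R k)) = ennreal (C * (1 / 2) ^ k)"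
      using w0[of k] by (simp add: emeasure_vmeasure_finite ennreal_mult[symmetric])
  qed
  also have "\<dots> = ennreal (\<Sum>k. C * (1 / 2) ^ k)"
    using C by (intro suminf_ennreal2 summable_mult summable_geometric) auto
  also have "(\<Sum>k. C * (1 / 2) ^ k) = 2 * C"
    by (subst suminf_mult) (auto simp: suminf_geometric)
  also have "ennreal Cp * (\<integral>\<^sup>+x. hl_max ?h x * indicator ?A x \<partial>vmeasure \<mu>) + ennreal (2 * C)
      \<le> ennreal Cp * ennreal (2 * Cd\<^sup>2 + 4 * Cd ^ 4 / (1 - 2 powr (1 - s))) + ennreal (2 * C)"
    by (intro add_right_mono mult_left_mono near) simp
  also have "\<dots> = ennreal (Cp * (2 * Cd\<^sup>2 + 4 * Cd ^ 4 / (1 - 2 powr (1 - s))) + 2 * C)"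
    using Cp_pos C q by (subst ennreal_plus) (auto simp: ennreal_mult)
  finally show ?thesis by (simp add: C_def mult.assoc)
qed

text \<open>The decomposition converges only in gradient. On a fixed ball, Poincare bounds the
  oscillation of the remainder by a constant depending on the ball times an \<open>L1\<close> norm
  tending to 0, so the limit is taken before the supremum over balls.\<close>

lemma atomic_decomp_Nmax_le:
  assumes dec: "atomic_decomp \<mu> t f c a"
  shows "Nmax \<mu> f x \<le> (\<Sum>i. ennreal \<bar>c i\<bar> * Nmax \<mu> (a i) x)"
proof (rule Nmax_le)
  fix z r assume r: "0 < r" and x: "x \<in> B z r"
  let ?k = "1 / (r * V z r)" and ?S = "\<Sum>i. ennreal \<bar>c i\<bar> * Nmax \<mu> (a i) x"
  have k: "0 \<le> ?k" using r by simp
  define h where "h = (\<lambda>n x. f x - (\<Sum>i\<le>n. c i * a i x))"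
  have step: "ennreal (?k * osc f z r) \<le> ?S + ennreal (?k * (Cp * r)) * Lp_norm \<mu> 1 (grad \<mu> (h n))" for n
  proof -
    have "osc f z r = osc (\<lambda>x. (\<Sum>i\<le>n. c i * a i x) + h n x) z r" by (simp add: h_def)
    also have "\<dots> \<le> osc (\<lambda>x. \<Sum>i\<le>n. c i * a i x) z r + osc (h n) z r" by (rule osc_add_le[OF r])
    also have "\<dots> \<le> (\<Sum>i\<le>n. \<bar>c i\<bar> * osc (a i) z r) + Cp * r * (\<Sum>x\<in>B z r. grad \<mu> (h n) x * m x)"
      by (intro add_mono osc_sum_le poincare r)
    finally have "?k * osc f z r \<le> ?k * ((\<Sum>i\<le>n. \<bar>c i\<bar> * osc (a i) z r) + Cp * r * (\<Sum>x\<in>B z r. grad \<mu> (h n) x * m x))"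
      using k by (rule mult_left_mono)
    also have "\<dots> = (\<Sum>i\<le>n. \<bar>c i\<bar> * (?k * osc (a i) z r)) + ?k * (Cp * r) * (\<Sum>x\<in>B z r. grad \<mu> (h n) x * m x)"
      by (simp add: distrib_left sum_distrib_left mult_ac)
    finally have "ennreal (?k * osc f z r) \<le> ennreal ((\<Sum>i\<le>n. \<bar>c i\<bar> * (?k * osc (a i) z r)) + ?k * (Cp * r) * (\<Sum>x\<in>B z r. grad \<mu> (h n) x * m x))"
      by (rule ennreal_leI)
    also have "\<dots> = ennreal (\<Sum>i\<le>n. \<bar>c i\<bar> * (?k * osc (a i) z r)) + ennreal (?k * (Cp * r)) * ennreal (\<Sum>x\<in>B z r. grad \<mu> (h n) x * m x)"
    proof -
      have "0 \<le> (\<Sum>i\<le>n. \<bar>c i\<bar> * (?k * osc (a i) z r))" using k by (intro sum_nonneg mult_nonneg_nonneg) auto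
      moreover have "0 \<le> ?k * (Cp * r)" using k Cp_pos r by simp
      moreover have "0 \<le> (\<Sum>x\<in>B z r. grad \<mu> (h n) x * m x)" by (intro sum_nonneg) auto
      ultimately show ?thesis by (simp only: ennreal_plus ennreal_mult mult_nonneg_nonneg)
    qed
    also have "\<dots> \<le> ?S + ennreal (?k * (Cp * r)) * Lp_norm \<mu> 1 (grad \<mu> (h n))"
    proof (intro add_mono mult_left_mono)
      have nn: "0 \<le> ?k * osc (a i) z r" for i by (intro mult_nonneg_nonneg k osc_nonneg)
      have "ennreal (\<Sum>i\<le>n. \<bar>c i\<bar> * (?k * osc (a i) z r)) = (\<Sum>i\<le>n. ennreal (\<bar>c i\<bar> * (?k * osc (a i) z r)))"
        by (intro sum_ennreal[symmetric] mult_nonneg_nonneg nn) simp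
      also have "\<dots> = (\<Sum>i\<le>n. ennreal \<bar>c i\<bar> * ennreal (?k * osc (a i) z r))"
        by (intro sum.cong refl ennreal_mult nn) simp
      also have "\<dots> \<le> (\<Sum>i\<le>n. ennreal \<bar>c i\<bar> * Nmax \<mu> (a i) x)"
        by (intro sum_mono mult_left_mono osc_le_Nmax r x) simp
      also have "\<dots> \<le> ?S" by (rule sum_le_suminf) auto
      finally show "ennreal (\<Sum>i\<le>n. \<bar>c i\<bar> * (?k * osc (a i) z r)) \<le> ?S" .
      have "ennreal (\<Sum>x\<in>B z r. grad \<mu> (h n) x * m x)
          = (\<integral>\<^sup>+x. ennreal (grad \<mu> (h n) x) * indicator (B z r) x \<partial>vmeasure \<mu>)"
        by (intro nn_integral_vmeasure_finite[symmetric]) auto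
      also have "\<dots> \<le> Lp_norm \<mu> 1 (grad \<mu> (h n))"
        unfolding Lp_norm_1 by (intro nn_integral_mono) (auto simp: indicator_def)
      finally show "ennreal (\<Sum>x\<in>B z r. grad \<mu> (h n) x * m x) \<le> Lp_norm \<mu> 1 (grad \<mu> (h n))" .
    qed simp
    finally show ?thesis .
  qed
  have "(\<lambda>n. Lp_norm \<mu> 1 (grad \<mu> (h n))) \<longlonglongrightarrow> 0"
    using dec unfolding atomic_decomp_def h_def by blast
  then have "(\<lambda>n. ?S + ennreal (?k * (Cp * r)) * Lp_norm \<mu> 1 (grad \<mu> (h n))) \<longlonglongrightarrow> ?S + ennreal (?k * (Cp * r)) * 0"
    by (intro tendsto_add tendsto_const ennreal_tendsto_cmult) auto
  then show "ennreal (?k * osc f z r) \<le> ?S"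
    using step by (intro LIMSEQ_le_const[where x = ?S]) auto
qed

lemma HSato_S_bound:
  assumes t: "1 < t"
  shows "\<exists>E>0. \<forall>f c a. atomic_decomp \<mu> t f c a \<longrightarrow> S_seminorm \<mu> f \<le> ennreal E * ennreal (\<Sum>i. \<bar>c i\<bar>)"
proof -
  obtain s where s: "1 < s" and at: "\<And>a. HS_atom \<mu> t a \<Longrightarrow> \<exists>z r. 0 < r \<and> (\<forall>x. x \<notin> B z r \<longrightarrow> a x = 0) \<and>
    (\<Sum>x\<in>B z r. a x * m x) = 0 \<and>
    (\<Sum>x\<in>B z (r + 1). grad \<mu> a x powr s * m x) \<le> Cd\<^sup>2 * V z r powr (1 - s)"
    using HS_atom_gradient_power[OF t] by blast
  define E where "E = max 1 (Cp * (2 * Cd\<^sup>2 + 4 * Cd ^ 4 / (1 - 2 powr (1 - s))) + 32 * Cp * (1 + Cd\<^sup>2) * Cd ^ 3)"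
  have E: "0 < E" by (simp add: E_def)
  have int: "(\<integral>\<^sup>+x. Nmax \<mu> a x \<partial>vmeasure \<mu>) \<le> ennreal E" if a: "HS_atom \<mu> t a" for a
  proof -
    obtain z r where zr: "0 < r" "\<And>x. x \<notin> B z r \<Longrightarrow> a x = 0" "(\<Sum>x\<in>B z r. a x * m x) = 0"
      "(\<Sum>x\<in>B z (r + 1). grad \<mu> a x powr s * m x) \<le> Cd\<^sup>2 * V z r powr (1 - s)"
      using at[OF a] by blast
    show ?thesis
      unfolding E_def
      by (rule order_trans[OF Nmax_atom_integral ennreal_leI[OF max.cobounded2]]) (fact s zr)+
  qed
  have "S_seminorm \<mu> f \<le> ennreal E * ennreal (\<Sum>i. \<bar>c i\<bar>)" if dec: "atomic_decomp \<mu> t f c a" for f c a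
  proof -
    have c: "summable (\<lambda>i. \<bar>c i\<bar>)" and a: "\<And>i. HS_atom \<mu> t (a i)"
      using dec by (auto simp: atomic_decomp_def)
    have "S_seminorm \<mu> f \<le> (\<integral>\<^sup>+x. (\<Sum>i. ennreal \<bar>c i\<bar> * Nmax \<mu> (a i) x) \<partial>vmeasure \<mu>)"
      unfolding S_seminorm_def by (intro nn_integral_mono atomic_decomp_Nmax_le[OF dec])
    also have "\<dots> = (\<Sum>i. ennreal \<bar>c i\<bar> * (\<integral>\<^sup>+x. Nmax \<mu> (a i) x \<partial>vmeasure \<mu>))"
      by (simp add: nn_integral_suminf nn_integral_cmult borel_measurable_vmeasure)
    also have "\<dots> \<le> (\<Sum>i. ennreal \<bar>c i\<bar> * ennreal E)"
      by (intro suminf_le mult_left_mono int a) auto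
    also have "\<dots> = (\<Sum>i. ennreal \<bar>c i\<bar>) * ennreal E" by simp
    also have "(\<Sum>i. ennreal \<bar>c i\<bar>) = ennreal (\<Sum>i. \<bar>c i\<bar>)" by (intro suminf_ennreal2 c) simp
    finally show ?thesis by (simp add: mult.commute)
  qed
  with E show ?thesis by blast
qed

end

section \<open>Equality of the spaces\<close>

context poincare_graph
begin

lemma HSato_embeds_S:
  assumes t: "1 < t"
  shows "embeds (HSato_space \<mu> t) (HSato_seminorm \<mu> t) (S_space \<mu>) (S_seminorm \<mu>)"
proof -
  obtain E where E: "0 < E"
    "\<And>f c a. atomic_decomp \<mu> t f c a \<Longrightarrow> S_seminorm \<mu> f \<le> ennreal E * ennreal (\<Sum>i. \<bar>c i\<bar>)"
    using HSato_S_bound[OF t] by blast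
  show ?thesis
  proof (rule embedsI[OF _ E(1)])
    show "HSato_space \<mu> t \<subseteq> S_space \<mu>"
      using E(2) by (force simp: HSato_space_def S_space_def ennreal_mult_less_top intro: le_less_trans)
    fix f
    show "S_seminorm \<mu> f \<le> ennreal E * HSato_seminorm \<mu> t f"
      unfolding HSato_seminorm_def
      by (intro ennreal_le_mult_INF E(1)) (use E(2) in auto)
  qed
qed

end

lemma poincare_graph_of_assms:
  assumes "weighted_graph \<mu>" "doubling \<mu>" "\<alpha> > 0" "Delta_cond \<mu> \<alpha>" "poincare1 \<mu>"
  shows "\<exists>Cd Cp. poincare_graph \<mu> Cd \<alpha> Cp"
proof -
  interpret weighted_graph \<mu> by fact
  obtain Cd where Cd: "\<And>x r. 0 < r \<Longrightarrow> V x (2 * r) \<le> Cd * V x r"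
    using assms(2) unfolding doubling_def by blast
  obtain Cp where Cp: "0 < Cp" "\<And>f z r. 0 < r \<Longrightarrow> osc f z r \<le> Cp * r * (\<Sum>x\<in>B z r. grad \<mu> f x * m x)"
    using assms(5) unfolding poincare1_def osc_def by blast
  have "poincare_graph \<mu> Cd \<alpha> Cp"
    by unfold_locales (use assms(3,4) Cd Cp in \<open>auto simp: Delta_cond_def\<close>)
  then show ?thesis by blast
qed

theorem theorem2p12:
  fixes \<mu> :: "'v \<Rightarrow> 'v \<Rightarrow> real" and \<alpha> :: real
  assumes "weighted_graph \<mu>"
    and "doubling \<mu>"
    and "\<alpha> > 0" and "Delta_cond \<mu> \<alpha>"
    and "poincare1 \<mu>"
  shows "(\<forall>t::ennreal. 1 < t \<longrightarrow>
            same_space (S_space \<mu>) (S_seminorm \<mu>) (M_space \<mu>) (M_seminorm \<mu>) \<and>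
            same_space (M_space \<mu>) (M_seminorm \<mu>) (HSmax_space \<mu>) (HSmax_seminorm \<mu>) \<and>
            same_space (HSmax_space \<mu>) (HSmax_seminorm \<mu>) (HSato_space \<mu> t) (HSato_seminorm \<mu> t)) \<and>
         (\<forall>t s::ennreal. 1 < t \<longrightarrow> 1 < s \<longrightarrow>
            same_space (HSato_space \<mu> t) (HSato_seminorm \<mu> t) (HSato_space \<mu> s) (HSato_seminorm \<mu> s))"
proof -
  obtain Cd Cp where "poincare_graph \<mu> Cd \<alpha> Cp"
    using poincare_graph_of_assms[OF assms] by blast
  then interpret poincare_graph \<mu> Cd \<alpha> Cp .
  note SM = S_embeds_M and MA = M_embeds_HSato and AS = HSato_embeds_S
    and SH = S_embeds_HSmax and HS = HSmax_embeds_S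
  \<comment> \<open>Any single exponent closes the cycle back to \<open>S\<close>; 2 is a
    sample.\<close>
  have MS: "embeds (M_space \<mu>) (M_seminorm \<mu>) (S_space \<mu>) (S_seminorm \<mu>)"
    by (rule embeds_trans[OF MA[of 2] AS]) auto
  have SA: "embeds (S_space \<mu>) (S_seminorm \<mu>) (HSato_space \<mu> t) (HSato_seminorm \<mu> t)" if "1 < t" for t
    by (rule embeds_trans[OF SM MA[OF that]])
  show ?thesis
    by (intro conjI allI impI same_spaceI SM MS
        embeds_trans[OF MS SH] embeds_trans[OF HS SM]
        embeds_trans[OF HS SA] embeds_trans[OF AS SH] embeds_trans[OF AS SA])
qed

end
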